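(* Let $\Gamma\subset \mathrm{SU}((2,1),\mathbb{C})$ be a discrete, torsion-free, cocompact subgroup and let $X_\Gamma=\Gamma\backslash\mathbb{B}^2$. There is a constant $c>0$ depending only on $X_\Gamma$ such that for every integer $k\ge 3$ and all $z,w\in X_\Gamma$, $$\big|\mathcal{B}_{\Lambda}^{k}(z,w)\big|_{\mathrm{hyp}}\le c\,\frac{k^{2}}{\cosh^{3k-8}\big(d_{\mathrm{hyp}}(z,w)/2\big)},$$ where $\mathcal{B}_\Lambda^k$ is the Bergman kernel of $H^0(X_\Gamma,\Lambda^{\otimes k})$, $\Lambda=\Omega^2_{X_\Gamma}$, and $d_{\mathrm{hyp}}(z,w)$ is the geodesic distance between $z$ and $w$ on $X_\Gamma$.
   Context: Let $\mathbb{B}^2=\{z=(z_1,z_2)^t\in\mathbb{C}^2: |z|^2=|z_1|^2+|z_2|^2<1\}$ and $H=\mathrm{diag}(1,1,-1)$. $\mathrm{SU}((2,1),\mathbb{C})=\{A\in\mathrm{SL}(3,\mathbb{C}): A^*HA=H\}$. An element $\gamma=\begin{pmatrix}A&B\\C&D\end{pmatrix}$ ($A$ of size $2\times2$, $B$ of size $2\times 1$, $C$ of size $1\times 2$, $D\in\mathbb{C}$) acts on $\mathbb{B}^2$ by $\gamma z=(Az+B)/(Cz+D)$. The group $\Gamma$ is discrete, torsion-free and cocompact, so $X_\Gamma=\Gamma\backslash\mathbb{B}^2$ is a compact complex surface. For $z,w\in\mathbb{B}^2$ put $\tilde z=(z_1,z_2,1)^t$ and $\langle\tilde z,\tilde w\rangle_{\mathrm{hyp}}=z_1\overline{w_1}+z_2\overline{w_2}-1$.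 The hyperbolic metric is $\mu_{\mathrm{hyp}}(z)=-\frac{i}{2}\partial\overline\partial\log(1-|z|^2)$, with volume form $\mu_{\mathrm{hyp}}^{\mathrm{vol}}(z)=(\frac i2)^2\frac{dz_1\wedge d\overline{z_1}\wedge dz_2\wedge d\overline{z_2}}{(1-|z|^2)^3}$. The hyperbolic distance on $\mathbb{B}^2$ is given by $$\cosh^2(d_{\mathrm{hyp}}(z,w)/2)=\frac{\langle\tilde z,\tilde w\rangle_{\mathrm{hyp}}\langle\tilde w,\tilde z\rangle_{\mathrm{hyp}}}{\langle\tilde z,\tilde z\rangle_{\mathrm{hyp}}\langle\tilde w,\tilde w\rangle_{\mathrm{hyp}}};$$ on $X_\Gamma$, $d_{\mathrm{hyp}}$ denotes the induced geodesic distance, i.e. $\min_{\gamma\in\Gamma}d_{\mathrm{hyp}}(z,\gamma w)$ for lifts $z,w\in\mathbb{B}^2$. $\Lambda=\Omega^2_{X_\Gamma}$ is the line bundle of holomorphic $(2,0)$-forms. $\mathcal{S}_m(\Gamma)$ is the space of holomorphic $f:\mathbb{B}^2\to\mathbb{C}$ with $f(\gamma z)=(Cz+D)^mf(z)$ for all $\gamma\in\Gamma$. Sections of $\Lambda^{\otimes k}$ are $\omega=f\,(dz_1\wedge dz_2)^{\otimes k}$ with $f\in\mathcal{S}_{3k}(\Gamma)$; the pointwise norm is $|\omega(z)|^2_{\mathrm{hyp}}=(1-|z|^2)^{3k}|f(z)|^2$, and the $L^2$ inner product is $\langle\omega,\eta\rangle_{\mathrm{hyp}}=\int_{\mathcal{F}_\Gamma}(1-|z|^2)^{3k}f(z)\overline{g(z)}\,\mu_{\mathrm{hyp}}^{\mathrm{vol}}(z)$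 for $\eta=g\,(dz_1\wedge dz_2)^{\otimes k}$, with $\mathcal{F}_\Gamma$ a fundamental domain. For an orthonormal basis $\omega_j=f_j\,(dz_1\wedge dz_2)^{\otimes k}$ of $H^0(X_\Gamma,\Lambda^{\otimes k})$, $\mathcal{B}_\Lambda^k(z,w)=\sum_j\omega_j(z)\overline{\omega_j(w)}$, and $|\mathcal{B}_\Lambda^k(z,w)|_{\mathrm{hyp}}=(1-|z|^2)^{3k/2}(1-|w|^2)^{3k/2}\big|\sum_jf_j(z)\overline{f_j(w)}\big|$. *)

theory Defs
  imports "HOL-Analysis.Analysis" "HOL-Algebra.Group_Action"
begin

section \<open>The group SU(2,1) and its action on the unit ball\<close>

definition adjoint_mat :: "complex^'n^'m \<Rightarrow> complex^'m^'n" where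
  "adjoint_mat A = (\<chi> i j. cnj (A $ j $ i))"

definition H21 :: "complex^3^3" where
  "H21 = (\<chi> i j. if i = j then (if i = 3 then -1 else 1) else 0)"

definition SU21 :: "(complex^3^3) monoid" where
  "SU21 = \<lparr>carrier = {A. det A = 1 \<and> adjoint_mat A ** H21 ** A = H21},
           mult = (**), one = mat 1\<rparr>"

definition unit_ball :: "(complex^2) set" where
  "unit_ball = {z. norm z < 1}"

definition lift :: "complex^2 \<Rightarrow> complex^3" where
  "lift z = vector [z $ 1, z $ 2, 1]"

text \<open>
  For \<open>\<gamma>\<close> with blocks \<open>A, B, C, D\<close>, the first two coordinates of \<open>\<gamma> *v lift z\<close> are \<open>Az + B\<close>
  and the third one is \<open>Cz + D\<close>.
\<close>

definition aut_factor :: "complex^3^3 \<Rightarrow> complex^2 \<Rightarrow> complex" where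
  "aut_factor \<gamma> z = (\<gamma> *v lift z) $ 3"

definition act :: "complex^3^3 \<Rightarrow> complex^2 \<Rightarrow> complex^2" where
  "act \<gamma> z = vector [(\<gamma> *v lift z) $ 1 / aut_factor \<gamma> z, (\<gamma> *v lift z) $ 2 / aut_factor \<gamma> z]"

definition torsion_free :: "(complex^3^3) set \<Rightarrow> bool" where
  "torsion_free \<Gamma> \<longleftrightarrow>
     (\<forall>\<gamma>\<in>\<Gamma>. \<forall>n::nat. n > 0 \<and> \<gamma> [^]\<^bsub>SU21\<^esub> n = \<one>\<^bsub>SU21\<^esub> \<longrightarrow> \<gamma> = \<one>\<^bsub>SU21\<^esub>)"

lemma group_SU21: "group SU21"
proof -
  have adj_mult: "adjoint_mat (A ** B) = adjoint_mat B ** adjoint_mat A" for A B :: "complex^3^3"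
    by (simp add: adjoint_mat_def matrix_matrix_mult_def vec_eq_iff mult.commute)
  have adj_one: "adjoint_mat (mat 1 :: complex^3^3) = mat 1"
    by (simp add: adjoint_mat_def mat_def vec_eq_iff)
  show ?thesis
  proof (rule groupI)
    fix A B assume "A \<in> carrier SU21" "B \<in> carrier SU21"
    then have A: "det A = 1" "adjoint_mat A ** H21 ** A = H21"
      and B: "det B = 1" "adjoint_mat B ** H21 ** B = H21"
      by (auto simp: SU21_def)
    have "adjoint_mat (A ** B) ** H21 ** (A ** B)
        = adjoint_mat B ** (adjoint_mat A ** H21 ** A) ** B"
      by (simp add: adj_mult matrix_mul_assoc)
    then show "A \<otimes>\<^bsub>SU21\<^esub> B \<in> carrier SU21"
      using A B by (simp add: SU21_def det_mul)
  next
    fix A assume "A \<in> carrier SU21"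
    then have A: "det A = 1" "adjoint_mat A ** H21 ** A = H21"
      by (auto simp: SU21_def)
    then have "invertible A"
      by (simp add: invertible_det_nz)
    then obtain B where B: "A ** B = mat 1" "B ** A = mat 1"
      unfolding invertible_def by auto
    have "det A * det B = 1"
      using B by (metis det_I det_mul)
    then have "det B = 1" using A by simp
    moreover have "adjoint_mat B ** H21 ** B = H21"
    proof -
      have "adjoint_mat B ** H21 ** B = adjoint_mat B ** (adjoint_mat A ** H21 ** A) ** B"
        by (simp add: A)
      also have "\<dots> = adjoint_mat (A ** B) ** H21 ** (A ** B)"
        by (simp add: adj_mult matrix_mul_assoc)
      finally show ?thesis by (simp add: B adj_one)
    qed
    ultimately show "\<exists>B\<in>carrier SU21. B \<otimes>\<^bsub>SU21\<^esub> A = \<one>\<^bsub>SU21\<^esub>"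
      using B by (auto simp: SU21_def)
  qed (auto simp: SU21_def matrix_mul_assoc adj_one)
qed

section \<open>The quotient of the ball\<close>

definition ball_quotient :: "(complex^3^3) set \<Rightarrow> (complex^2) set set" where
  "ball_quotient \<Gamma> = orbits (SU21\<lparr>carrier := \<Gamma>\<rparr>) unit_ball act"

text \<open>The quotient topology: a set of orbits is open iff its preimage (its union) is open.\<close>

definition ball_quotient_topology :: "(complex^3^3) set \<Rightarrow> (complex^2) set topology" where
  "ball_quotient_topology \<Gamma> =
     topology (\<lambda>U. U \<subseteq> ball_quotient \<Gamma> \<and> open {z \<in> unit_ball. orbit (SU21\<lparr>carrier := \<Gamma>\<rparr>) act z \<in> U})"

lemma openin_ball_quotient_topology:
  "openin (ball_quotient_topology \<Gamma>) U \<longleftrightarrow>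
     U \<subseteq> ball_quotient \<Gamma> \<and> open {z \<in> unit_ball. orbit (SU21\<lparr>carrier := \<Gamma>\<rparr>) act z \<in> U}"
proof -
  define p where "p = orbit (SU21\<lparr>carrier := \<Gamma>\<rparr>) act"
  have "istopology (\<lambda>U. U \<subseteq> ball_quotient \<Gamma> \<and> open {z \<in> unit_ball. p z \<in> U})"
    unfolding istopology_def
  proof (intro conjI allI impI)
    fix S T
    assume "S \<subseteq> ball_quotient \<Gamma> \<and> open {z \<in> unit_ball. p z \<in> S}"
      and "T \<subseteq> ball_quotient \<Gamma> \<and> open {z \<in> unit_ball. p z \<in> T}"
    moreover have "{z \<in> unit_ball. p z \<in> S \<inter> T}
        = {z \<in> unit_ball. p z \<in> S} \<inter> {z \<in> unit_ball. p z \<in> T}" by auto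
    ultimately show "S \<inter> T \<subseteq> ball_quotient \<Gamma>" "open {z \<in> unit_ball. p z \<in> S \<inter> T}"
      by auto
  next
    fix \<K> assume K: "\<forall>S\<in>\<K>. S \<subseteq> ball_quotient \<Gamma> \<and> open {z \<in> unit_ball. p z \<in> S}"
    then show "\<Union>\<K> \<subseteq> ball_quotient \<Gamma>" by auto
    have "{z \<in> unit_ball. p z \<in> \<Union>\<K>} = (\<Union>S\<in>\<K>. {z \<in> unit_ball. p z \<in> S})" by auto
    then show "open {z \<in> unit_ball. p z \<in> \<Union>\<K>}" using K by auto
  qed
  then show ?thesis
    unfolding ball_quotient_topology_def p_def by (simp add: topology_inverse')
qed

definition cocompact :: "(complex^3^3) set \<Rightarrow> bool" where
  "cocompact \<Gamma> \<longleftrightarrow> compact_space (ball_quotient_topology \<Gamma>)"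

section \<open>Hyperbolic distance and volume\<close>

definition hyp_form :: "complex^2 \<Rightarrow> complex^2 \<Rightarrow> complex" where
  "hyp_form z w = z $ 1 * cnj (w $ 1) + z $ 2 * cnj (w $ 2) - 1"

definition hyp_dist :: "complex^2 \<Rightarrow> complex^2 \<Rightarrow> real" where
  "hyp_dist z w =
     2 * arcosh (sqrt (Re ((hyp_form z w * hyp_form w z) / (hyp_form z z * hyp_form w w))))"

definition quotient_dist :: "(complex^3^3) set \<Rightarrow> complex^2 \<Rightarrow> complex^2 \<Rightarrow> real" where
  "quotient_dist \<Gamma> z w = (INF \<gamma>\<in>\<Gamma>. hyp_dist z (act \<gamma> w))"

lemma hyp_form_self: "hyp_form z z = of_real ((norm z)\<^sup>2 - 1)"
proof -
  have "(norm z)\<^sup>2 = (cmod (z $ 1))\<^sup>2 + (cmod (z $ 2))\<^sup>2"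
    by (simp add: norm_vec_def L2_set_def sum_2)
  then show ?thesis
    by (simp only: hyp_form_def complex_norm_square [symmetric] of_real_diff of_real_add of_real_1)
qed

lemma cosh_hyp_dist:
  assumes "z \<in> unit_ball" "w \<in> unit_ball"
  shows "hyp_dist z w \<ge> 0"
    and "of_real ((cosh (hyp_dist z w / 2))\<^sup>2)
           = (hyp_form z w * hyp_form w z) / (hyp_form z z * hyp_form w w)"
proof -
  define r where "r = (cmod (hyp_form z w))\<^sup>2 / (((norm z)\<^sup>2 - 1) * ((norm w)\<^sup>2 - 1))"
  have "hyp_form w z = cnj (hyp_form z w)"
    by (simp add: hyp_form_def mult.commute)
  then have r: "(hyp_form z w * hyp_form w z) / (hyp_form z z * hyp_form w w) = of_real r"
    by (simp only: r_def hyp_form_self complex_norm_square of_real_divide of_real_mult)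
  define a b where "a = norm z" and "b = norm w"
  have ab: "0 \<le> a" "a < 1" "0 \<le> b" "b < 1"
    using assms by (auto simp: a_def b_def unit_ball_def)
  define s where "s = z $ 1 * cnj (w $ 1) + z $ 2 * cnj (w $ 2)"
  have "cmod s \<le> cmod (z $ 1) * cmod (w $ 1) + cmod (z $ 2) * cmod (w $ 2)"
    unfolding s_def by (metis complex_mod_cnj norm_mult norm_triangle_ineq)
  also have "\<dots> = (\<Sum>i\<in>UNIV. \<bar>cmod (z $ i)\<bar> * \<bar>cmod (w $ i)\<bar>)"
    by (simp add: sum_2)
  also have "\<dots> \<le> a * b"
    unfolding a_def b_def norm_vec_def by (rule L2_set_mult_ineq)
  finally have s: "cmod s \<le> a * b" .
  have "a * b \<le> 1"
    using ab by (simp add: mult_le_one)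
  moreover have "1 - cmod s \<le> cmod (hyp_form z w)"
    using norm_triangle_ineq2 [of 1 s] unfolding hyp_form_def s_def
    by (metis norm_minus_commute norm_one)
  ultimately have "(1 - a * b)\<^sup>2 \<le> (cmod (hyp_form z w))\<^sup>2"
    using s by (intro power_mono) auto
  moreover have "(a\<^sup>2 - 1) * (b\<^sup>2 - 1) = (1 - a * b)\<^sup>2 - (a - b)\<^sup>2"
    by (simp add: power2_eq_square algebra_simps)
  ultimately have le: "(a\<^sup>2 - 1) * (b\<^sup>2 - 1) \<le> (cmod (hyp_form z w))\<^sup>2"
    by (smt (verit) zero_le_power2)
  have "0 < (a\<^sup>2 - 1) * (b\<^sup>2 - 1)"
    using ab by (intro mult_neg_neg) (simp_all add: power_less_one_iff)
  then have "r \<ge> 1"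
    using le by (simp add: r_def a_def b_def)
  then show "hyp_dist z w \<ge> 0"
    and "of_real ((cosh (hyp_dist z w / 2))\<^sup>2)
           = (hyp_form z w * hyp_form w z) / (hyp_form z z * hyp_form w w)"
    by (simp_all add: hyp_dist_def r)
qed

text \<open>
  The form \<open>(i/2)\<^sup>2 dz\<^sub>1 \<and> d(cnj z\<^sub>1) \<and> dz\<^sub>2 \<and> d(cnj z\<^sub>2)\<close> is Lebesgue measure on \<open>complex^2\<close>, viewed as
  real 4-space.
\<close>

definition hyp_volume :: "(complex^2) measure" where
  "hyp_volume = density lborel (\<lambda>z. indicator unit_ball z * ennreal (1 / (1 - (norm z)\<^sup>2) ^ 3))"

definition fundamental_domain :: "(complex^3^3) set \<Rightarrow> (complex^2) set \<Rightarrow> bool" where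
  "fundamental_domain \<Gamma> F \<longleftrightarrow>
     F \<in> sets borel \<and> F \<subseteq> unit_ball \<and> (\<Union>\<gamma>\<in>\<Gamma>. act \<gamma> ` F) = unit_ball \<and>
     (\<forall>\<gamma>\<in>\<Gamma>. \<gamma> \<noteq> mat 1 \<longrightarrow> F \<inter> act \<gamma> ` F \<in> null_sets lborel)"

definition fund_dom :: "(complex^3^3) set \<Rightarrow> (complex^2) set" where
  "fund_dom \<Gamma> = (SOME F. fundamental_domain \<Gamma> F)"

section \<open>Automorphic forms and the Bergman kernel\<close>

definition holomorphic2_on :: "(complex^2 \<Rightarrow> complex) \<Rightarrow> (complex^2) set \<Rightarrow> bool" where
  "holomorphic2_on f S \<longleftrightarrow>
     (\<forall>z\<in>S. \<exists>f'. (f has_derivative f') (at z) \<and> (\<forall>c v. f' (c *s v) = c * f' v))"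

text \<open>
  Functions on the ball are represented by functions on \<open>complex^2\<close> that vanish outside the ball,
  so that equality of functions is equality on the ball.
\<close>

definition aut_forms :: "nat \<Rightarrow> (complex^3^3) set \<Rightarrow> (complex^2 \<Rightarrow> complex) set" where
  "aut_forms m \<Gamma> =
     {f. holomorphic2_on f unit_ball \<and>
         (\<forall>\<gamma>\<in>\<Gamma>. \<forall>z\<in>unit_ball. f (act \<gamma> z) = aut_factor \<gamma> z ^ m * f z) \<and>
         (\<forall>z. z \<notin> unit_ball \<longrightarrow> f z = 0)}"

text \<open>
  Sections \<open>f (dz\<^sub>1 \<and> dz\<^sub>2)\<^sup>k\<close> of the \<open>k\<close>-th power of the canonical bundle are represented by their
  coefficient functions \<open>f\<close>, which range over \<open>aut_forms (3 * k) \<Gamma>\<close>.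
\<close>

definition form_inner ::
  "(complex^3^3) set \<Rightarrow> nat \<Rightarrow> (complex^2 \<Rightarrow> complex) \<Rightarrow> (complex^2 \<Rightarrow> complex) \<Rightarrow> complex" where
  "form_inner \<Gamma> k f g =
     set_lebesgue_integral hyp_volume (fund_dom \<Gamma>)
       (\<lambda>z. of_real ((1 - (norm z)\<^sup>2) ^ (3 * k)) * f z * cnj (g z))"

definition orthonormal_basis ::
  "(complex^3^3) set \<Rightarrow> nat \<Rightarrow> (complex^2 \<Rightarrow> complex) set \<Rightarrow> bool" where
  "orthonormal_basis \<Gamma> k E \<longleftrightarrow>
     finite E \<and> E \<subseteq> aut_forms (3 * k) \<Gamma> \<and>
     (\<forall>f\<in>E. \<forall>g\<in>E. form_inner \<Gamma> k f g = (if f = g then 1 else 0)) \<and>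
     (\<forall>g\<in>aut_forms (3 * k) \<Gamma>. \<exists>a. g = (\<lambda>z. \<Sum>f\<in>E. a f * f z))"

text \<open>
  The choices of fundamental domain and of orthonormal basis are immaterial. Because they are made
  by \<open>SOME\<close>, any estimate of \<open>bergman_kernel\<close> needs the existence of both.
\<close>

definition bergman_kernel ::
  "(complex^3^3) set \<Rightarrow> nat \<Rightarrow> complex^2 \<Rightarrow> complex^2 \<Rightarrow> complex" where
  "bergman_kernel \<Gamma> k z w = (\<Sum>f\<in>(SOME E. orthonormal_basis \<Gamma> k E). f z * cnj (f w))"

definition bergman_norm ::
  "(complex^3^3) set \<Rightarrow> nat \<Rightarrow> complex^2 \<Rightarrow> complex^2 \<Rightarrow> real" where
  "bergman_norm \<Gamma> k z w =
     (1 - (norm z)\<^sup>2) powr (3 * real k / 2) * (1 - (norm w)\<^sup>2) powr (3 * real k / 2) *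
     cmod (bergman_kernel \<Gamma> k z w)"

end

theory Submission
  imports Defs "HOL-Complex_Analysis.Cauchy_Integral_Formula"
begin

text \<open>
  Write \<open>m = 3k\<close>, let \<open>\<langle>x,y\<rangle>\<close> be the Hermitian form of signature \<open>(2,1)\<close> on \<open>complex^3\<close>, and let \<open>\<mu>\<close> be the
  hyperbolic volume. The proof compares the Bergman kernel of the quotient with the Poincare series
  \<open>Q\<^sub>z(w) = \<Sum>\<gamma>. (-\<langle>\<gamma> w, z\<rangle>)\<^bsup>-m\<^esup>\<close> (points being lifted to \<open>complex^3\<close>), whose summands are
  translates of the Bergman kernel of the ball.

  On the ball, a holomorphic \<open>f\<close> with \<open>(1 - |u|\<^sup>2)\<^bsup>m/2\<^esup> |f|\<close> bounded satisfies
  \<open>V\<^sub>m f(z) = \<integral> (1 - |u|\<^sup>2)\<^bsup>m\<^esup> f(u) (-\<langle>z,u\<rangle>)\<^bsup>-m\<^esup> d\<mu>(u)\<close> with \<open>V\<^sub>m = \<integral> (1 - |u|\<^sup>2)\<^bsup>m\<^esup> d\<mu>\<close>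
  (\<open>reproducing_formula\<close>). At \<open>z = 0\<close> this is the mean value property on circles \<open>\<zeta> \<mapsto> \<zeta> u\<close>
  (\<open>mean_value_ball\<close>); the general case follows by moving \<open>0\<close> to \<open>z\<close>, because \<open>\<mu>\<close> is invariant
  (\<open>distr_hyp_volume\<close>). If \<open>f\<close> is automorphic, unfolding the integral over the translates of a
  fundamental domain (\<open>integral_unfolding\<close>) turns the formula into \<open>V\<^sub>m f(z) = (f, Q\<^sub>z)\<close>, with
  the inner product of forms (\<open>reproducing_kernel\<close>). Since \<open>Q\<^sub>z\<close> is itself an automorphic form (\<open>poincare_aut_form\<close>),
  expanding it in an orthonormal basis shows that the Bergman kernel is the complex conjugate of
  \<open>Q\<^sub>z(w) / V\<^sub>m\<close> (\<open>bergman_kernel_eq\<close>).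

  The \<open>\<gamma>\<close>-th summand of \<open>Q\<^sub>z(w)\<close> has hyperbolic norm exactly \<open>cosh\<^bsup>-m\<^esup>(d(z, \<gamma>w)/2)\<close>
  (\<open>poincare_le_cosh_sum\<close>). Each of these \<open>cosh\<close> is at least that of the distance on the quotient, so
  \<open>m - 8\<close> of the \<open>m\<close> factors can be pulled out of the sum, and what remains is at most
  \<open>\<Sum>\<gamma>. cosh\<^bsup>-6\<^esup>(d(z, \<gamma>w)/2)\<close>. This is bounded uniformly in \<open>z\<close> and \<open>w\<close>
  (\<open>uniform_lattice_sum\<close>): by cocompactness \<open>z\<close> and \<open>w\<close> may be moved into a ball of radius
  \<open>r < 1\<close>, where the sum is comparable with \<open>\<Sum>\<gamma>. |\<gamma>\<^sub>3\<^sub>3|\<^bsup>-6\<^esup>\<close>; and that series converges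
  because unfolding \<open>\<integral> (1 - |u|\<^sup>2)\<^sup>3 d\<mu>\<close>, the Euclidean volume of the ball, produces it up to positive
  factors (\<open>summable_lattice\<close>). The factor \<open>k\<^sup>2\<close> comes from \<open>V\<^sub>m \<ge> const / m\<^sup>2\<close> (\<open>weight_volume_ge\<close>).

  Two objects have to be shown to exist. A fundamental domain is built from a countable
  cover by open sets that are disjoint from their translates; these exist because torsion-freeness
  makes the action free. An orthonormal basis exists because Bessel's inequality against \<open>Q\<^sub>z\<close> bounds the number of
  orthonormal forms, so that a largest orthonormal set exists, and it must span.
\<close>

section \<open>The Hermitian form and the action on the ball\<close>

text \<open>
  Working with the form on all of \<open>complex^3\<close>, rather than with \<open>hyp_form\<close> on the ball, makes the
  invariance under \<open>SU21\<close> linear; the transformation rules on the ball are then read off from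
  \<open>\<gamma> *v lift z = aut_factor \<gamma> z *s lift (act \<gamma> z)\<close>.
\<close>

definition hform :: "complex^3 \<Rightarrow> complex^3 \<Rightarrow> complex" where
  "hform x y = x $ 1 * cnj (y $ 1) + x $ 2 * cnj (y $ 2) - x $ 3 * cnj (y $ 3)"

lemma lift_nth [simp]: "lift z $ 1 = z $ 1" "lift z $ 2 = z $ 2" "lift z $ 3 = 1"
  by (simp_all add: lift_def)

lemma norm_complex2: "(norm z)\<^sup>2 = (cmod (z $ 1))\<^sup>2 + (cmod (z $ 2))\<^sup>2" for z :: "complex^2"
  by (simp add: norm_vec_def L2_set_def sum_2)

lemma hform_lift: "hform (lift z) (lift w) = hyp_form z w"
  by (simp add: hform_def hyp_form_def)

lemma cnj_hyp_form: "cnj (hyp_form z w) = hyp_form w z"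
  by (simp add: hyp_form_def mult.commute)

lemma hform_scale: "hform (a *s x) (b *s y) = a * cnj b * hform x y"
  by (simp add: hform_def algebra_simps)

lemma SU21_iff: "\<gamma> \<in> carrier SU21 \<longleftrightarrow> det \<gamma> = 1 \<and> adjoint_mat \<gamma> ** H21 ** \<gamma> = H21"
  by (simp add: SU21_def)

lemma SU21_mult [simp]: "\<gamma> \<otimes>\<^bsub>SU21\<^esub> \<delta> = \<gamma> ** \<delta>"
  and SU21_one [simp]: "\<one>\<^bsub>SU21\<^esub> = mat 1"
  by (simp_all add: SU21_def)

lemma adj_H_entry:
  "(adjoint_mat A ** H21 ** A) $ i $ j =
     cnj (A$1$i) * A$1$j + cnj (A$2$i) * A$2$j - cnj (A$3$i) * A$3$j" for A :: "complex^3^3"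
  by (simp add: matrix_matrix_mult_def adjoint_mat_def H21_def sum_3)

lemma SU21_columns:
  assumes "\<gamma> \<in> carrier SU21"
  shows "cnj (\<gamma>$1$i) * \<gamma>$1$j + cnj (\<gamma>$2$i) * \<gamma>$2$j - cnj (\<gamma>$3$i) * \<gamma>$3$j = H21 $ i $ j"
  using assms adj_H_entry by (metis SU21_iff)

lemma SU21I:
  assumes "det \<gamma> = 1"
    and "\<And>i j. cnj (\<gamma>$1$i) * \<gamma>$1$j + cnj (\<gamma>$2$i) * \<gamma>$2$j - cnj (\<gamma>$3$i) * \<gamma>$3$j = H21 $ i $ j"
  shows "\<gamma> \<in> carrier SU21"
  using assms by (simp add: SU21_iff vec_eq_iff adj_H_entry)

lemma hform_invariant:
  assumes "\<gamma> \<in> carrier SU21"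
  shows "hform (\<gamma> *v x) (\<gamma> *v y) = hform x y"
proof -
  have "hform (\<gamma> *v x) (\<gamma> *v y) =
     (\<Sum>i\<in>UNIV. \<Sum>j\<in>UNIV. x $ j * cnj (y $ i) *
       (cnj (\<gamma>$1$i) * \<gamma>$1$j + cnj (\<gamma>$2$i) * \<gamma>$2$j - cnj (\<gamma>$3$i) * \<gamma>$3$j))"
    by (simp add: hform_def matrix_vector_mult_def sum_3 algebra_simps)
  also have "\<dots> = hform x y"
    unfolding SU21_columns[OF assms] by (simp add: sum_3 H21_def hform_def)
  finally show ?thesis .
qed

abbreviation inverse21 :: "complex^3^3 \<Rightarrow> complex^3^3" where
  "inverse21 \<gamma> \<equiv> inv\<^bsub>SU21\<^esub> \<gamma>"

lemma SU21_closed: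
  assumes "\<gamma> \<in> carrier SU21"
  shows "inverse21 \<gamma> \<in> carrier SU21" "\<gamma> ** inverse21 \<gamma> = mat 1" "inverse21 \<gamma> ** \<gamma> = mat 1"
  using assms group.inv_closed[OF group_SU21] group.r_inv[OF group_SU21] group.l_inv[OF group_SU21]
  by auto

lemma hform_adjoint:
  assumes "\<gamma> \<in> carrier SU21"
  shows "hform (\<gamma> *v x) y = hform x (inverse21 \<gamma> *v y)"
proof -
  have "y = \<gamma> *v (inverse21 \<gamma> *v y)"
    using SU21_closed[OF assms] by (simp add: matrix_vector_mul_assoc)
  then show ?thesis using hform_invariant[OF assms] by metis
qed

lemma hyp_form_bounds:
  assumes "w \<in> unit_ball" "u \<in> unit_ball"
  shows "1 - norm w \<le> cmod (hyp_form w u)" "cmod (hyp_form w u) \<le> 2"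
    "1 - norm u \<le> cmod (hyp_form w u)"
proof -
  define s where "s = w $ 1 * cnj (u $ 1) + w $ 2 * cnj (u $ 2)"
  have "cmod s \<le> cmod (w $ 1) * cmod (u $ 1) + cmod (w $ 2) * cmod (u $ 2)"
    unfolding s_def by (metis complex_mod_cnj norm_mult norm_triangle_ineq)
  also have "\<dots> = (\<Sum>i\<in>UNIV. \<bar>cmod (w $ i)\<bar> * \<bar>cmod (u $ i)\<bar>)"
    by (simp add: sum_2)
  also have "\<dots> \<le> norm w * norm u"
    unfolding norm_vec_def by (rule L2_set_mult_ineq)
  finally have s: "cmod s \<le> norm w * norm u" .
  have "norm w * norm u \<le> norm w" "norm w * norm u \<le> norm u" "norm w < 1" "norm u < 1"
    using assms mult_left_mono[of "norm u" 1 "norm w"] mult_right_mono[of "norm w" 1 "norm u"]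
    by (auto simp: unit_ball_def)
  moreover have "cmod (hyp_form w u) = cmod (1 - s)"
    unfolding hyp_form_def s_def by (metis norm_minus_commute)
  moreover have "1 - cmod s \<le> cmod (1 - s)" "cmod (1 - s) \<le> 1 + cmod s"
    using norm_triangle_ineq2[of 1 s] norm_triangle_ineq4[of 1 s] by auto
  ultimately show "1 - norm w \<le> cmod (hyp_form w u)" "cmod (hyp_form w u) \<le> 2"
    "1 - norm u \<le> cmod (hyp_form w u)"
    using s by linarith+
qed

text \<open>
  Negative vectors lie off the plane at infinity; this is what makes the action on the ball well defined.
\<close>

lemma third_coordinate_nonzero:
  assumes "hform x x = of_real r" "r < 0"
  shows "x $ 3 \<noteq> 0"
proof
  assume "x $ 3 = 0"
  then have "hform x x = of_real ((cmod (x$1))\<^sup>2 + (cmod (x$2))\<^sup>2)"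
    by (simp add: hform_def complex_norm_square[symmetric] del: of_real_power)
  then have "r = (cmod (x$1))\<^sup>2 + (cmod (x$2))\<^sup>2"
    using assms(1) of_real_eq_iff[where 'a = complex] by metis
  then show False using assms(2) by (smt (verit) zero_le_power2)
qed

lemma unit_ball_sq: "z \<in> unit_ball \<longleftrightarrow> (norm z)\<^sup>2 < 1" for z :: "complex^2"
  by (simp add: unit_ball_def power_less_one_iff abs_square_less_1)

lemma unit_ball_eq: "unit_ball = ball 0 1"
  by (auto simp: unit_ball_def)

lemma open_unit_ball: "open unit_ball"
  by (simp add: unit_ball_eq)

lemma aut_factor_nonzero:
  assumes "\<gamma> \<in> carrier SU21" "z \<in> unit_ball"
  shows "aut_factor \<gamma> z \<noteq> 0"
proof -
  have "hform (\<gamma> *v lift z) (\<gamma> *v lift z) = of_real ((norm z)\<^sup>2 - 1)"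
    using hform_invariant[OF assms(1)] by (simp add: hform_lift hyp_form_self)
  then show ?thesis unfolding aut_factor_def
    by (rule third_coordinate_nonzero) (use assms(2) in \<open>simp add: unit_ball_sq\<close>)
qed

lemma lift_act:
  assumes "\<gamma> \<in> carrier SU21" "z \<in> unit_ball"
  shows "\<gamma> *v lift z = aut_factor \<gamma> z *s lift (act \<gamma> z)"
  using aut_factor_nonzero[OF assms]
  by (simp add: vec_eq_iff forall_3 act_def) (simp add: aut_factor_def)

lemma hyp_form_act:
  assumes "\<gamma> \<in> carrier SU21" "z \<in> unit_ball" "w \<in> unit_ball"
  shows "aut_factor \<gamma> z * cnj (aut_factor \<gamma> w) * hyp_form (act \<gamma> z) (act \<gamma> w) = hyp_form z w"
  using hform_invariant[OF assms(1), of "lift z" "lift w"]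
  by (simp add: lift_act[OF assms(1)] assms hform_scale hform_lift)

abbreviation defect :: "complex^2 \<Rightarrow> real" where
  "defect z \<equiv> 1 - (norm z)\<^sup>2"

lemma one_minus_norm_act:
  assumes "\<gamma> \<in> carrier SU21" "z \<in> unit_ball"
  shows "(cmod (aut_factor \<gamma> z))\<^sup>2 * (defect (act \<gamma> z)) = defect z"
proof -
  have "(of_real ((cmod (aut_factor \<gamma> z))\<^sup>2 * ((norm (act \<gamma> z))\<^sup>2 - 1)) :: complex) = of_real ((norm z)\<^sup>2 - 1)"
    using hyp_form_act[OF assms assms(2)]
    unfolding hyp_form_self complex_norm_square[symmetric] by (metis of_real_mult)
  then have "(cmod (aut_factor \<gamma> z))\<^sup>2 * ((norm (act \<gamma> z))\<^sup>2 - 1) = (norm z)\<^sup>2 - 1"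
    using of_real_eq_iff by blast
  then show ?thesis by (simp add: algebra_simps)
qed

lemma act_in_ball:
  assumes "\<gamma> \<in> carrier SU21" "z \<in> unit_ball"
  shows "act \<gamma> z \<in> unit_ball"
proof -
  have "0 < (cmod (aut_factor \<gamma> z))\<^sup>2 * defect (act \<gamma> z)"
    using assms by (simp add: one_minus_norm_act unit_ball_sq)
  then show ?thesis
    by (simp add: unit_ball_sq zero_less_mult_iff)
qed

lemma cocycle:
  assumes "\<gamma> \<in> carrier SU21" "\<delta> \<in> carrier SU21" "z \<in> unit_ball"
  shows aut_factor_mult: "aut_factor (\<gamma> ** \<delta>) z = aut_factor \<gamma> (act \<delta> z) * aut_factor \<delta> z"
    and act_mult: "act (\<gamma> ** \<delta>) z = act \<gamma> (act \<delta> z)"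
proof -
  have *: "(\<gamma> ** \<delta>) *v lift z = aut_factor \<delta> z *s (\<gamma> *v lift (act \<delta> z))"
    using assms by (simp add: matrix_vector_mul_assoc[symmetric] lift_act vector_scalar_commute)
  show "aut_factor (\<gamma> ** \<delta>) z = aut_factor \<gamma> (act \<delta> z) * aut_factor \<delta> z"
    using * by (simp add: aut_factor_def)
  then show "act (\<gamma> ** \<delta>) z = act \<gamma> (act \<delta> z)"
    using aut_factor_nonzero[OF assms(2,3)] * by (simp add: act_def)
qed

lemma act_one [simp]: "act (mat 1) z = z" and aut_factor_one [simp]: "aut_factor (mat 1) z = 1"
  by (simp_all add: act_def aut_factor_def vec_eq_iff forall_2)

lemma act_inverse:
  assumes "\<gamma> \<in> carrier SU21" "z \<in> unit_ball"
  shows "act \<gamma> (act (inverse21 \<gamma>) z) = z" "act (inverse21 \<gamma>) (act \<gamma> z) = z"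
    "aut_factor \<gamma> (act (inverse21 \<gamma>) z) * aut_factor (inverse21 \<gamma>) z = 1"
  using assms SU21_closed[OF assms(1)] act_mult aut_factor_mult
  by (metis act_one aut_factor_one)+

lemma act_bij: "\<gamma> \<in> carrier SU21 \<Longrightarrow> bij_betw (act \<gamma>) unit_ball unit_ball"
  by (rule bij_betw_byWitness[where f' = "act (inverse21 \<gamma>)"])
    (auto simp: act_inverse act_in_ball SU21_closed)

lemma act_image_eq_vimage:
  assumes "\<gamma> \<in> carrier SU21" "A \<subseteq> unit_ball"
  shows "act \<gamma> ` A = {z \<in> unit_ball. act (inverse21 \<gamma>) z \<in> A}"
proof -
  have "z \<in> act \<gamma> ` A" if "z \<in> unit_ball" "act (inverse21 \<gamma>) z \<in> A" for z
    using that act_inverse(1)[OF assms(1)] by (metis imageI)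
  then show ?thesis
    using assms by (auto simp: act_in_ball act_inverse subsetD)
qed

section \<open>Controlling a group element by its last entry\<close>

lemma zero_in_ball [simp]: "0 \<in> unit_ball"
  by (simp add: unit_ball_def)

lemma aut_factor_zero: "aut_factor \<gamma> 0 = \<gamma>$3$3"
  by (simp add: aut_factor_def matrix_vector_mult_def sum_3)

lemma aut_factor_eq_hform: "aut_factor \<gamma> z = - hform (\<gamma> *v lift z) (lift 0)"
  by (simp add: aut_factor_def hform_def)

text \<open>
  Pairing \<open>\<gamma> *v lift z\<close> with the lift of the origin and moving \<open>\<gamma>\<close> to the other side expresses
  \<open>aut_factor \<gamma> z\<close> through values at the origin. The bounds on automorphy factors come from this
  identity together with \<open>hyp_form_bounds\<close>.
\<close>

lemma aut_factor_inverse: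
  assumes "\<gamma> \<in> carrier SU21" "z \<in> unit_ball"
  shows "aut_factor \<gamma> z = - (cnj (aut_factor (inverse21 \<gamma>) 0) * hyp_form z (act (inverse21 \<gamma>) 0))"
proof -
  have "hform (\<gamma> *v lift z) (lift 0) = hform (1 *s lift z) (inverse21 \<gamma> *v lift 0)"
    using hform_adjoint[OF assms(1)] by simp
  also have "\<dots> = cnj (aut_factor (inverse21 \<gamma>) 0) * hyp_form z (act (inverse21 \<gamma>) 0)"
    unfolding lift_act[OF SU21_closed(1)[OF assms(1)] zero_in_ball] hform_scale by (simp add: hform_lift)
  finally show ?thesis
    using aut_factor_eq_hform[of \<gamma> z] by simp
qed

lemma hyp_form_zero [simp]: "hyp_form 0 w = -1" "hyp_form w 0 = -1"
  by (simp_all add: hyp_form_def)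

lemma inverse_33: "\<gamma> \<in> carrier SU21 \<Longrightarrow> inverse21 \<gamma> $ 3 $ 3 = cnj (\<gamma>$3$3)"
  using aut_factor_inverse[of \<gamma> 0] by (simp add: aut_factor_zero)

lemma aut_factor_bounds:
  assumes "\<gamma> \<in> carrier SU21" "z \<in> unit_ball"
  shows "cmod (\<gamma>$3$3) * (1 - norm z) \<le> cmod (aut_factor \<gamma> z)"
    "cmod (aut_factor \<gamma> z) \<le> 2 * cmod (\<gamma>$3$3)"
proof -
  have u: "act (inverse21 \<gamma>) 0 \<in> unit_ball" using assms by (simp add: act_in_ball SU21_closed)
  have e: "cmod (aut_factor \<gamma> z) = cmod (\<gamma>$3$3) * cmod (hyp_form z (act (inverse21 \<gamma>) 0))"
    unfolding aut_factor_inverse[OF assms] using assms by (simp add: aut_factor_zero inverse_33 norm_mult)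
  show "cmod (\<gamma>$3$3) * (1 - norm z) \<le> cmod (aut_factor \<gamma> z)"
    unfolding e using hyp_form_bounds(1)[OF assms(2) u] by (intro mult_left_mono) auto
  show "cmod (aut_factor \<gamma> z) \<le> 2 * cmod (\<gamma>$3$3)"
    unfolding e using hyp_form_bounds(2)[OF assms(2) u] mult_left_mono[of _ 2 "cmod (\<gamma>$3$3)"]
    by (simp add: mult.commute)
qed

lemma SU21_33_ge_1:
  assumes "\<gamma> \<in> carrier SU21"
  shows "1 \<le> cmod (\<gamma>$3$3)"
proof -
  have "(cmod (\<gamma>$3$3))\<^sup>2 * (defect (act \<gamma> 0)) = 1"
    using one_minus_norm_act[OF assms zero_in_ball] by (simp add: aut_factor_zero)
  moreover have "(cmod (\<gamma>$3$3))\<^sup>2 * (defect (act \<gamma> 0)) \<le> (cmod (\<gamma>$3$3))\<^sup>2 * 1"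
    by (intro mult_left_mono) auto
  ultimately have "1\<^sup>2 \<le> (cmod (\<gamma>$3$3))\<^sup>2" by simp
  then show ?thesis using norm_ge_zero power2_le_imp_le by blast
qed

lemma hyp_form_act_lower:
  assumes "\<gamma> \<in> carrier SU21" "z \<in> unit_ball" "w \<in> unit_ball"
  shows "cmod (\<gamma>$3$3) * (1 - norm z) * (1 - norm w) \<le> cmod (aut_factor \<gamma> w) * cmod (hyp_form (act \<gamma> w) z)"
proof -
  have "cmod (\<gamma>$3$3) * (1 - norm w) * (1 - norm z) \<le> cmod (aut_factor \<gamma> w) * cmod (hyp_form (act \<gamma> w) z)"
    using aut_factor_bounds(1)[OF assms(1,3)] hyp_form_bounds(3)[OF act_in_ball[OF assms(1,3)] assms(2)]
      assms by (intro mult_mono) (auto simp: unit_ball_def)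
  then show ?thesis by (simp add: ac_simps)
qed

text \<open>
  The columns of \<open>\<gamma>\<close> have \<open>H21\<close>-norm \<open>1\<close>, \<open>1\<close>, \<open>-1\<close>, so each column is bounded by its last entry. The
  last row is, up to signs and conjugation, the last column of the inverse, so it is bounded by the
  corner entry.
\<close>

lemma SU21_entry_le:
  assumes "\<gamma> \<in> carrier SU21"
  shows "cmod (\<gamma>$i$j) \<le> 2 * cmod (\<gamma>$3$3)"
proof -
  have col: "(cmod (\<gamma>$1$i))\<^sup>2 + (cmod (\<gamma>$2$i))\<^sup>2 - (cmod (\<gamma>$3$i))\<^sup>2 = (if i = 3 then -1 else 1)" 
    if "\<gamma> \<in> carrier SU21" for \<gamma> i
  proof -
    have "complex_of_real ((cmod (\<gamma>$1$i))\<^sup>2 + (cmod (\<gamma>$2$i))\<^sup>2 - (cmod (\<gamma>$3$i))\<^sup>2) = of_real (if i = 3 then -1 else 1)"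
      using SU21_columns[OF that, of i i] by (simp add: H21_def complex_norm_square mult.commute split: if_splits del: of_real_power)
    then show ?thesis using of_real_eq_iff by blast
  qed
  have inv_entry: "inverse21 \<gamma> $ j $ 3 = - cnj (\<gamma> $ 3 $ j)" if "j \<noteq> 3" for j
  proof -
    have "hform (\<gamma> *v axis j 1) (axis 3 1) = hform (axis j 1) (inverse21 \<gamma> *v axis 3 1)"
      by (rule hform_adjoint[OF assms])
    then have "- \<gamma> $ 3 $ j = cnj (inverse21 \<gamma> $ j $ 3)"
      using that exhaust_3[of j]
      by (auto simp: hform_def matrix_vector_mult_def sum_3 axis_def)
    then show ?thesis by (metis complex_cnj_cnj complex_cnj_minus)
  qed
  define D where "D = (cmod (\<gamma>$3$3))\<^sup>2"
  have D1: "D \<ge> 1" using SU21_33_ge_1[OF assms] by (simp add: D_def one_le_power)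
  have row: "(cmod (\<gamma>$3$1))\<^sup>2 + (cmod (\<gamma>$3$2))\<^sup>2 - D = -1"
    using col[OF SU21_closed(1)[OF assms], of 3] inv_entry[of 1] inv_entry[of 2] inverse_33[OF assms]
    by (simp add: D_def)
  have "(cmod (\<gamma>$3$j))\<^sup>2 \<le> D" for j
    using row exhaust_3[of j] D_def by (smt (verit) zero_le_power2)
  then have "(cmod (\<gamma>$i$j))\<^sup>2 \<le> 1 + D"
    using col[OF assms, of j] exhaust_3[of i] D_def
    by (smt (verit) zero_le_power2)
  also have "\<dots> \<le> (2 * cmod (\<gamma>$3$3))\<^sup>2"
    using D1 by (simp add: D_def power_mult_distrib)
  finally show ?thesis by (rule power2_le_imp_le) simp
qed

section \<open>The Jacobian of the action\<close>

lemma has_derivative_vecI: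
  fixes f :: "'a::real_normed_vector \<Rightarrow> complex^'n"
  assumes "\<And>i. ((\<lambda>x. f x $ i) has_derivative (\<lambda>h. f' h $ i)) (at x within S)"
  shows "(f has_derivative f') (at x within S)"
proof (subst has_derivative_componentwise_within, intro ballI)
  fix b :: "complex^'n" assume "b \<in> Basis"
  then obtain i u where "b = axis i u" "u \<in> Basis" by (auto simp: Basis_vec_def)
  then show "((\<lambda>x. f x \<bullet> b) has_derivative (\<lambda>h. f' h \<bullet> b)) (at x within S)"
    by (simp add: inner_axis has_derivative_inner_left[OF assms])
qed

lemma matrix_lift_nth: "(\<gamma> *v lift z) $ i = \<gamma>$i$1 * z$1 + \<gamma>$i$2 * z$2 + \<gamma>$i$3"
  by (simp add: matrix_vector_mult_def sum_3)

lemma matrix_lift_has_derivative [derivative_intros]: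
  "((\<lambda>z. (\<gamma> *v lift z) $ i) has_derivative (\<lambda>v. \<gamma>$i$1 * v$1 + \<gamma>$i$2 * v$2)) (at z)"
  unfolding matrix_lift_nth
  by (auto intro!: derivative_eq_intros bounded_linear.has_derivative[OF bounded_linear_vec_nth])

text \<open>
  The complex Jacobian matrix given by the quotient rule; the indices are translated because the rows
  and columns of the ball are indexed by the type \<open>2\<close> and those of \<open>\<gamma>\<close> by the type \<open>3\<close>.
\<close>

definition act_jacobian :: "complex^3^3 \<Rightarrow> complex^2 \<Rightarrow> complex^2^2" where
  "act_jacobian \<gamma> z = (\<chi> i j.
     let i' = (if i = 1 then 1 else 2); j' = (if j = 1 then 1 else 2) in
     (\<gamma>$i'$j' * aut_factor \<gamma> z - (\<gamma> *v lift z)$i' * \<gamma>$3$j') / (aut_factor \<gamma> z)\<^sup>2)"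

lemma act_has_derivative:
  assumes "\<gamma> \<in> carrier SU21" "z \<in> unit_ball"
  shows "(act \<gamma> has_derivative (*v) (act_jacobian \<gamma> z)) (at z)"
proof (rule has_derivative_vecI)
  fix i :: 2
  define i' :: 3 where "i' = (if i = 1 then 1 else 2)"
  have nz: "(\<gamma> *v lift z) $ 3 \<noteq> 0"
    using aut_factor_nonzero[OF assms] by (simp add: aut_factor_def)
  have eq: "(\<lambda>z. act \<gamma> z $ i) = (\<lambda>z. (\<gamma> *v lift z) $ i' / (\<gamma> *v lift z) $ 3)"
    using exhaust_2[of i] by (auto simp: act_def i'_def aut_factor_def fun_eq_iff)
  have "((\<lambda>z. (\<gamma> *v lift z) $ i' / (\<gamma> *v lift z) $ 3) has_derivative
     (\<lambda>v. ((\<gamma>$i'$1 * v$1 + \<gamma>$i'$2 * v$2) * (\<gamma> *v lift z) $ 3 -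
        (\<gamma> *v lift z) $ i' * (\<gamma>$3$1 * v$1 + \<gamma>$3$2 * v$2)) / ((\<gamma> *v lift z) $ 3 * (\<gamma> *v lift z) $ 3))) (at z)"
    by (rule has_derivative_divide'[OF matrix_lift_has_derivative matrix_lift_has_derivative nz])
  also have "(\<lambda>v. ((\<gamma>$i'$1 * v$1 + \<gamma>$i'$2 * v$2) * (\<gamma> *v lift z) $ 3 -
        (\<gamma> *v lift z) $ i' * (\<gamma>$3$1 * v$1 + \<gamma>$3$2 * v$2)) / ((\<gamma> *v lift z) $ 3 * (\<gamma> *v lift z) $ 3))
      = (\<lambda>v. (act_jacobian \<gamma> z *v v) $ i)"
    by (rule ext) (simp add: matrix_vector_mult_def sum_2 act_jacobian_def Let_def i'_def[symmetric]
        aut_factor_def power2_eq_square diff_divide_distrib add_divide_distrib algebra_simps)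
  finally show "((\<lambda>z. act \<gamma> z $ i) has_derivative (\<lambda>v. (act_jacobian \<gamma> z *v v) $ i)) (at z)"
    unfolding eq .
qed

lemma det_act_jacobian:
  assumes "\<gamma> \<in> carrier SU21" "z \<in> unit_ball"
  shows "det (act_jacobian \<gamma> z) * aut_factor \<gamma> z ^ 3 = 1"
proof -
  define n1 n2 n3 where n: "n1 = (\<gamma> *v lift z)$1" "n2 = (\<gamma> *v lift z)$2" "n3 = (\<gamma> *v lift z)$3"
  have nz: "n3 \<noteq> 0" using aut_factor_nonzero[OF assms] by (simp add: aut_factor_def n)
  have "det (act_jacobian \<gamma> z) =
     ((\<gamma>$1$1 * n3 - n1 * \<gamma>$3$1) * (\<gamma>$2$2 * n3 - n2 * \<gamma>$3$2)
     - (\<gamma>$1$2 * n3 - n1 * \<gamma>$3$2) * (\<gamma>$2$1 * n3 - n2 * \<gamma>$3$1)) / n3 ^ 4"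
    using nz by (simp add: det_2 act_jacobian_def Let_def aut_factor_def n[symmetric] diff_divide_distrib)
      (simp add: field_simps power2_eq_square power4_eq_xxxx)
  also have "(\<gamma>$1$1 * n3 - n1 * \<gamma>$3$1) * (\<gamma>$2$2 * n3 - n2 * \<gamma>$3$2)
     - (\<gamma>$1$2 * n3 - n1 * \<gamma>$3$2) * (\<gamma>$2$1 * n3 - n2 * \<gamma>$3$1) = n3 * det \<gamma>"
    unfolding det_3 n matrix_lift_nth by (simp add: algebra_simps)
  also have "det \<gamma> = 1" using assms by (simp add: SU21_iff)
  finally show ?thesis using nz by (simp add: aut_factor_def n[symmetric] field_simps power4_eq_xxxx power3_eq_cube)
qed

lemma act_continuous_on:
  assumes "\<gamma> \<in> carrier SU21"
  shows "continuous_on unit_ball (act \<gamma>)"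
  by (meson act_has_derivative assms continuous_at_imp_continuous_on has_derivative_continuous)

section \<open>Invariance of the hyperbolic volume\<close>

lemma det_4:
  "det (A::'a::comm_ring_1^4^4) =
     A$1$1 * (A$2$2 * (A$3$3 * A$4$4 - A$3$4 * A$4$3) - A$2$3 * (A$3$2 * A$4$4 - A$3$4 * A$4$2) + A$2$4 * (A$3$2 * A$4$3 - A$3$3 * A$4$2))
   - A$1$2 * (A$2$1 * (A$3$3 * A$4$4 - A$3$4 * A$4$3) - A$2$3 * (A$3$1 * A$4$4 - A$3$4 * A$4$1) + A$2$4 * (A$3$1 * A$4$3 - A$3$3 * A$4$1))
   + A$1$3 * (A$2$1 * (A$3$2 * A$4$4 - A$3$4 * A$4$2) - A$2$2 * (A$3$1 * A$4$4 - A$3$4 * A$4$1) + A$2$4 * (A$3$1 * A$4$2 - A$3$2 * A$4$1))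
   - A$1$4 * (A$2$1 * (A$3$2 * A$4$3 - A$3$3 * A$4$2) - A$2$2 * (A$3$1 * A$4$3 - A$3$3 * A$4$1) + A$2$3 * (A$3$1 * A$4$2 - A$3$2 * A$4$1))"
proof -
  have f1234: "finite {2::4, 3, 4}" "1 \<notin> {2::4, 3, 4}"
    by auto
  have f234: "finite {3::4, 4}" "2 \<notin> {3::4, 4}"
    by auto
  have f34: "finite {4::4}" "3 \<notin> {4::4}"
    by auto
  show ?thesis
    unfolding det_def UNIV_4
    unfolding sum_over_permutations_insert[OF f1234]
    unfolding sum_over_permutations_insert[OF f234]
    unfolding sum_over_permutations_insert[OF f34]
    unfolding permutes_sing
    by (simp add: sign_swap_id permutation_swap_id permutation_compose sign_compose sign_id swap_id_eq algebra_simps)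
qed

text \<open>
  The change of variables theorem concerns \<open>real^'n\<close>, so the ball is transported to \<open>real^4\<close>.
\<close>

definition complex_coords :: "real^4 \<Rightarrow> complex^2" where
  "complex_coords x = (\<chi> i. if i = 1 then Complex (x$1) (x$2) else Complex (x$3) (x$4))"

definition real_coords :: "complex^2 \<Rightarrow> real^4" where
  "real_coords z = (\<chi> i. if i = 1 then Re (z$1) else if i = 2 then Im (z$1)
     else if i = 3 then Re (z$2) else Im (z$2))"

lemma real_coords_inverse [simp]: "real_coords (complex_coords x) = x" "complex_coords (real_coords z) = z"
  by (simp_all add: real_coords_def complex_coords_def vec_eq_iff forall_4 forall_2)

lemma bounded_linear_complex_coords: "bounded_linear complex_coords"
  and bounded_linear_real_coords: "bounded_linear real_coords"
  by (auto intro!: linear_conv_bounded_linear[THEN iffD1] linearI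
      simp: real_coords_def complex_coords_def vec_eq_iff forall_4 forall_2 complex_eq_iff)

text \<open>
  A complex linear map of determinant \<open>d\<close> has real determinant \<open>|d|\<^sup>2\<close>; here this is a polynomial
  identity in eight real variables.
\<close>

lemma det_real_coords:
  "det (matrix (real_coords \<circ> (*v) A \<circ> complex_coords)) = (cmod (det A))\<^sup>2"
  unfolding cmod_power2
  by (simp add: det_4 det_2 matrix_def real_coords_def complex_coords_def axis_def
      matrix_vector_mult_def sum_2 power2_eq_square algebra_simps)

lemma inner_real_coords: "real_coords z \<bullet> real_coords w = z \<bullet> w"
  by (simp add: inner_vec_def sum_4 sum_2 real_coords_def inner_complex_def)

lemma bij_real_coords: "bij real_coords"
  by (metis bijI' real_coords_inverse)

lemma real_coords_Basis: "real_coords ` Basis = Basis"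
proof -
  have "real_coords (axis 1 1) = axis 1 1" "real_coords (axis 1 \<i>) = axis 2 1"
    "real_coords (axis 2 1) = axis 3 1" "real_coords (axis 2 \<i>) = axis 4 1"
    by (simp_all add: real_coords_def axis_def vec_eq_iff forall_4)
  then show ?thesis
    by (auto simp: Basis_vec_def UNIV_2 UNIV_4 Basis_complex_def)
qed

lemma measurable_coords [measurable]:
  "complex_coords \<in> borel_measurable borel" "real_coords \<in> borel_measurable borel"
  by (simp_all add: borel_measurable_continuous_onI bounded_linear_complex_coords
      bounded_linear_real_coords linear_continuous_on)

lemma lborel_complex_coords: "lborel = distr lborel borel complex_coords"
proof (rule lborel_eqI)
  fix l u :: "complex^2"
  assume lu: "\<And>b. b \<in> Basis \<Longrightarrow> l \<bullet> b \<le> u \<bullet> b"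
  have mem: "x \<in> box (real_coords l) (real_coords u) \<longleftrightarrow> complex_coords x \<in> box l u" for x
  proof -
    have "x \<in> box (real_coords l) (real_coords u) \<longleftrightarrow>
      (\<forall>i\<in>real_coords ` Basis. real_coords l \<bullet> i < x \<bullet> i \<and> x \<bullet> i < real_coords u \<bullet> i)"
      by (simp add: mem_box real_coords_Basis)
    also have "\<dots> \<longleftrightarrow> complex_coords x \<in> box l u"
      using inner_real_coords[of "complex_coords x"] by (simp add: mem_box inner_real_coords)
    finally show ?thesis .
  qed
  have "emeasure (distr lborel borel complex_coords) (box l u)
      = emeasure lborel (complex_coords -` box l u \<inter> space lborel)"
    by (intro emeasure_distr) auto
  also have "complex_coords -` box l u \<inter> space lborel = box (real_coords l) (real_coords u)"
    by (auto simp: mem)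
  also have "emeasure lborel \<dots> = ennreal (\<Prod>b\<in>Basis. (real_coords u - real_coords l) \<bullet> b)"
  proof (rule emeasure_lborel_box)
    fix b :: "real^4" assume "b \<in> Basis"
    then obtain c where "c \<in> Basis" "b = real_coords c" using real_coords_Basis by blast
    then show "real_coords l \<bullet> b \<le> real_coords u \<bullet> b" by (simp add: inner_real_coords lu)
  qed
  also have "(\<Prod>b\<in>Basis. (real_coords u - real_coords l) \<bullet> b) = (\<Prod>b\<in>real_coords ` Basis. (real_coords u - real_coords l) \<bullet> b)"
    by (simp add: real_coords_Basis)
  also have "\<dots> = (\<Prod>b\<in>Basis. (real_coords u - real_coords l) \<bullet> real_coords b)"
    by (subst prod.reindex) (auto intro: inj_on_subset[OF bij_is_inj[OF bij_real_coords]])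
  also have "\<dots> = (\<Prod>b\<in>Basis. (u - l) \<bullet> b)"
    by (intro prod.cong refl) (simp add: inner_diff_left inner_real_coords)
  finally show "emeasure (distr lborel borel complex_coords) (box l u) = ennreal (\<Prod>b\<in>Basis. (u - l) \<bullet> b)" .
qed simp

lemma space_hyp_volume [simp]: "space hyp_volume = UNIV"
  and sets_hyp_volume [simp, measurable_cong]: "sets hyp_volume = sets borel"
  by (simp_all add: hyp_volume_def)

lemma unit_ball_borel [measurable]: "unit_ball \<in> sets borel"
  by (simp add: open_unit_ball)

definition hyp_weight :: "real^4 \<Rightarrow> real" where
  "hyp_weight x = 1 / defect (complex_coords x) ^ 3"

lemma hyp_weight_measurable [measurable]: "hyp_weight \<in> borel_measurable borel"
  unfolding hyp_weight_def by measurable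

lemma emeasure_hyp_volume:
  assumes [measurable]: "A \<in> sets borel" and A: "A \<subseteq> unit_ball"
  shows "emeasure hyp_volume A = (\<integral>\<^sup>+x. ennreal (indicator (real_coords ` A) x * hyp_weight x) \<partial>lborel)"
proof -
  have "emeasure hyp_volume A = (\<integral>\<^sup>+z. (indicator unit_ball z * ennreal (1 / defect z ^ 3)) * indicator A z \<partial>lborel)"
    unfolding hyp_volume_def by (subst emeasure_density) auto
  also have "\<dots> = (\<integral>\<^sup>+z. ennreal (indicator A z * (1 / defect z ^ 3)) \<partial>lborel)"
    by (intro nn_integral_cong) (use A in \<open>auto simp: indicator_def\<close>)
  also have "\<dots> = (\<integral>\<^sup>+x. ennreal (indicator A (complex_coords x) * hyp_weight x) \<partial>lborel)"
    by (subst lborel_complex_coords) (simp add: nn_integral_distr hyp_weight_def)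
  also have "(\<lambda>x. indicator A (complex_coords x) :: real) = indicator (real_coords ` A)"
    by (auto simp: indicator_def fun_eq_iff image_iff)
  finally show ?thesis by (metis (no_types, lifting))
qed

lemma real_coords_borel: "A \<in> sets borel \<Longrightarrow> real_coords ` A \<in> sets borel"
proof -
  assume "A \<in> sets borel"
  then have "complex_coords -` A \<inter> space borel \<in> sets borel" by (intro measurable_sets[of _ _ borel]) auto
  moreover have "complex_coords -` A = real_coords ` A"
    by (auto simp: image_iff) (metis real_coords_inverse(1))
  ultimately show ?thesis by simp
qed

lemma act_image_borel:
  assumes "\<gamma> \<in> carrier SU21" "A \<subseteq> unit_ball" "A \<in> sets borel"
  shows "act \<gamma> ` A \<in> sets borel"
proof -
  have "(\<lambda>z. act (inverse21 \<gamma>) z) \<in> measurable (restrict_space borel unit_ball) borel"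
    by (intro borel_measurable_continuous_on_restrict act_continuous_on SU21_closed assms)
  then have "act (inverse21 \<gamma>) -` A \<inter> space (restrict_space borel unit_ball) \<in> sets (restrict_space borel unit_ball)"
    using assms(3) by (rule measurable_sets)
  then show ?thesis
    by (auto simp: act_image_eq_vimage[OF assms(1,2)] sets_restrict_space_iff vimage_def Int_def conj_commute space_restrict_space)
qed

lemma hyp_weight_nonneg: "x \<in> real_coords ` unit_ball \<Longrightarrow> 0 \<le> hyp_weight x"
  by (auto simp: hyp_weight_def unit_ball_sq)

text \<open>
  The real Jacobian of \<open>act \<gamma>\<close> is \<open>|aut_factor \<gamma> z|\<^bsup>-6\<^esup>\<close>, and the density \<open>(1 - |z|\<^sup>2)\<^bsup>-3\<^esup>\<close> changes by
  the inverse factor because of \<open>one_minus_norm_act\<close>. The equivalence for every value \<open>r\<close>, rather than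
  an equation of integrals, keeps sets of infinite volume under control.
\<close>

lemma act_coords_change_of_variables:
  assumes \<gamma>: "\<gamma> \<in> carrier SU21" and A: "A \<in> sets borel" "A \<subseteq> unit_ball"
  shows "(hyp_weight has_integral r) (real_coords ` A) \<longleftrightarrow>
         (hyp_weight has_integral r) (real_coords ` act \<gamma> ` A)"
proof -
  define S where "S = real_coords ` A"
  define g where "g = real_coords \<circ> act \<gamma> \<circ> complex_coords"
  define g' where "g' x = real_coords \<circ> (*v) (act_jacobian \<gamma> (complex_coords x)) \<circ> complex_coords" for x
  have gS: "g ` S = real_coords ` act \<gamma> ` A" 
    unfolding g_def S_def by (simp add: image_comp o_def)
  have cS: "complex_coords x \<in> unit_ball" if "x \<in> S" for x using that A by (auto simp: S_def)
  have der: "(g has_derivative g' x) (at x within S)" if "x \<in> S" for x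
  proof -
    have "(act \<gamma> has_derivative (*v) (act_jacobian \<gamma> (complex_coords x))) (at (complex_coords x))"
      by (rule act_has_derivative[OF \<gamma> cS[OF that]])
    then have "(g has_derivative g' x) (at x)"
      unfolding g_def g'_def
      by (intro diff_chain_at bounded_linear_imp_has_derivative bounded_linear_complex_coords bounded_linear_real_coords)
    then show ?thesis by (rule has_derivative_at_withinI)
  qed
  have inj: "inj_on g S"
  proof (rule inj_onI)
    fix x y assume xy: "x \<in> S" "y \<in> S" "g x = g y"
    then have "act \<gamma> (complex_coords x) = act \<gamma> (complex_coords y)"
      unfolding g_def by (metis comp_apply real_coords_inverse(2))
    then have "complex_coords x = complex_coords y"
      using act_inverse(2)[OF \<gamma>] cS xy by metis
    then show "x = y" by (metis real_coords_inverse(1))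
  qed
  have jac: "\<bar>det (matrix (g' x))\<bar> * hyp_weight (g x) = hyp_weight x" if "x \<in> S" for x
  proof -
    define z where "z = complex_coords x"
    have z: "z \<in> unit_ball" using cS[OF that] by (simp add: z_def)
    define a b c where "a = cmod (aut_factor \<gamma> z)" "b = defect (act \<gamma> z)" "c = defect z"
    have a: "a \<noteq> 0" using aut_factor_nonzero[OF \<gamma> z] by (simp add: a_b_c_def)
    have abc: "a\<^sup>2 * b = c" using one_minus_norm_act[OF \<gamma> z] by (simp add: a_b_c_def)
    have "cmod (det (act_jacobian \<gamma> z)) * a ^ 3 = 1"
      using arg_cong[OF det_act_jacobian[OF \<gamma> z], of cmod] by (simp add: norm_mult norm_power a_b_c_def)
    then have d: "cmod (det (act_jacobian \<gamma> z)) = 1 / a ^ 3" using a by (simp add: field_simps)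
    have "\<bar>det (matrix (g' x))\<bar> * hyp_weight (g x) = (1 / a^3)\<^sup>2 * (1 / b ^ 3)"
      unfolding g'_def det_real_coords z_def[symmetric] d
      by (simp add: hyp_weight_def g_def z_def[symmetric] a_b_c_def)
    also have "\<dots> = 1 / (a\<^sup>2 * b) ^ 3" by (simp add: power_mult_distrib power_divide flip: power_mult)
    also have "\<dots> = hyp_weight x" unfolding abc by (simp add: hyp_weight_def a_b_c_def z_def)
    finally show ?thesis .
  qed
  have nonneg: "0 \<le> hyp_weight x" if "x \<in> S \<or> x \<in> g ` S" for x
    using that \<gamma> A by (intro hyp_weight_nonneg) (auto simp: S_def g_def act_in_ball subsetD)
  have "S \<in> sets lebesgue"
    using real_coords_borel[OF A(1)] by (simp add: S_def)
  from has_absolute_integral_change_of_variables[OF this der inj, of "\<lambda>x. vec (hyp_weight x) :: real^1" "vec r"]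
  have "(\<lambda>x. \<bar>det (matrix (g' x))\<bar> * hyp_weight (g x)) absolutely_integrable_on S \<and>
           integral S (\<lambda>x. \<bar>det (matrix (g' x))\<bar> * hyp_weight (g x)) = r
     \<longleftrightarrow> hyp_weight absolutely_integrable_on (g ` S) \<and> integral (g ` S) hyp_weight = r"
    unfolding absolutely_integrable_on_1_iff integral_on_1_eq by (simp add: vec_eq_iff)
  also have "(\<lambda>x. \<bar>det (matrix (g' x))\<bar> * hyp_weight (g x)) absolutely_integrable_on S
      \<longleftrightarrow> hyp_weight absolutely_integrable_on S"
    by (intro set_integrable_cong refl jac) auto
  also have "integral S (\<lambda>x. \<bar>det (matrix (g' x))\<bar> * hyp_weight (g x)) = integral S hyp_weight"
    by (intro Henstock_Kurzweil_Integration.integral_cong jac)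
  finally show ?thesis
    using nonneg unfolding gS[symmetric] S_def[symmetric]
    by (simp add: absolutely_integrable_on_iff_nonneg has_integral_iff)
qed

lemma emeasure_hyp_volume_iff:
  assumes A: "A \<in> sets borel" "A \<subseteq> unit_ball" and r: "0 \<le> r"
  shows "emeasure hyp_volume A = ennreal r \<longleftrightarrow> (hyp_weight has_integral r) (real_coords ` A)"
proof -
  have S: "real_coords ` A \<in> sets borel" by (rule real_coords_borel[OF A(1)])
  have *: "(\<lambda>x. if x \<in> real_coords ` A then hyp_weight x else 0) = (\<lambda>x. indicator (real_coords ` A) x * hyp_weight x)"
    by (auto simp: indicator_def)
  have meas: "(\<lambda>x. indicator (real_coords ` A) x * hyp_weight x) \<in> borel_measurable borel"
    using S by measurable
  have nn: "0 \<le> indicator (real_coords ` A) x * hyp_weight x" for x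
    using hyp_weight_nonneg[of x] A(2) by (auto simp: indicator_def)
  show ?thesis
    unfolding emeasure_hyp_volume[OF A] has_integral_restrict_UNIV[symmetric, of _ _ "real_coords ` A"] *
    using nn_integral_has_integral[OF meas nn _ r] nn_integral_has_integral_lborel[OF meas nn, of r] by blast
qed

lemma emeasure_hyp_volume_act:
  assumes \<gamma>: "\<gamma> \<in> carrier SU21" and A: "A \<in> sets borel" "A \<subseteq> unit_ball"
  shows "emeasure hyp_volume (act \<gamma> ` A) = emeasure hyp_volume A"
proof -
  have A': "act \<gamma> ` A \<in> sets borel" "act \<gamma> ` A \<subseteq> unit_ball"
    using act_image_borel[OF \<gamma> A(2,1)] \<gamma> A(2) by (auto simp: act_in_ball subsetD)
  have "emeasure hyp_volume (act \<gamma> ` A) = ennreal r \<longleftrightarrow> emeasure hyp_volume A = ennreal r" if "0 \<le> r" for r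
    using emeasure_hyp_volume_iff[OF A that] emeasure_hyp_volume_iff[OF A' that]
      act_coords_change_of_variables[OF \<gamma> A] by simp
  then show ?thesis
    by (metis ennreal_cases)
qed

lemma act_borel_measurable [measurable]: "act \<gamma> \<in> borel_measurable borel"
proof -
  have comp: "(\<lambda>z. act \<gamma> z $ i) \<in> borel_measurable borel" for i
  proof -
    have "continuous_on UNIV (\<lambda>z. (\<gamma> *v lift z) $ j)" for j
      unfolding matrix_lift_nth by (intro continuous_intros)
    then have [measurable]: "(\<lambda>z. (\<gamma> *v lift z) $ j) \<in> borel_measurable borel" for j
      by (rule borel_measurable_continuous_onI)
    show ?thesis
      using exhaust_2[of i] by (auto simp: act_def aut_factor_def)
  qed
  show ?thesis
  proof (rule borel_measurable_euclidean_space[THEN iffD2], rule ballI)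
    fix b :: "complex^2" assume "b \<in> Basis"
    then obtain i u where "b = axis i u" by (auto simp: Basis_vec_def)
    then show "(\<lambda>z. act \<gamma> z \<bullet> b) \<in> borel_measurable borel"
      using comp[of i] by (simp add: inner_axis)
  qed
qed

lemma emeasure_hyp_volume_outside:
  assumes "A \<in> sets borel"
  shows "emeasure hyp_volume A = emeasure hyp_volume (A \<inter> unit_ball)"
  using assms unfolding hyp_volume_def
  by (simp add: emeasure_density) (intro nn_integral_cong, auto simp: indicator_def)

theorem distr_hyp_volume:
  assumes \<gamma>: "\<gamma> \<in> carrier SU21"
  shows "distr hyp_volume hyp_volume (act \<gamma>) = hyp_volume"
proof (rule measure_eqI)
  fix A assume "A \<in> sets (distr hyp_volume hyp_volume (act \<gamma>))"
  then have A [measurable]: "A \<in> sets borel" by simp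
  have V: "act \<gamma> -` A \<in> sets borel"
    using measurable_sets[OF act_borel_measurable A] by simp
  have "emeasure (distr hyp_volume hyp_volume (act \<gamma>)) A = emeasure hyp_volume (act \<gamma> -` A)"
    using A by (subst emeasure_distr) simp_all
  also have "\<dots> = emeasure hyp_volume (act \<gamma> -` A \<inter> unit_ball)"
    by (rule emeasure_hyp_volume_outside[OF V])
  also have "\<dots> = emeasure hyp_volume (act \<gamma> ` (act \<gamma> -` A \<inter> unit_ball))"
    using V by (intro emeasure_hyp_volume_act[OF \<gamma>, symmetric]) auto
  also have "act \<gamma> ` (act \<gamma> -` A \<inter> unit_ball) = A \<inter> unit_ball"
    using act_bij[OF \<gamma>] by (force simp: bij_betw_def)
  finally show "emeasure (distr hyp_volume hyp_volume (act \<gamma>)) A = emeasure hyp_volume A"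
    by (simp add: emeasure_hyp_volume_outside[OF A])
qed simp

section \<open>Proper discontinuity\<close>

lemma norm_matrix_le:
  fixes A :: "complex^3^3"
  assumes "\<And>i j. cmod (A$i$j) \<le> a"
  shows "norm A \<le> 9 * a"
proof -
  have "norm A \<le> (\<Sum>i\<in>UNIV. \<Sum>j\<in>UNIV. cmod (A$i$j))"
    unfolding norm_vec_def
    by (rule order_trans[OF L2_set_le_sum]) (auto intro!: sum_mono L2_set_le_sum L2_set_nonneg)
  also have "\<dots> \<le> (\<Sum>i\<in>(UNIV::3 set). \<Sum>j\<in>(UNIV::3 set). a)"
    by (intro sum_mono assms)
  finally show ?thesis by simp
qed

lemma norm_matrix_mult_le:
  fixes A B :: "complex^3^3"
  assumes "\<And>i j. cmod (A$i$j) \<le> a"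
  shows "norm (A ** B) \<le> 27 * a * norm B"
proof -
  have B: "cmod (B$i$j) \<le> norm B" for i j
    by (meson Finite_Cartesian_Product.norm_nth_le order_trans)
  have a: "0 \<le> a" using assms[of 1 1] norm_ge_zero order_trans by blast
  have "cmod ((A ** B)$i$j) \<le> 3 * a * norm B" for i j
  proof -
    have "cmod ((A ** B)$i$j) \<le> (\<Sum>k\<in>UNIV. cmod (A$i$k * B$k$j))"
      by (simp add: matrix_matrix_mult_def norm_sum)
    also have "\<dots> \<le> (\<Sum>k\<in>(UNIV::3 set). a * norm B)"
      unfolding norm_mult by (intro sum_mono mult_mono assms B a) auto
    finally show ?thesis by simp
  qed
  from norm_matrix_le[OF this] show ?thesis by simp
qed

lemma matrix_diff_ldistrib: "A ** (B - C) = A ** B - A ** C" for A B C :: "complex^3^3"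
  by (simp add: matrix_matrix_mult_def vec_eq_iff algebra_simps sum_subtractf)

locale ball_lattice =
  fixes \<Gamma> :: "(complex^3^3) set"
  assumes subgroup: "subgroup \<Gamma> SU21"
    and discrete: "discrete \<Gamma>"
    and torsion_free: "torsion_free \<Gamma>"
    and cocompact: "cocompact \<Gamma>"
begin

lemma in_SU21 [simp]: "\<gamma> \<in> \<Gamma> \<Longrightarrow> \<gamma> \<in> carrier SU21"
  using subgroup.mem_carrier[OF subgroup] .

lemma mult_closed: "\<gamma> \<in> \<Gamma> \<Longrightarrow> \<delta> \<in> \<Gamma> \<Longrightarrow> \<gamma> ** \<delta> \<in> \<Gamma>"
  using subgroup.m_closed[OF subgroup] by simp

lemma inverse_closed: "\<gamma> \<in> \<Gamma> \<Longrightarrow> inverse21 \<gamma> \<in> \<Gamma>"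
  using subgroup.m_inv_closed[OF subgroup] by simp

lemma one_closed: "mat 1 \<in> \<Gamma>"
  using subgroup.one_closed[OF subgroup] by simp

lemma inverse_inverse: "\<gamma> \<in> \<Gamma> \<Longrightarrow> inverse21 (inverse21 \<gamma>) = \<gamma>"
  by (simp add: group.inv_inv[OF group_SU21])

lemma bij_mult_right:
  assumes "\<delta> \<in> \<Gamma>"
  shows "bij_betw (\<lambda>\<gamma>. \<gamma> ** \<delta>) \<Gamma> \<Gamma>"
  using assms SU21_closed[of \<delta>]
  by (intro bij_betw_byWitness[where f' = "\<lambda>\<gamma>. \<gamma> ** inverse21 \<delta>"])
    (auto simp: mult_closed inverse_closed matrix_mul_assoc[symmetric])

text \<open>
  If \<open>\<gamma>\<close> and \<open>\<delta>\<close> are close and their entries are bounded, then \<open>\<gamma>\<^bsup>-1\<^esup> \<delta>\<close> is close to the identity,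
  which is isolated in \<open>\<Gamma>\<close>. Hence the bounded part of \<open>\<Gamma>\<close> is uniformly discrete.
\<close>

lemma finite_bounded: "finite {\<gamma> \<in> \<Gamma>. cmod (\<gamma>$3$3) \<le> R}"
proof -
  define S where "S = {\<gamma> \<in> \<Gamma>. cmod (\<gamma>$3$3) \<le> R}"
  obtain e where e: "e > 0" "\<And>\<gamma>. \<gamma> \<in> \<Gamma> \<Longrightarrow> dist (mat 1) \<gamma> < e \<Longrightarrow> \<gamma> = mat 1"
    using discreteD[OF discrete one_closed] unfolding isolated_in_dist_Ex_iff by blast
  have R: "cmod (\<gamma>$i$j) \<le> 2 * \<bar>R\<bar>" if "\<gamma> \<in> S" for \<gamma> i j
    using SU21_entry_le[of \<gamma> i j] that by (auto simp: S_def)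
  have "bounded S"
    using norm_matrix_le[OF R] unfolding bounded_iff by blast
  moreover have "uniform_discrete S"
    unfolding uniform_discrete_def
  proof (intro exI[of _ "e / (54 * \<bar>R\<bar> + 1)"] conjI ballI impI)
    show "0 < e / (54 * \<bar>R\<bar> + 1)" using e by simp
    fix \<gamma> \<delta> assume \<gamma>: "\<gamma> \<in> S" and \<delta>: "\<delta> \<in> S" and d: "dist \<gamma> \<delta> < e / (54 * \<bar>R\<bar> + 1)"
    have G: "\<gamma> \<in> \<Gamma>" "\<delta> \<in> \<Gamma>" using \<gamma> \<delta> by (auto simp: S_def)
    have "inverse21 \<gamma> \<in> S"
      using \<gamma> by (auto simp: S_def inverse_closed inverse_33)
    then have "norm (inverse21 \<gamma> ** (\<delta> - \<gamma>)) \<le> 27 * (2 * \<bar>R\<bar>) * norm (\<delta> - \<gamma>)"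
      by (intro norm_matrix_mult_le R)
    moreover have "inverse21 \<gamma> ** (\<delta> - \<gamma>) = inverse21 \<gamma> ** \<delta> - mat 1"
      using G SU21_closed(3)[of \<gamma>]
      by (simp add: matrix_diff_ldistrib)
    moreover have "54 * \<bar>R\<bar> * norm (\<delta> - \<gamma>) \<le> (54 * \<bar>R\<bar> + 1) * norm (\<delta> - \<gamma>)"
      by (intro mult_right_mono) auto
    moreover have "(54 * \<bar>R\<bar> + 1) * norm (\<delta> - \<gamma>) < e"
      using d by (simp add: dist_norm norm_minus_commute field_simps)
    ultimately have "dist (mat 1) (inverse21 \<gamma> ** \<delta>) < e"
      by (simp add: dist_norm norm_minus_commute)
    then have "inverse21 \<gamma> ** \<delta> = mat 1"
      using e(2) G by (simp add: mult_closed inverse_closed)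
    then have "\<gamma> ** (inverse21 \<gamma> ** \<delta>) = \<gamma>" by simp
    then show "\<gamma> = \<delta>"
      using SU21_closed(2)[of \<gamma>] G by (simp add: matrix_mul_assoc)
  qed
  ultimately show ?thesis
    using uniform_discrete_finite_iff unfolding S_def by blast
qed

lemma countable_group: "countable \<Gamma>"
proof -
  have "\<Gamma> \<subseteq> (\<Union>n::nat. {\<gamma> \<in> \<Gamma>. cmod (\<gamma>$3$3) \<le> real n})"
    using real_arch_simple by auto
  then show ?thesis
    by (rule countable_subset) (intro countable_UN countable_finite finite_bounded countableI_type)
qed

lemma finite_return:
  assumes "\<rho> < 1"
  shows "finite {\<gamma> \<in> \<Gamma>. \<exists>z. norm z \<le> \<rho> \<and> norm (act \<gamma> z) \<le> \<rho>}"
proof (rule finite_subset[OF _ finite_bounded[of "1 / (sqrt (1 - \<rho>\<^sup>2) * (1 - \<rho>))"]], safe)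
  fix \<gamma> z assume \<gamma>: "\<gamma> \<in> \<Gamma>" and z: "norm z \<le> \<rho>" "norm (act \<gamma> z) \<le> \<rho>"
  have \<rho>: "0 \<le> \<rho>" using z norm_ge_zero order_trans by blast
  then have p: "0 < 1 - \<rho>\<^sup>2" using assms by (simp add: power_less_one_iff)
  have zB: "z \<in> unit_ball" using z assms by (simp add: unit_ball_def)
  have "(cmod (aut_factor \<gamma> z))\<^sup>2 * (1 - \<rho>\<^sup>2) \<le> (cmod (aut_factor \<gamma> z))\<^sup>2 * defect (act \<gamma> z)"
    using z \<rho> by (intro mult_left_mono) (auto intro: power_mono)
  also have "\<dots> \<le> 1" using \<gamma> zB by (simp add: one_minus_norm_act)
  finally have "sqrt ((cmod (aut_factor \<gamma> z))\<^sup>2 * (1 - \<rho>\<^sup>2)) \<le> 1"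
    by (simp only: real_sqrt_le_1_iff)
  then have 1: "cmod (aut_factor \<gamma> z) * sqrt (1 - \<rho>\<^sup>2) \<le> 1"
    by (simp add: real_sqrt_mult)
  have "cmod (\<gamma>$3$3) * (1 - \<rho>) \<le> cmod (\<gamma>$3$3) * (1 - norm z)"
    using z by (intro mult_left_mono) auto
  also have "\<dots> \<le> cmod (aut_factor \<gamma> z)" using \<gamma> zB by (simp add: aut_factor_bounds)
  finally have "cmod (\<gamma>$3$3) * (1 - \<rho>) * sqrt (1 - \<rho>\<^sup>2) \<le> 1"
    using 1 p by (meson mult_right_mono order_trans real_sqrt_ge_zero less_imp_le)
  then show "cmod (\<gamma>$3$3) \<le> 1 / (sqrt (1 - \<rho>\<^sup>2) * (1 - \<rho>))"
    using assms p by (simp add: field_simps)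
qed

text \<open>
  The powers of an element fixing a point lie in a finite set, so two of them coincide and the element
  has finite order.
\<close>

lemma act_free:
  assumes \<gamma>: "\<gamma> \<in> \<Gamma>" and z: "z \<in> unit_ball" and fixed: "act \<gamma> z = z"
  shows "\<gamma> = mat 1"
proof -
  interpret G: group SU21 by (rule group_SU21)
  define pw where "pw n = \<gamma> [^]\<^bsub>SU21\<^esub> n" for n :: nat
  have pw: "pw n \<in> \<Gamma> \<and> act (pw n) z = z" for n
  proof (induction n)
    case 0
    then show ?case by (simp add: pw_def one_closed)
  next
    case (Suc n)
    then show ?case using \<gamma> z fixed by (auto simp: pw_def mult_closed act_mult)
  qed
  have "finite {\<gamma> \<in> \<Gamma>. \<exists>w. norm w \<le> norm z \<and> norm (act \<gamma> w) \<le> norm z}"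
    using z by (intro finite_return) (simp add: unit_ball_def)
  moreover have "range pw \<subseteq> {\<gamma> \<in> \<Gamma>. \<exists>w. norm w \<le> norm z \<and> norm (act \<gamma> w) \<le> norm z}"
    using pw by fastforce
  ultimately have "finite (range pw)" by (rule finite_subset[rotated])
  then have "\<not> inj pw" using finite_imageD infinite_UNIV_nat by blast
  then obtain a b where "pw b = pw a" "a < b"
    unfolding inj_def by (metis linorder_neqE_nat)
  then have "\<gamma> [^]\<^bsub>SU21\<^esub> (b - a) = \<one>\<^bsub>SU21\<^esub>"
    using \<gamma> unfolding pw_def by (intro G.pow_eq_div2) auto
  then show ?thesis
    using torsion_free \<gamma> \<open>a < b\<close> unfolding torsion_free_def by (metis SU21_one zero_less_diff)
qed

lemma wandering_neighbourhood:
  assumes z: "z \<in> unit_ball"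
  shows "\<exists>U. open U \<and> z \<in> U \<and> U \<subseteq> unit_ball \<and> (\<forall>\<gamma>\<in>\<Gamma>. \<gamma> \<noteq> mat 1 \<longrightarrow> U \<inter> act \<gamma> ` U = {})"
proof -
  obtain \<rho> where \<rho>: "norm z < \<rho>" "\<rho> < 1"
    using z dense by (auto simp: unit_ball_def)
  define X where "X = {\<gamma> \<in> \<Gamma>. \<exists>z. norm z \<le> \<rho> \<and> norm (act \<gamma> z) \<le> \<rho>} - {mat 1}"
  have fin: "finite X" unfolding X_def using finite_return[OF \<rho>(2)] by blast
  have "\<exists>V. open V \<and> z \<in> V \<and> V \<subseteq> unit_ball \<and> V \<inter> act \<gamma> ` V = {}" if "\<gamma> \<in> X" for \<gamma>
  proof -
    have \<gamma>: "\<gamma> \<in> \<Gamma>" "\<gamma> \<noteq> mat 1" using that by (auto simp: X_def)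
    then have "act \<gamma> z \<noteq> z" using act_free z by blast
    then obtain P Q where PQ: "open P" "open Q" "z \<in> P" "act \<gamma> z \<in> Q" "P \<inter> Q = {}"
      by (metis hausdorff)
    have "open (unit_ball \<inter> act \<gamma> -` Q)"
      by (rule continuous_open_preimage[OF act_continuous_on open_unit_ball PQ(2)]) (simp add: \<gamma>)
    then show ?thesis
      using PQ z by (intro exI[of _ "P \<inter> (unit_ball \<inter> act \<gamma> -` Q)"]) auto
  qed
  then obtain V where V: "\<And>\<gamma>. \<gamma> \<in> X \<Longrightarrow> open (V \<gamma>) \<and> z \<in> V \<gamma> \<and> V \<gamma> \<subseteq> unit_ball \<and> V \<gamma> \<inter> act \<gamma> ` V \<gamma> = {}"
    by metis
  define U where "U = ball 0 \<rho> \<inter> (\<Inter>\<gamma>\<in>X. V \<gamma>)"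
  have "open U" unfolding U_def using fin V by (intro open_Int open_INT) auto
  moreover have "z \<in> U" using V \<rho> by (simp add: U_def)
  moreover have "U \<subseteq> unit_ball" using \<rho> by (auto simp: U_def unit_ball_def)
  moreover have "U \<inter> act \<gamma> ` U = {}" if "\<gamma> \<in> \<Gamma>" "\<gamma> \<noteq> mat 1" for \<gamma>
  proof (cases "\<gamma> \<in> X")
    case True
    then have "U \<subseteq> V \<gamma>" by (auto simp: U_def)
    then show ?thesis using V[OF True] by blast
  next
    case False
    then have "norm (act \<gamma> u) > \<rho>" if "u \<in> U" for u
      using that \<open>\<gamma> \<in> \<Gamma>\<close> \<open>\<gamma> \<noteq> mat 1\<close> unfolding X_def U_def
      by (metis (mono_tags, lifting) DiffI Int_iff mem_Collect_eq mem_ball_0 less_imp_le not_le singletonD)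
    then show ?thesis by (force simp: U_def)
  qed
  ultimately show ?thesis by blast
qed

section \<open>Fundamental domain and compactness\<close>

definition saturation :: "(complex^2) set \<Rightarrow> (complex^2) set" where
  "saturation U = (\<Union>\<gamma>\<in>\<Gamma>. act \<gamma> ` U)"

lemma open_act_image:
  assumes "\<gamma> \<in> \<Gamma>" "open U" "U \<subseteq> unit_ball"
  shows "open (act \<gamma> ` U)"
proof -
  have "open (unit_ball \<inter> act (inverse21 \<gamma>) -` U)"
    by (rule continuous_open_preimage[OF act_continuous_on open_unit_ball assms(2)])
      (simp add: assms inverse_closed)
  also have "unit_ball \<inter> act (inverse21 \<gamma>) -` U = act \<gamma> ` U"
    using assms by (auto simp: act_image_eq_vimage)
  finally show ?thesis .
qed

lemma open_saturation: "open U \<Longrightarrow> U \<subseteq> unit_ball \<Longrightarrow> open (saturation U)"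
  unfolding saturation_def by (intro open_UN ballI open_act_image)

lemma saturation_iff:
  assumes "U \<subseteq> unit_ball" "z \<in> unit_ball"
  shows "z \<in> saturation U \<longleftrightarrow> (\<exists>\<gamma>\<in>\<Gamma>. act \<gamma> z \<in> U)"
proof
  assume "z \<in> saturation U"
  then obtain \<gamma> u where *: "\<gamma> \<in> \<Gamma>" "u \<in> U" "z = act \<gamma> u" by (auto simp: saturation_def)
  then have "act (inverse21 \<gamma>) z = u" using assms by (auto simp: act_inverse)
  then show "\<exists>\<gamma>\<in>\<Gamma>. act \<gamma> z \<in> U" using * inverse_closed by blast
next
  assume "\<exists>\<gamma>\<in>\<Gamma>. act \<gamma> z \<in> U"
  then obtain \<gamma> where \<gamma>: "\<gamma> \<in> \<Gamma>" "act \<gamma> z \<in> U" by blast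
  then have "z = act (inverse21 \<gamma>) (act \<gamma> z)" using assms by (simp add: act_inverse)
  then show "z \<in> saturation U" unfolding saturation_def using \<gamma> inverse_closed by blast
qed

text \<open>
  Enumerate countably many wandering neighbourhoods that cover the ball, and take from each one the
  points whose orbits miss all earlier ones. Every orbit then meets the result exactly once.
\<close>

lemma fundamental_domain_exists: "\<exists>F. fundamental_domain \<Gamma> F"
proof -
  define \<U> where "\<U> = {U. open U \<and> U \<subseteq> unit_ball \<and> (\<forall>\<gamma>\<in>\<Gamma>. \<gamma> \<noteq> mat 1 \<longrightarrow> U \<inter> act \<gamma> ` U = {})}"
  have "z \<in> \<Union>\<U>" if z: "z \<in> unit_ball" for z
  proof -
    obtain U where "z \<in> U" "U \<in> \<U>"
      using wandering_neighbourhood[OF z] unfolding \<U>_def by auto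
    then show ?thesis by blast
  qed
  then have "\<Union>\<U> = unit_ball" by (auto simp: \<U>_def)
  moreover have op: "open U" if "U \<in> \<U>" for U using that by (simp add: \<U>_def)
  obtain \<V> where \<V>: "\<V> \<subseteq> \<U>" "countable \<V>" "\<Union>\<V> = \<Union>\<U>"
    using Lindelof[OF op] by metis
  ultimately have cover: "\<Union>\<V> = unit_ball" by simp
  then have ne: "\<V> \<noteq> {}" using zero_in_ball by blast
  define V where "V = from_nat_into \<V>"
  have rV: "range V = \<V>" unfolding V_def using \<V>(2) ne by (simp add: range_from_nat_into)
  then have V: "open (V n)" "V n \<subseteq> unit_ball"
    "\<And>\<gamma>. \<gamma> \<in> \<Gamma> \<Longrightarrow> \<gamma> \<noteq> mat 1 \<Longrightarrow> V n \<inter> act \<gamma> ` V n = {}" for n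
  proof -
    have "V n \<in> \<U>" using rV \<V>(1) by auto
    then show "open (V n)" "V n \<subseteq> unit_ball"
      "\<And>\<gamma>. \<gamma> \<in> \<Gamma> \<Longrightarrow> \<gamma> \<noteq> mat 1 \<Longrightarrow> V n \<inter> act \<gamma> ` V n = {}"
      by (simp_all add: \<U>_def)
  qed
  define F where "F = (\<Union>n. V n - (\<Union>i<n. saturation (V i)))"
  have FB: "F \<subseteq> unit_ball" using V by (auto simp: F_def)
  have Fb: "F \<in> sets borel"
  proof -
    have "open (V n)" "open (\<Union>i<n. saturation (V i))" for n
      by (simp_all add: V(1,2) open_saturation open_UN)
    then have "V n - (\<Union>i<n. saturation (V i)) \<in> sets borel" for n
      by (intro sets.Diff borel_open)
    then show ?thesis unfolding F_def by (intro sets.countable_UN) auto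
  qed
  have tile: "z \<in> (\<Union>\<gamma>\<in>\<Gamma>. act \<gamma> ` F)" if z: "z \<in> unit_ball" for z
  proof -
    have "\<exists>n. z \<in> saturation (V n)"
    proof -
      obtain n where "z \<in> V n" using z cover rV by blast
      then have "z \<in> saturation (V n)"
        using saturation_iff[OF V(2) z] one_closed by (metis act_one)
      then show ?thesis ..
    qed
    then obtain n where n: "z \<in> saturation (V n)" "\<And>i. i < n \<Longrightarrow> z \<notin> saturation (V i)"
      using exists_least_iff[of "\<lambda>n. z \<in> saturation (V n)"] by blast
    from n(1) obtain \<gamma> where \<gamma>: "\<gamma> \<in> \<Gamma>" "act \<gamma> z \<in> V n"
      using saturation_iff[OF V(2) z] by blast
    have az: "act \<gamma> z \<in> unit_ball" using \<gamma> z by (simp add: act_in_ball)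
    have "act \<gamma> z \<notin> saturation (V i)" if "i < n" for i
    proof
      assume "act \<gamma> z \<in> saturation (V i)"
      then obtain \<delta> where "\<delta> \<in> \<Gamma>" "act \<delta> (act \<gamma> z) \<in> V i"
        using saturation_iff[OF V(2) az] by blast
      then have "\<delta> ** \<gamma> \<in> \<Gamma>" "act (\<delta> ** \<gamma>) z \<in> V i"
        using \<gamma> z by (auto simp: mult_closed act_mult)
      then show False using n(2)[OF that] saturation_iff[OF V(2) z] by blast
    qed
    then have "act \<gamma> z \<in> F" using \<gamma> by (auto simp: F_def)
    moreover have "z = act (inverse21 \<gamma>) (act \<gamma> z)" using \<gamma> z by (simp add: act_inverse)
    ultimately show ?thesis using inverse_closed[OF \<gamma>(1)] by blast
  qed
  have disj: "F \<inter> act \<gamma> ` F = {}" if \<gamma>: "\<gamma> \<in> \<Gamma>" "\<gamma> \<noteq> mat 1" for \<gamma>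
  proof (rule ccontr)
    assume "F \<inter> act \<gamma> ` F \<noteq> {}"
    then obtain u where u: "u \<in> F" "act \<gamma> u \<in> F" by blast
    then obtain n m where nm: "u \<in> V n" "u \<notin> (\<Union>i<n. saturation (V i))"
      "act \<gamma> u \<in> V m" "act \<gamma> u \<notin> (\<Union>i<m. saturation (V i))"
      by (auto simp: F_def)
    have uB: "u \<in> unit_ball" "act \<gamma> u \<in> unit_ball" using u FB by auto
    have "u \<in> saturation (V m)" using saturation_iff[OF V(2) uB(1)] \<gamma> nm by blast
    moreover have "act \<gamma> u \<in> saturation (V n)"
      using \<gamma> nm by (auto simp: saturation_def)
    ultimately have "n = m" using nm by (metis UN_I lessThan_iff linorder_neqE_nat)
    then show False using V(3)[OF \<gamma>, of n] nm by blast
  qed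
  show ?thesis
    unfolding fundamental_domain_def
  proof (intro exI[of _ F] conjI ballI impI)
    show "(\<Union>\<gamma>\<in>\<Gamma>. act \<gamma> ` F) = unit_ball"
      using tile FB act_in_ball in_SU21 by blast
  qed (use Fb FB disj in auto)
qed

abbreviation "D \<equiv> fund_dom \<Gamma>"

lemma fund_dom: "fundamental_domain \<Gamma> D"
  unfolding fund_dom_def using fundamental_domain_exists by (rule someI_ex)

lemma fund_dom_borel [measurable]: "D \<in> sets borel" and fund_dom_subset: "D \<subseteq> unit_ball"
  using fund_dom by (auto simp: fundamental_domain_def)

text \<open>
  As \<open>r\<close> increases to \<open>1\<close>, the sets of orbits meeting the ball of radius \<open>r\<close> form an increasing open cover
  of the quotient.
\<close>

lemma orbits_meet_smaller_ball: "\<exists>r<1. 0 < r \<and> (\<forall>z\<in>unit_ball. \<exists>\<gamma>\<in>\<Gamma>. norm (act \<gamma> z) < r)"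
proof -
  define orb where "orb = orbit (SU21\<lparr>carrier := \<Gamma>\<rparr>) act"
  have orb: "orb z = (\<lambda>\<gamma>. act \<gamma> z) ` \<Gamma>" for z
    by (auto simp: orb_def orbit_def)
  define W where "W n = {p \<in> ball_quotient \<Gamma>. \<exists>z\<in>p. norm z < 1 - 1 / real (n + 2)}" for n :: nat
  have bq: "orb z \<in> ball_quotient \<Gamma>" if "z \<in> unit_ball" for z
    using that by (auto simp: ball_quotient_def orbits_def orb_def)
  have opn: "openin (ball_quotient_topology \<Gamma>) (W n)" for n
    unfolding openin_ball_quotient_topology
  proof
    have "{z \<in> unit_ball. orb z \<in> W n} = saturation (ball 0 (1 - 1 / real (n + 2)))"
    proof -
      have sub: "ball 0 (1 - 1 / real (n + 2)) \<subseteq> unit_ball"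
        unfolding unit_ball_eq by (intro subset_ball) simp
      have "saturation (ball 0 (1 - 1 / real (n + 2))) \<subseteq> unit_ball"
        using sub by (auto simp: saturation_def intro!: act_in_ball)
      then show ?thesis
        using saturation_iff[OF sub] bq by (auto simp: W_def orb)
    qed
    also have "open \<dots>"
      by (intro open_saturation) (simp_all add: unit_ball_eq subset_ball)
    finally show "open {z \<in> unit_ball. orbit (SU21\<lparr>carrier := \<Gamma>\<rparr>) act z \<in> W n}"
      by (simp add: orb_def)
  qed (auto simp: W_def)
  have "topspace (ball_quotient_topology \<Gamma>) \<subseteq> \<Union>(range W)"
  proof
    fix p assume "p \<in> topspace (ball_quotient_topology \<Gamma>)"
    then have p: "p \<in> ball_quotient \<Gamma>"
      unfolding topspace_def openin_ball_quotient_topology by blast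
    then obtain z where z: "z \<in> unit_ball" "p = orb z"
      by (auto simp: ball_quotient_def orbits_def orb_def)
    obtain n where n: "1 / (1 - norm z) < real n" using reals_Archimedean2 by blast
    have "norm z < 1 - 1 / real (n + 2)"
    proof -
      have "0 < 1 - norm z" using z by (simp add: unit_ball_def)
      then have "1 < real n * (1 - norm z)" using n by (simp add: field_simps)
      also have "\<dots> \<le> real (n + 2) * (1 - norm z)" using \<open>0 < 1 - norm z\<close> by (intro mult_right_mono) auto
      finally show ?thesis by (simp add: field_simps)
    qed
    moreover have "z \<in> p" unfolding z(2) orb using one_closed act_one by (metis imageI)
    ultimately have "p \<in> W n" using p by (auto simp: W_def)
    then show "p \<in> \<Union>(range W)" by blast
  qed
  then have "\<exists>\<F>. finite \<F> \<and> \<F> \<subseteq> range W \<and> topspace (ball_quotient_topology \<Gamma>) \<subseteq> \<Union>\<F>"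
    using cocompact opn unfolding cocompact_def compact_space_alt by (metis imageE)
  then obtain \<F> where \<F>: "finite \<F>" "\<F> \<subseteq> range W" "topspace (ball_quotient_topology \<Gamma>) \<subseteq> \<Union>\<F>" by blast
  then obtain N where N: "finite N" "\<F> = W ` N" by (meson finite_subset_image)
  define n where "n = Max (insert 0 N)"
  have "\<exists>\<gamma>\<in>\<Gamma>. norm (act \<gamma> z) < 1 - 1 / real (n + 2)" if z: "z \<in> unit_ball" for z
  proof -
    have "openin (ball_quotient_topology \<Gamma>) (ball_quotient \<Gamma>)"
    proof -
      have "{z \<in> unit_ball. orb z \<in> ball_quotient \<Gamma>} = unit_ball" using bq by auto
      then show ?thesis
        unfolding openin_ball_quotient_topology orb_def[symmetric] by (simp add: open_unit_ball)
    qed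
    then have "orb z \<in> topspace (ball_quotient_topology \<Gamma>)"
      using bq[OF z] openin_subset by blast
    then obtain k where k: "k \<in> N" "orb z \<in> W k" using \<F>(3) N(2) by blast
    then obtain \<gamma> where \<gamma>: "\<gamma> \<in> \<Gamma>" "norm (act \<gamma> z) < 1 - 1 / real (k + 2)"
      by (auto simp: W_def orb)
    have "k \<le> n" using k N by (simp add: n_def)
    then have "1 - 1 / real (k + 2) \<le> 1 - 1 / real (n + 2)" by (simp add: frac_le)
    then show ?thesis using \<gamma> by force
  qed
  moreover have "1 - 1 / real (n + 2) < 1" "0 < 1 - 1 / real (n + 2)" by (auto simp: field_simps)
  ultimately show ?thesis by blast
qed

end

section \<open>Unfolding\<close>

lemma hyp_volume_null: "A \<in> null_sets lborel \<Longrightarrow> emeasure hyp_volume A = 0"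
  unfolding hyp_volume_def
  by (subst emeasure_density) (auto intro!: nn_integral_null_set)

lemma AE_hyp_volume_ball: "AE z in hyp_volume. z \<in> unit_ball"
  unfolding hyp_volume_def by (subst AE_density) (auto simp: indicator_def)

lemma nn_integral_hyp_volume:
  assumes [measurable]: "h \<in> borel_measurable borel"
  shows "(\<integral>\<^sup>+z. h z \<partial>hyp_volume) =
    (\<integral>\<^sup>+z. indicator unit_ball z * ennreal (1 / defect z ^ 3) * h z \<partial>lborel)"
  unfolding hyp_volume_def by (subst nn_integral_density) (auto simp: mult.assoc)

lemma nn_integral_hyp_volume_act:
  assumes \<gamma>: "\<gamma> \<in> carrier SU21" and [measurable]: "h \<in> borel_measurable borel"
  shows "(\<integral>\<^sup>+z. h (act \<gamma> z) \<partial>hyp_volume) = (\<integral>\<^sup>+z. h z \<partial>hyp_volume)"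
proof -
  have "(\<integral>\<^sup>+z. h z \<partial>hyp_volume) = (\<integral>\<^sup>+z. h z \<partial>distr hyp_volume hyp_volume (act \<gamma>))"
    by (simp add: distr_hyp_volume[OF \<gamma>])
  also have "\<dots> = (\<integral>\<^sup>+z. h (act \<gamma> z) \<partial>hyp_volume)"
    by (rule nn_integral_distr) auto
  finally show ?thesis ..
qed

lemma integral_hyp_volume_act:
  fixes h :: "complex^2 \<Rightarrow> complex"
  assumes \<gamma>: "\<gamma> \<in> carrier SU21" and [measurable]: "h \<in> borel_measurable borel"
  shows "(\<integral>z. h (act \<gamma> z) \<partial>hyp_volume) = (\<integral>z. h z \<partial>hyp_volume)"
proof -
  have "(\<integral>z. h z \<partial>hyp_volume) = (\<integral>z. h z \<partial>distr hyp_volume hyp_volume (act \<gamma>))"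
    by (simp add: distr_hyp_volume[OF \<gamma>])
  also have "\<dots> = (\<integral>z. h (act \<gamma> z) \<partial>hyp_volume)"
    by (rule integral_distr) auto
  finally show ?thesis ..
qed

text \<open>
  The density of the hyperbolic volume has exponent \<open>-3\<close>, so the weights with exponent at least \<open>3\<close> are
  those that become bounded with respect to Lebesgue measure.
\<close>

lemma nn_integral_weight_ge_3:
  assumes "3 \<le> m"
  shows "(\<integral>\<^sup>+z. indicator unit_ball z * ennreal (defect z ^ m) \<partial>hyp_volume)
    = (\<integral>\<^sup>+z. indicator unit_ball z * ennreal (defect z ^ (m - 3)) \<partial>lborel)"
proof (subst nn_integral_hyp_volume, measurable, intro nn_integral_cong)
  fix z :: "complex^2"
  show "indicator unit_ball z * ennreal (1 / defect z ^ 3) *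
      (indicator unit_ball z * ennreal (defect z ^ m))
    = indicator unit_ball z * ennreal (defect z ^ (m - 3))"
  proof (cases "z \<in> unit_ball")
    case True
    define q where "q = defect z"
    have q: "0 < q" using True by (simp add: q_def unit_ball_sq)
    have "q ^ m = q ^ 3 * q ^ (m - 3)" using assms by (simp flip: power_add)
    then show ?thesis using True q by (simp add: q_def[symmetric] ennreal_mult[symmetric])
  qed simp
qed

lemma nn_integral_weight_3:
  "(\<integral>\<^sup>+z. indicator unit_ball z * ennreal (defect z ^ 3) \<partial>hyp_volume)
    = emeasure lborel (ball (0::complex^2) 1)"
  using nn_integral_weight_ge_3[of 3] by (simp add: unit_ball_eq)

context ball_lattice
begin

abbreviation counting :: "(complex^3^3) measure" where
  "counting \<equiv> count_space \<Gamma>"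

text \<open>
  Only the overlaps \<open>D \<inter> \<gamma> D\<close> are null by definition of a fundamental domain; an overlap of two arbitrary translates is the
  image of one of these, hence null by invariance.
\<close>

lemma AE_unique_translate:
  "AE u in hyp_volume. u \<in> unit_ball \<and> (\<exists>!\<gamma>. \<gamma> \<in> \<Gamma> \<and> act (inverse21 \<gamma>) u \<in> D)"
proof -
  have null: "AE u in hyp_volume. u \<notin> act \<gamma> ` D \<inter> act \<delta> ` D"
    if \<gamma>: "\<gamma> \<in> \<Gamma>" and \<delta>: "\<delta> \<in> \<Gamma>" and ne: "\<gamma> \<noteq> \<delta>" for \<gamma> \<delta>
  proof -
    define \<epsilon> where "\<epsilon> = inverse21 \<gamma> ** \<delta>"
    have \<epsilon>: "\<epsilon> \<in> \<Gamma>" using \<gamma> \<delta> by (simp add: \<epsilon>_def mult_closed inverse_closed)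
    have \<delta>eq: "\<delta> = \<gamma> ** \<epsilon>" using SU21_closed(2)[of \<gamma>] \<gamma> by (simp add: \<epsilon>_def matrix_mul_assoc)
    have "\<epsilon> \<noteq> mat 1" using ne \<delta>eq by auto
    then have nul: "D \<inter> act \<epsilon> ` D \<in> null_sets lborel"
      using fund_dom \<epsilon> by (auto simp: fundamental_domain_def)
    have b: "D \<inter> act \<epsilon> ` D \<in> sets borel"
      using act_image_borel[of \<epsilon> D] \<epsilon> fund_dom_subset by (intro sets.Int) auto
    have sub: "D \<inter> act \<epsilon> ` D \<subseteq> unit_ball" using fund_dom_subset by auto
    have eq: "act \<gamma> ` D \<inter> act \<delta> ` D = act \<gamma> ` (D \<inter> act \<epsilon> ` D)"
    proof -
      have "act \<delta> ` D = act \<gamma> ` act \<epsilon> ` D"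
        unfolding \<delta>eq image_image using \<gamma> \<epsilon> fund_dom_subset
        by (intro image_cong refl act_mult) auto
      moreover have "inj_on (act \<gamma>) unit_ball" using act_bij \<gamma> by (auto simp: bij_betw_def)
      moreover have "act \<epsilon> ` D \<subseteq> unit_ball" using fund_dom_subset \<epsilon> by (auto simp: act_in_ball subsetD)
      ultimately show ?thesis using fund_dom_subset by (simp add: inj_on_image_Int)
    qed
    have "emeasure hyp_volume (act \<gamma> ` D \<inter> act \<delta> ` D) = 0"
      unfolding eq using emeasure_hyp_volume_act[OF _ b sub, of \<gamma>] \<gamma> hyp_volume_null[OF nul] by simp
    moreover have "act \<gamma> ` D \<inter> act \<delta> ` D \<in> sets borel"
      unfolding eq using \<gamma> b sub by (intro act_image_borel) auto
    ultimately show ?thesis by (intro AE_not_in) (simp add: null_sets_def)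
  qed
  have "AE u in hyp_volume. \<forall>\<gamma>\<in>\<Gamma>. \<forall>\<delta>\<in>\<Gamma>. \<gamma> \<noteq> \<delta> \<longrightarrow> u \<notin> act \<gamma> ` D \<inter> act \<delta> ` D"
    using null by (simp add: AE_ball_countable countable_group)
  with AE_hyp_volume_ball show ?thesis
  proof eventually_elim
    case (elim u)
    then have "u \<in> (\<Union>\<gamma>\<in>\<Gamma>. act \<gamma> ` D)"
      using fund_dom by (auto simp: fundamental_domain_def)
    then have "\<exists>\<gamma>. \<gamma> \<in> \<Gamma> \<and> u \<in> act \<gamma> ` D" by blast
    then have "\<exists>!\<gamma>. \<gamma> \<in> \<Gamma> \<and> u \<in> act \<gamma> ` D"
      using elim(2) by blast
    moreover have "\<gamma> \<in> \<Gamma> \<and> u \<in> act \<gamma> ` D \<longleftrightarrow> \<gamma> \<in> \<Gamma> \<and> act (inverse21 \<gamma>) u \<in> D" for \<gamma>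
      using act_image_eq_vimage[of \<gamma> D] fund_dom_subset elim(1)
      by (metis (mono_tags, lifting) in_SU21 mem_Collect_eq)
    ultimately show ?case using elim(1) by simp
  qed
qed

definition dom_volume :: "(complex^2) measure" where
  "dom_volume = density hyp_volume (indicator D)"

lemma sets_dom_volume [simp, measurable_cong]: "sets dom_volume = sets borel"
  and space_dom_volume [simp]: "space dom_volume = UNIV"
  by (simp_all add: dom_volume_def)

lemma nn_integral_dom_volume:
  "h \<in> borel_measurable borel \<Longrightarrow> (\<integral>\<^sup>+z. h z \<partial>dom_volume) = (\<integral>\<^sup>+z. h z * indicator D z \<partial>hyp_volume)"
  unfolding dom_volume_def by (subst nn_integral_density) (auto simp: mult.commute)

lemma AE_dom_volume: "AE z in dom_volume. z \<in> D"
  unfolding dom_volume_def by (subst AE_density) (auto simp: indicator_def)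

lemma unfolding_product:
  assumes [measurable]: "h \<in> borel_measurable borel"
  shows "(\<integral>\<^sup>+z. h z \<partial>hyp_volume) = (\<integral>\<^sup>+\<gamma>. \<integral>\<^sup>+z. h (act \<gamma> z) \<partial>dom_volume \<partial>counting)"
proof -
  have "(\<integral>\<^sup>+z. h (act \<gamma> z) \<partial>dom_volume) = (\<integral>\<^sup>+u. h u * indicator D (act (inverse21 \<gamma>) u) \<partial>hyp_volume)"
    if \<gamma>: "\<gamma> \<in> \<Gamma>" for \<gamma>
  proof -
    have "(\<integral>\<^sup>+u. h u * indicator D (act (inverse21 \<gamma>) u) \<partial>hyp_volume)
        = (\<integral>\<^sup>+z. h (act \<gamma> z) * indicator D (act (inverse21 \<gamma>) (act \<gamma> z)) \<partial>hyp_volume)"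
      using \<gamma> by (subst nn_integral_hyp_volume_act[of \<gamma>]) auto
    also have "\<dots> = (\<integral>\<^sup>+z. h (act \<gamma> z) * indicator D z \<partial>hyp_volume)"
      using AE_hyp_volume_ball \<gamma> by (intro nn_integral_cong_AE) (auto simp: act_inverse)
    finally show ?thesis by (simp add: nn_integral_dom_volume)
  qed
  then have "(\<integral>\<^sup>+\<gamma>. \<integral>\<^sup>+z. h (act \<gamma> z) \<partial>dom_volume \<partial>counting)
     = (\<integral>\<^sup>+\<gamma>. \<integral>\<^sup>+u. h u * indicator D (act (inverse21 \<gamma>) u) \<partial>hyp_volume \<partial>counting)"
    by (intro nn_integral_cong) auto
  also have "\<dots> = (\<integral>\<^sup>+u. \<integral>\<^sup>+\<gamma>. h u * indicator D (act (inverse21 \<gamma>) u) \<partial>counting \<partial>hyp_volume)"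
    by (intro nn_integral_count_space_nn_integral[symmetric] countable_group) measurable
  also have "\<dots> = (\<integral>\<^sup>+u. h u \<partial>hyp_volume)"
  proof (intro nn_integral_cong_AE, use AE_unique_translate in eventually_elim)
    case (elim u)
    then obtain \<gamma>0 where \<gamma>0: "\<gamma>0 \<in> \<Gamma>" "\<And>\<gamma>. \<gamma> \<in> \<Gamma> \<Longrightarrow> act (inverse21 \<gamma>) u \<in> D \<longleftrightarrow> \<gamma> = \<gamma>0"
      by metis
    have "(\<integral>\<^sup>+\<gamma>. indicator D (act (inverse21 \<gamma>) u) \<partial>counting) = (\<integral>\<^sup>+\<gamma>. indicator {\<gamma>0} \<gamma> \<partial>counting)"
      using \<gamma>0 by (intro nn_integral_cong) (auto simp: indicator_def)
    also have "\<dots> = 1" using \<gamma>0(1) by (subst nn_integral_indicator) auto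
    finally show ?case by (simp add: nn_integral_cmult)
  qed
  finally show ?thesis ..
qed

lemma unfolding_nn:
  assumes [measurable]: "h \<in> borel_measurable borel"
  shows "(\<integral>\<^sup>+z. h z \<partial>hyp_volume) = (\<integral>\<^sup>+z. \<integral>\<^sup>+\<gamma>. h (act \<gamma> z) \<partial>counting \<partial>dom_volume)"
  unfolding unfolding_product[OF assms]
  by (intro nn_integral_count_space_nn_integral[symmetric] countable_group) measurable

text \<open>
  Every orbit has a point in a fixed smaller ball, so unfolding \<open>(1 - |u|\<^sup>2)\<^sup>3\<close>, whose total integral is the
  Euclidean volume of the ball, gives a sum bounded below by a positive constant on the domain.
\<close>

lemma finite_dom_volume: "finite_measure dom_volume"
proof
  obtain r where r: "r < 1" "0 < r" "\<And>z. z \<in> unit_ball \<Longrightarrow> \<exists>\<gamma>\<in>\<Gamma>. norm (act \<gamma> z) < r"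
    using orbits_meet_smaller_ball by blast
  define h :: "complex^2 \<Rightarrow> ennreal" where "h z = indicator unit_ball z * ennreal (defect z ^ 3)" for z
  have [measurable]: "h \<in> borel_measurable borel" unfolding h_def by measurable
  define c where "c = ennreal ((1 - r\<^sup>2) ^ 3)"
  have r2: "0 < 1 - r\<^sup>2" using r by (simp add: power_less_one_iff)
  have "c * emeasure dom_volume (space dom_volume) = (\<integral>\<^sup>+z. c \<partial>dom_volume)"
    by (rule nn_integral_const[symmetric])
  also have "\<dots> \<le> (\<integral>\<^sup>+z. \<integral>\<^sup>+\<gamma>. h (act \<gamma> z) \<partial>counting \<partial>dom_volume)"
  proof (intro nn_integral_mono_AE, use AE_dom_volume in eventually_elim)
    case (elim z)
    then have z: "z \<in> unit_ball" using fund_dom_subset by blast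
    then obtain \<gamma> where \<gamma>: "\<gamma> \<in> \<Gamma>" "norm (act \<gamma> z) < r" using r(3) by blast
    then have "(norm (act \<gamma> z))\<^sup>2 \<le> r\<^sup>2" by (intro power_mono) auto
    then have "c \<le> h (act \<gamma> z)"
      using \<gamma> z r2 unfolding c_def h_def by (auto simp: act_in_ball intro!: ennreal_leI power_mono)
    also have "\<dots> \<le> (\<integral>\<^sup>+\<gamma>. h (act \<gamma> z) \<partial>counting)"
      by (rule nn_integral_ge_point[OF \<gamma>(1)])
    finally show ?case .
  qed
  also have "\<dots> = emeasure lborel (ball (0::complex^2) 1)"
    using unfolding_nn[of h] nn_integral_weight_3 by (simp add: h_def)
  also have "\<dots> < \<infinity>" using emeasure_lborel_ball_finite[of "0::complex^2" 1] by simp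
  finally show "emeasure dom_volume (space dom_volume) \<noteq> \<infinity>"
    using r2 by (auto simp: c_def ennreal_mult_eq_top_iff)
qed

text \<open>
  The map \<open>(\<gamma>, z) \<mapsto> act \<gamma> z\<close> carries counting measure times the volume of the domain to the
  hyperbolic volume, so this is Fubini's theorem on the product.
\<close>

theorem integral_unfolding:
  fixes h :: "complex^2 \<Rightarrow> complex"
  assumes h: "integrable hyp_volume h"
  shows "(\<integral>z. h z \<partial>hyp_volume) = (\<integral>z. (\<integral>\<gamma>. h (act \<gamma> z) \<partial>counting) \<partial>dom_volume)"
    and "integrable dom_volume (\<lambda>z. \<integral>\<gamma>. h (act \<gamma> z) \<partial>counting)"
proof -
  interpret MD: finite_measure dom_volume by (rule finite_dom_volume)
  interpret C: sigma_finite_measure "counting"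
    by (rule sigma_finite_measure_count_space_countable[OF countable_group])
  interpret P: pair_sigma_finite "counting" dom_volume ..
  define P where "P = counting \<Otimes>\<^sub>M dom_volume"
  define \<phi> where "\<phi> p = act (fst p) (snd p)" for p :: "(complex^3^3) \<times> (complex^2)"
  have \<phi> [measurable]: "\<phi> \<in> measurable P hyp_volume"
    unfolding P_def \<phi>_def by (rule measurable_pair_measure_countable1[OF countable_group]) simp
  have distr_eq: "distr P hyp_volume \<phi> = hyp_volume"
  proof (rule measure_eqI)
    fix A assume "A \<in> sets (distr P hyp_volume \<phi>)"
    then have A: "A \<in> sets borel" by simp
    have "emeasure (distr P hyp_volume \<phi>) A = (\<integral>\<^sup>+u. indicator A u \<partial>distr P hyp_volume \<phi>)"
      using A by simp
    also have "\<dots> = (\<integral>\<^sup>+p. indicator A (\<phi> p) \<partial>P)"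
      using A by (intro nn_integral_distr) auto
    also have "\<dots> = (\<integral>\<^sup>+\<gamma>. \<integral>\<^sup>+z. indicator A (\<phi> (\<gamma>, z)) \<partial>dom_volume \<partial>counting)"
      unfolding P_def
      by (rule MD.nn_integral_fst[symmetric], rule measurable_compose[OF \<phi>[unfolded P_def]]) (use A in simp)
    also have "\<dots> = (\<integral>\<^sup>+u. indicator A u \<partial>hyp_volume)"
      using A by (subst unfolding_product) (auto simp: \<phi>_def)
    finally show "emeasure (distr P hyp_volume \<phi>) A = emeasure hyp_volume A" using A by simp
  qed simp
  have hm [measurable]: "h \<in> borel_measurable hyp_volume" using h by auto
  have "integrable P (\<lambda>p. h (\<phi> p))"
    using h by (subst (asm) distr_eq[symmetric]) (simp add: integrable_distr_eq)
  then have int: "integrable (counting \<Otimes>\<^sub>M dom_volume) (case_prod (\<lambda>\<gamma> z. h (act \<gamma> z)))"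
    by (simp add: P_def \<phi>_def case_prod_beta')
  have "(\<integral>z. h z \<partial>hyp_volume) = (\<integral>p. h (\<phi> p) \<partial>P)"
    by (subst distr_eq[symmetric]) (rule integral_distr[OF \<phi> hm])
  also have "\<dots> = integral\<^sup>L (counting \<Otimes>\<^sub>M dom_volume) (case_prod (\<lambda>\<gamma> z. h (act \<gamma> z)))"
    by (simp add: P_def \<phi>_def case_prod_beta')
  also have "\<dots> = (\<integral>z. (\<integral>\<gamma>. h (act \<gamma> z) \<partial>counting) \<partial>dom_volume)"
    by (rule P.integral_snd[OF int, symmetric])
  finally show "(\<integral>z. h z \<partial>hyp_volume) = (\<integral>z. (\<integral>\<gamma>. h (act \<gamma> z) \<partial>counting) \<partial>dom_volume)" .
  show "integrable dom_volume (\<lambda>z. \<integral>\<gamma>. h (act \<gamma> z) \<partial>counting)"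
    by (rule P.integrable_snd[OF int])
qed

text \<open>
  Since \<open>1 - |\<gamma>z|\<^sup>2 = (1 - |z|\<^sup>2) / |aut_factor \<gamma> z|\<^sup>2\<close> and the automorphy factor is at most
  \<open>2 |\<gamma>\<^sub>3\<^sub>3|\<close>, the unfolded integral of \<open>(1 - |u|\<^sup>2)\<^sup>3\<close> dominates a positive multiple of the series. It is
  finite, being the Euclidean volume of the ball.
\<close>

theorem summable_lattice: "integrable counting (\<lambda>\<gamma>. 1 / cmod (\<gamma>$3$3) ^ 6)"
proof -
  define h :: "complex^2 \<Rightarrow> ennreal" where "h z = indicator unit_ball z * ennreal (defect z ^ 3)" for z
  have [measurable]: "h \<in> borel_measurable borel" unfolding h_def by measurable
  define s where "s z = (\<integral>\<^sup>+\<gamma>. h (act \<gamma> z) \<partial>counting)" for z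
  have Is: "(\<integral>\<^sup>+z. s z \<partial>dom_volume) = emeasure lborel (ball (0::complex^2) 1)"
    using unfolding_nn[of h] nn_integral_weight_3 by (simp add: s_def h_def)
  define L where "L = (\<integral>\<^sup>+\<gamma>. ennreal (1 / cmod (\<gamma>$3$3) ^ 6) \<partial>counting)"
  define b where "b z = ennreal (defect z ^ 3 / 64)" for z :: "complex^2"
  have [measurable]: "b \<in> borel_measurable borel" unfolding b_def by measurable
  have bound: "b z * ennreal (1 / cmod (\<gamma>$3$3) ^ 6) \<le> h (act \<gamma> z)"
    if \<gamma>: "\<gamma> \<in> \<Gamma>" and z: "z \<in> unit_ball" for \<gamma> z
  proof -
    define J where "J = cmod (aut_factor \<gamma> z)"
    define q where "q = defect z"
    have q: "0 < q" using z by (simp add: q_def unit_ball_sq)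
    have J: "0 < J" using \<gamma> z by (simp add: J_def aut_factor_nonzero)
    have "J\<^sup>2 * (defect (act \<gamma> z)) = q"
      using one_minus_norm_act[of \<gamma> z] \<gamma> z by (simp add: J_def q_def)
    then have eq: "defect (act \<gamma> z) = q / J\<^sup>2" using J by (simp add: field_simps)
    have hval: "h (act \<gamma> z) = ennreal (q ^ 3 / J ^ 6)"
      using \<gamma> z by (simp add: h_def act_in_ball eq power_divide flip: power_mult)
    have J2: "J \<le> 2 * cmod (\<gamma>$3$3)" using aut_factor_bounds(2)[of \<gamma> z] \<gamma> z by (simp add: J_def)
    then have "J ^ 6 \<le> (2 * cmod (\<gamma>$3$3)) ^ 6" using J by (intro power_mono) auto
    then have "q ^ 3 / (64 * cmod (\<gamma>$3$3) ^ 6) \<le> q ^ 3 / J ^ 6"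
      using J q by (intro divide_left_mono) (auto simp: power_mult_distrib intro!: mult_pos_pos)
    then show ?thesis
      using q by (simp add: hval b_def q_def[symmetric] ennreal_mult[symmetric] ennreal_leI)
  qed
  have "(\<integral>\<^sup>+z. b z \<partial>dom_volume) * L = (\<integral>\<^sup>+z. b z * L \<partial>dom_volume)"
    by (rule nn_integral_multc[symmetric]) simp
  also have "\<dots> \<le> (\<integral>\<^sup>+z. s z \<partial>dom_volume)"
  proof (intro nn_integral_mono_AE, use AE_dom_volume in eventually_elim)
    case (elim z)
    then have "z \<in> unit_ball" using fund_dom_subset by blast
    then show ?case
      unfolding L_def s_def by (subst nn_integral_cmult[symmetric]) (auto intro!: nn_integral_mono bound)
  qed
  also have "\<dots> < \<infinity>"
    unfolding Is using emeasure_lborel_ball_finite[of "0::complex^2" 1] by simp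
  finally have fin: "(\<integral>\<^sup>+z. b z \<partial>dom_volume) * L < \<infinity>" .
  have "(\<integral>\<^sup>+z. b z \<partial>dom_volume) \<noteq> 0"
  proof
    assume "(\<integral>\<^sup>+z. b z \<partial>dom_volume) = 0"
    then have "AE z in dom_volume. b z = 0" by (subst (asm) nn_integral_0_iff_AE) auto
    then have "AE z in dom_volume. s z = 0"
      using AE_dom_volume
    proof eventually_elim
      case (elim z)
      then have "z \<in> unit_ball" using fund_dom_subset by blast
      then have "0 < (defect z) ^ 3" by (simp add: unit_ball_sq)
      then show ?case using elim by (simp add: b_def ennreal_eq_0_iff)
    qed
    then have "(\<integral>\<^sup>+z. s z \<partial>dom_volume) = (\<integral>\<^sup>+z. 0 \<partial>dom_volume)"
      by (rule nn_integral_cong_AE)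
    then show False
      unfolding Is by (simp add: emeasure_ball unit_ball_vol_pos[THEN less_imp_neq, symmetric])
  qed
  then have "L < \<infinity>"
    using fin by (auto simp: ennreal_mult_less_top)
  then show ?thesis
    unfolding L_def by (intro integrableI_nonneg) auto
qed

end

section \<open>Mean values and the reproducing formula on the ball\<close>

text \<open>
  Averaging \<open>\<zeta>\<^bsup>n\<^esup>\<close> over the \<open>N\<close>-th roots of unity gives \<open>0\<close> unless \<open>N\<close> divides \<open>n\<close>; hence the average of
  the power series is the constant term up to a tail. Finite averages replace circle integrals, so
  that the mean value property in the ball needs only dominated convergence.
\<close>

lemma root_of_unity_average:
  assumes f: "f holomorphic_on ball 0 R" and R: "1 < R"
  shows "(\<lambda>N. (\<Sum>j<N. f (exp (2 * of_real pi * \<i> / of_nat N) ^ j)) / of_nat N) \<longlonglongrightarrow> f 0"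
proof -
  define a where "a n = (deriv ^^ n) f 0 / fact n" for n
  have sums: "(\<lambda>n. a n * z ^ n) sums f z" if "norm z < R" for z
    using holomorphic_power_series[OF f, of z] that by (simp add: a_def)
  have abs: "summable (\<lambda>n. norm (a n))"
  proof -
    obtain \<rho> where \<rho>: "1 < \<rho>" "\<rho> < R" using dense[OF R] by blast
    have "summable (\<lambda>n. a n * of_real \<rho> ^ n)"
      using sums[of "of_real \<rho>"] \<rho> by (auto simp: sums_iff)
    from powser_insidea[OF this, of 1] show ?thesis using \<rho> by simp
  qed
  define \<omega> where "\<omega> N = exp (2 * of_real pi * \<i> / of_nat N)" for N :: nat
  have norm\<omega>: "norm (\<omega> N ^ j) = 1" for N j
    by (simp add: \<omega>_def norm_power)
  define T where "T N = (\<Sum>n. norm (a (n + N)))" for N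
  have T: "T \<longlonglongrightarrow> 0"
    unfolding T_def using suminf_exist_split2[OF abs] by simp
  have bound: "norm ((\<Sum>j<N. f (\<omega> N ^ j)) / of_nat N - f 0) \<le> T N" if N: "0 < N" for N
  proof -
    \<comment> \<open>The average of the monomial \<open>\<zeta> ^ n\<close>; it vanishes for \<open>0 < n < N\<close> and has modulus at most \<open>1\<close>.\<close>
    define c where "c n = (\<Sum>j<N. (\<omega> N ^ j) ^ n) / of_nat N" for n
    have "(\<lambda>n. \<Sum>j<N. a n * (\<omega> N ^ j) ^ n) sums (\<Sum>j<N. f (\<omega> N ^ j))"
      using R by (intro sums_sum sums) (simp add: norm\<omega>)
    then have "(\<lambda>n. (\<Sum>j<N. a n * (\<omega> N ^ j) ^ n) / of_nat N) sums ((\<Sum>j<N. f (\<omega> N ^ j)) / of_nat N)"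
      by (rule sums_divide)
    then have s: "(\<lambda>n. a n * c n) sums ((\<Sum>j<N. f (\<omega> N ^ j)) / of_nat N)"
      by (simp add: c_def sum_distrib_left[symmetric])
    have c0: "c 0 = 1" using N by (simp add: c_def)
    have cn: "c n = 0" if n: "0 < n" "n < N" for n
    proof -
      define x where "x = \<omega> N ^ n"
      have x: "x = exp (2 * of_real pi * \<i> * of_nat n / of_nat N)"
        by (simp add: x_def \<omega>_def exp_of_nat_mult[symmetric] field_simps)
      have "x \<noteq> 1"
      proof
        assume "x = 1"
        then obtain k :: int where k: "2 * pi * real n / real N = of_int (2 * k) * pi"
          unfolding x exp_eq_1 by auto
        then have "real n = of_int k * real N" using N by (simp add: field_simps)
        then have "int n = k * int N" by (metis of_int_eq_iff of_int_mult of_int_of_nat_eq)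
        then have "int N dvd int n" by simp
        then show False using n by (simp add: nat_dvd_not_less)
      qed
      moreover have "x ^ N = 1"
      proof -
        have "\<omega> N ^ N = 1" using N by (simp add: \<omega>_def exp_of_nat_mult[symmetric])
        then show ?thesis unfolding x_def by (metis power_commutes power_mult mult.commute power_one)
      qed
      ultimately have "(\<Sum>j<N. x ^ j) = 0" by (simp add: geometric_sum)
      then show ?thesis by (simp add: c_def x_def power_mult[symmetric] mult.commute)
    qed
    have c_le: "norm (c n) \<le> 1" for n
    proof -
      have "norm (\<Sum>j<N. (\<omega> N ^ j) ^ n) \<le> (\<Sum>j<N. norm ((\<omega> N ^ j) ^ n))" by (rule norm_sum)
      also have "\<dots> = real N" using norm\<omega>[of N 1] by (simp add: norm_power)
      finally show ?thesis using N by (simp add: c_def norm_divide field_simps)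
    qed
    have f0: "f 0 = a 0" by (simp add: a_def)
    have sm: "(\<Sum>n<N. a n * c n) = a 0"
    proof -
      have "(\<Sum>n<N. a n * c n) = (\<Sum>n<N. if n = 0 then a 0 else 0)"
        by (intro sum.cong) (auto simp: c0 cn)
      then show ?thesis using N by simp
    qed
    have summ: "summable (\<lambda>n. a n * c n)" using s by (simp add: sums_iff)
    have "(\<Sum>j<N. f (\<omega> N ^ j)) / of_nat N = (\<Sum>n. a (n + N) * c (n + N)) + a 0"
      using suminf_split_initial_segment[OF summ, of N] s sm by (simp add: sums_iff)
    then have "(\<Sum>j<N. f (\<omega> N ^ j)) / of_nat N - f 0 = (\<Sum>n. a (n + N) * c (n + N))"
      by (simp add: f0)
    also have "norm \<dots> \<le> T N"
      unfolding T_def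
    proof (rule norm_suminf_le)
      show "norm (a (n + N) * c (n + N)) \<le> norm (a (n + N))" for n
        using c_le[of "n + N"] by (simp add: norm_mult mult_left_le)
    qed (rule summable_ignore_initial_segment[OF abs])
    finally show ?thesis .
  qed
  have "(\<lambda>N. (\<Sum>j<N. f (\<omega> N ^ j)) / of_nat N - f 0) \<longlonglongrightarrow> 0"
  proof (rule Lim_null_comparison[OF _ T])
    show "\<forall>\<^sub>F N in sequentially. norm ((\<Sum>j<N. f (\<omega> N ^ j)) / of_nat N - f 0) \<le> T N"
      using eventually_gt_at_top[of 0] by eventually_elim (rule bound)
  qed
  then show ?thesis unfolding \<omega>_def by (rule LIM_zero_cancel)
qed

lemma holomorphic2_continuous_on: "holomorphic2_on f S \<Longrightarrow> continuous_on S f"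
  unfolding holomorphic2_on_def
  by (meson continuous_at_imp_continuous_on has_derivative_continuous)

lemma holomorphic2_measurable:
  assumes f: "holomorphic2_on f unit_ball" and zero: "\<And>z. z \<notin> unit_ball \<Longrightarrow> f z = 0"
  shows "f \<in> borel_measurable borel"
proof -
  have "(\<lambda>z. indicator unit_ball z *\<^sub>R f z) \<in> borel_measurable borel"
    by (intro borel_measurable_continuous_on_indicator holomorphic2_continuous_on f) simp
  also have "(\<lambda>z. indicator unit_ball z *\<^sub>R f z) = f"
    using zero by (auto simp: indicator_def)
  finally show ?thesis .
qed

lemma holomorphic2_on_line:
  assumes f: "holomorphic2_on f unit_ball" and w: "w \<in> unit_ball"
  shows "(\<lambda>\<zeta>. f (\<zeta> *s w)) holomorphic_on ball 0 (2 / (1 + norm w))"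
proof -
  have "\<exists>D. ((\<lambda>\<zeta>. f (\<zeta> *s w)) has_field_derivative D) (at \<zeta>)" if \<zeta>: "\<zeta> \<in> ball 0 (2 / (1 + norm w))" for \<zeta>
  proof -
    have ns: "norm (c *s v) = cmod c * norm v" for c and v :: "complex^2"
      by (simp add: norm_vec_def L2_set_def norm_mult power_mult_distrib sum_distrib_left[symmetric] real_sqrt_mult)
    have "norm (\<zeta> *s w) < 1"
    proof (cases "w = 0")
      case False
      have "cmod \<zeta> * norm w < 2 / (1 + norm w) * norm w"
        using \<zeta> False by (intro mult_strict_right_mono) auto
      also have "\<dots> \<le> 1"
      proof -
        have "0 < 1 + norm w" using norm_ge_zero[of w] by linarith
        then show ?thesis using w by (simp add: unit_ball_def field_simps)
      qed
      finally show ?thesis by (simp add: ns)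
    qed (simp add: ns)
    then have "\<zeta> *s w \<in> unit_ball" by (simp add: unit_ball_def)
    then obtain f' where f': "(f has_derivative f') (at (\<zeta> *s w))" "\<And>c v. f' (c *s v) = c * f' v"
      using f unfolding holomorphic2_on_def by metis
    have "((\<lambda>\<zeta>. \<zeta> *s w) has_derivative (\<lambda>\<zeta>. \<zeta> *s w)) (at \<zeta>)"
      by (rule has_derivative_vecI) (auto intro!: derivative_eq_intros)
    from has_derivative_compose[OF this f'(1)]
    have "((\<lambda>\<zeta>. f (\<zeta> *s w)) has_derivative (\<lambda>h. f' w * h)) (at \<zeta>)"
      by (simp add: f'(2) mult.commute)
    then show ?thesis by (auto simp: has_field_derivative_def)
  qed
  then show ?thesis
    by (simp add: holomorphic_on_open)
qed

text \<open>
  A representative in \<open>SU21\<close> of the rotation \<open>z \<mapsto> cis t *s z\<close>; the exponents \<open>t/3\<close> and \<open>-2t/3\<close> make the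
  determinant \<open>1\<close>.
\<close>

definition scalar_rotation :: "real \<Rightarrow> complex^3^3" where
  "scalar_rotation t = (\<chi> i j. if i = j then (if i = 3 then cis (- 2 * t / 3) else cis (t / 3)) else 0)"

lemma scalar_rotation_SU21: "scalar_rotation t \<in> carrier SU21"
proof (rule SU21I)
  show "det (scalar_rotation t) = 1"
    by (simp add: det_3 scalar_rotation_def cis_mult)
  have "cnj (cis x) * cis x = 1" for x by (simp add: cis_cnj cis_mult)
  then show "cnj (scalar_rotation t $ 1 $ i) * scalar_rotation t $ 1 $ j +
      cnj (scalar_rotation t $ 2 $ i) * scalar_rotation t $ 2 $ j -
      cnj (scalar_rotation t $ 3 $ i) * scalar_rotation t $ 3 $ j = H21 $ i $ j" for i j
    using exhaust_3[of i] exhaust_3[of j] by (auto simp: scalar_rotation_def H21_def)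
qed

lemma act_scalar_rotation: "act (scalar_rotation t) z = cis t *s z"
proof -
  have "cis (t / 3) / cis (- 2 * t / 3) = cis t"
    by (simp add: cis_divide field_simps)
  moreover have "(scalar_rotation t *v lift z) $ 1 = cis (t / 3) * z $ 1"
    "(scalar_rotation t *v lift z) $ 2 = cis (t / 3) * z $ 2"
    "(scalar_rotation t *v lift z) $ 3 = cis (- 2 * t / 3)"
    by (simp_all add: matrix_lift_nth scalar_rotation_def)
  ultimately show ?thesis
    by (simp add: act_def aut_factor_def vec_eq_iff forall_2 flip: times_divide_eq_left)
qed

lemma norm_cis_smult: "norm (cis t *s z) = norm z" for z :: "complex^2"
  by (simp add: norm_vec_def L2_set_def norm_mult)

definition weight_volume :: "nat \<Rightarrow> real" where
  "weight_volume m = (\<integral>z. indicator unit_ball z * defect z ^ m \<partial>hyp_volume)"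

lemma weight_nonneg: "0 \<le> indicator unit_ball z * defect z ^ m" for z :: "complex^2"
  by (auto simp: indicator_def unit_ball_sq)

lemma nn_integral_weight:
  "3 \<le> m \<Longrightarrow> (\<integral>\<^sup>+z. ennreal (indicator unit_ball z * defect z ^ m) \<partial>hyp_volume)
    = (\<integral>\<^sup>+z. ennreal (indicator unit_ball z * defect z ^ (m - 3)) \<partial>lborel)"
  using nn_integral_weight_ge_3[of m]
  by (simp add: ennreal_mult'' ennreal_indicator weight_nonneg indicator_mult_ennreal unit_ball_sq)

lemma integrable_weight:
  assumes "3 \<le> m"
  shows "integrable hyp_volume (\<lambda>z. indicator unit_ball z * defect z ^ m)"
proof (rule integrableI_nonneg)
  have "(\<integral>\<^sup>+z. ennreal (indicator unit_ball z * defect z ^ (m - 3)) \<partial>lborel)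
     \<le> (\<integral>\<^sup>+z. indicator (ball (0::complex^2) 1) z \<partial>lborel)"
    by (intro nn_integral_mono)
      (auto simp: indicator_def unit_ball_eq[symmetric] unit_ball_sq intro!: power_le_one)
  also have "\<dots> < \<infinity>" using emeasure_lborel_ball_finite[of "0::complex^2" 1] by simp
  finally show "(\<integral>\<^sup>+z. ennreal (indicator unit_ball z * defect z ^ m) \<partial>hyp_volume) < \<infinity>"
    by (simp add: nn_integral_weight assms)
qed (auto simp: weight_nonneg)

text \<open>
  On the ball of radius \<open>(2m)\<^bsup>-1/2\<^esup>\<close> the integrand is at least \<open>1/2\<close> by Bernoulli's inequality, and the
  volume of this ball is proportional to \<open>m\<^bsup>-2\<^esup>\<close> because the real dimension is \<open>4\<close>.
\<close>

lemma weight_volume_ge: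
  assumes "3 \<le> m"
  shows "measure lborel (ball (0::complex^2) 1) / (8 * (real m)\<^sup>2) \<le> weight_volume m"
proof -
  define r where "r = 1 / sqrt (2 * real m)"
  have m: "0 < real m" using assms by simp
  have r: "0 \<le> r" "r\<^sup>2 = 1 / (2 * real m)" using m by (simp_all add: r_def power_divide)
  have "r\<^sup>2 < 1" using r assms by simp
  then have r1: "r < 1" using r(1) by (simp add: power_less_one_iff abs_square_less_1)
  have "ennreal (1/2) * emeasure lborel (ball (0::complex^2) r) = (\<integral>\<^sup>+z. ennreal (1/2) * indicator (ball (0::complex^2) r) z \<partial>lborel)"
    by (rule nn_integral_cmult_indicator[symmetric]) simp
  also have "\<dots> \<le> (\<integral>\<^sup>+z. ennreal (indicator unit_ball z * defect z ^ (m - 3)) \<partial>lborel)"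
  proof (intro nn_integral_mono)
    fix z :: "complex^2"
    show "ennreal (1/2) * indicator (ball 0 r) z \<le> ennreal (indicator unit_ball z * defect z ^ (m - 3))"
    proof (cases "norm z < r")
      case True
      then have zr: "(norm z)\<^sup>2 \<le> 1 / (2 * real m)"
        unfolding r(2)[symmetric] by (intro power_mono) auto
      have "1 / 2 \<le> 1 - real m * (norm z)\<^sup>2"
        using mult_left_mono[OF zr, of "real m"] m by simp
      also have "\<dots> \<le> 1 - real (m - 3) * (norm z)\<^sup>2"
        by (simp add: mult_right_mono)
      also have "\<dots> = 1 + real (m - 3) * (- (norm z)\<^sup>2)" by simp
      also have "\<dots> \<le> (1 + (- (norm z)\<^sup>2)) ^ (m - 3)"
      proof (rule Bernoulli_inequality)
        show "- 1 \<le> - (norm z)\<^sup>2" using True r1 by (simp add: power_le_one)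
      qed
      finally have "ennreal (1/2) \<le> ennreal (defect z ^ (m - 3))" by (intro ennreal_leI) simp
      moreover have "z \<in> unit_ball" "z \<in> ball 0 r" using True r1 by (auto simp: unit_ball_def)
      ultimately show ?thesis by (simp only: indicator_simps mult_1_right mult_1_left)
    qed (simp add: indicator_def)
  qed
  also have "\<dots> = (\<integral>\<^sup>+z. ennreal (indicator unit_ball z * defect z ^ m) \<partial>hyp_volume)"
    by (rule nn_integral_weight[OF assms, symmetric])
  also have "\<dots> = ennreal (weight_volume m)"
    unfolding weight_volume_def
    by (rule nn_integral_eq_integral[OF integrable_weight[OF assms]]) (simp add: weight_nonneg)
  finally have le: "ennreal (1/2) * emeasure lborel (ball (0::complex^2) r) \<le> ennreal (weight_volume m)" .
  have nonneg: "0 \<le> weight_volume m"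
    unfolding weight_volume_def by (intro Bochner_Integration.integral_nonneg) (simp add: weight_nonneg)
  have "emeasure lborel (ball (0::complex^2) r) = ennreal (unit_ball_vol 4 * r ^ 4)"
    using emeasure_ball[OF r(1), of "0::complex^2"] by simp
  moreover have "measure lborel (ball (0::complex^2) 1) = unit_ball_vol 4"
    using emeasure_ball[of 1 "0::complex^2"] by (simp add: measure_def)
  moreover have "r ^ 4 = 1 / (4 * (real m)\<^sup>2)"
    using r(2) by (metis (no_types, lifting) power2_eq_square power4_eq_xxxx mult.assoc divide_divide_eq_left
      mult_2_right numeral_Bit0 power_divide power_mult_distrib power_one times_divide_eq_left)
  ultimately have "ennreal (1/2) * ennreal (measure lborel (ball (0::complex^2) 1) / (4 * (real m)\<^sup>2)) \<le> ennreal (weight_volume m)"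
    using le by simp
  then have "ennreal (1/2 * (measure lborel (ball (0::complex^2) 1) / (4 * (real m)\<^sup>2))) \<le> ennreal (weight_volume m)"
    by (subst ennreal_mult) auto
  then show ?thesis using nonneg by (simp only: ennreal_le_iff)
qed

lemma unit_ball_measure_pos: "0 < measure lborel (ball (0::complex^2) 1)"
  by (simp add: content_ball_pos)

lemma weight_volume_pos: "3 \<le> m \<Longrightarrow> 0 < weight_volume m"
  using weight_volume_ge[of m] unit_ball_measure_pos
  by (smt (verit) divide_pos_pos less_le_trans mult_pos_pos of_nat_0_less_iff zero_less_power not_numeral_le_zero gr0I)

text \<open>
  The integral is unchanged if \<open>g\<close> is replaced by its average over a finite group of rotations, and these
  averages tend to \<open>g 0\<close> pointwise.
\<close>

theorem mean_value_ball:
  assumes g: "holomorphic2_on g unit_ball" and zero: "\<And>z. z \<notin> unit_ball \<Longrightarrow> g z = 0"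
    and bound: "\<And>z. z \<in> unit_ball \<Longrightarrow> cmod (g z) * defect z ^ m \<le> A * defect z ^ 3"
  shows "integrable hyp_volume (\<lambda>z. of_real (defect z ^ m) * g z)"
    and "(\<integral>z. of_real (defect z ^ m) * g z \<partial>hyp_volume) = g 0 * of_real (weight_volume m)"
proof -
  have gm [measurable]: "g \<in> borel_measurable borel" by (rule holomorphic2_measurable[OF g zero])
  define k where "k z = of_real (defect z ^ m) * g z" for z
  have km [measurable]: "k \<in> borel_measurable borel" unfolding k_def by measurable
  define b where "b z = A * (indicator unit_ball z * defect z ^ 3)" for z :: "complex^2"
  have bi: "integrable hyp_volume b"
    unfolding b_def by (intro integrable_mult_right integrable_weight) simp
  have kb: "cmod (k z) \<le> b z" for z
  proof (cases "z \<in> unit_ball")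
    case True
    then have "\<bar>defect z\<bar> = defect z" by (simp add: unit_ball_sq)
    then show ?thesis using bound[OF True] True by (simp add: k_def b_def norm_mult norm_power mult.commute del: of_real_power)
  qed (simp add: k_def b_def zero)
  show ki: "integrable hyp_volume k"
    by (rule Bochner_Integration.integrable_bound[OF bi]) (use kb in \<open>auto intro: order_trans[OF _ abs_ge_self]\<close>)
  define \<omega> where "\<omega> N j = cis (2 * pi * real j / real N)" for N j :: nat
  have \<omega>_eq: "exp (2 * of_real pi * \<i> / of_nat N) ^ j = \<omega> N j" for N j
    by (simp add: \<omega>_def cis_conv_exp exp_of_nat_mult[symmetric] field_simps)
  define S where "S N z = (\<Sum>j<N. k (\<omega> N j *s z)) / of_nat N" for N z
  have rot: "k (\<omega> N j *s z) = k (act (scalar_rotation (2 * pi * real j / real N)) z)" for N j z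
    by (simp add: \<omega>_def act_scalar_rotation)
  have Sm: "S N \<in> borel_measurable borel" for N
    unfolding S_def rot by measurable
  have ki': "integrable hyp_volume (\<lambda>z. k (act \<gamma> z))" if "\<gamma> \<in> carrier SU21" for \<gamma>
    using ki by (subst (asm) distr_hyp_volume[OF that, symmetric]) (simp add: integrable_distr_eq)
  have SI: "(\<integral>z. S N z \<partial>hyp_volume) = (\<integral>z. k z \<partial>hyp_volume)" if "0 < N" for N
  proof -
    have "(\<integral>z. S N z \<partial>hyp_volume) =
      (\<Sum>j<N. \<integral>z. k (act (scalar_rotation (2 * pi * real j / real N)) z) \<partial>hyp_volume) / of_nat N"
      unfolding S_def rot by (simp add: Bochner_Integration.integral_sum ki' scalar_rotation_SU21)
    also have "\<dots> = (\<integral>z. k z \<partial>hyp_volume)"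
      using that by (simp add: integral_hyp_volume_act[OF scalar_rotation_SU21])
    finally show ?thesis .
  qed
  define f where "f z = of_real (indicator unit_ball z * defect z ^ m) * g 0" for z :: "complex^2"
  have "(\<lambda>N. \<integral>z. S N z \<partial>hyp_volume) \<longlonglongrightarrow> (\<integral>z. f z \<partial>hyp_volume)"
  proof (rule integral_dominated_convergence[OF _ _ bi])
    show "f \<in> borel_measurable hyp_volume" unfolding f_def by measurable
    show "S N \<in> borel_measurable hyp_volume" for N using Sm by simp
    have "cmod (S N z) \<le> b z" for N z
    proof (cases "N = 0")
      case True
      then show ?thesis using order_trans[OF norm_ge_zero kb[of z]] by (simp add: S_def)
    next
      case False
      have bz: "b (\<omega> N j *s z) = b z" for j
        by (simp add: b_def \<omega>_def norm_cis_smult unit_ball_def indicator_def)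
      have "cmod (\<Sum>j<N. k (\<omega> N j *s z)) \<le> (\<Sum>j<N. b z)"
        by (rule order_trans[OF norm_sum], rule sum_mono) (metis kb bz)
      then show ?thesis using False by (simp add: S_def norm_divide field_simps)
    qed
    then show "AE z in hyp_volume. cmod (S N z) \<le> b z" for N by simp
    show "AE z in hyp_volume. (\<lambda>N. S N z) \<longlonglongrightarrow> f z"
      using AE_hyp_volume_ball
    proof eventually_elim
      case (elim z)
      have "0 < 1 + norm z" using norm_ge_zero[of z] by linarith
      then have "1 < 2 / (1 + norm z)" using elim by (simp add: unit_ball_def field_simps)
      from root_of_unity_average[OF holomorphic2_on_line[OF g elim] this]
      have "(\<lambda>N. (\<Sum>j<N. g (\<omega> N j *s z)) / of_nat N) \<longlonglongrightarrow> g 0"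
        unfolding \<omega>_eq by simp
      then have "(\<lambda>N. of_real (defect z ^ m) * ((\<Sum>j<N. g (\<omega> N j *s z)) / of_nat N)) \<longlonglongrightarrow> of_real (defect z ^ m) * g 0"
        by (rule tendsto_mult_left)
      also have "of_real (defect z ^ m) * g 0 = f z" using elim by (simp add: f_def)
      also have "(\<lambda>N. of_real (defect z ^ m) * ((\<Sum>j<N. g (\<omega> N j *s z)) / of_nat N)) = (\<lambda>N. S N z)"
        by (rule ext) (simp add: S_def k_def \<omega>_def norm_cis_smult sum_distrib_left)
      finally show ?case .
    qed
  qed
  then have "(\<lambda>N. \<integral>z. k z \<partial>hyp_volume) \<longlonglongrightarrow> (\<integral>z. f z \<partial>hyp_volume)"
  proof (rule Lim_transform_eventually)
    show "\<forall>\<^sub>F N in sequentially. (\<integral>z. S N z \<partial>hyp_volume) = (\<integral>z. k z \<partial>hyp_volume)"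
      using eventually_gt_at_top[of 0] by eventually_elim (rule SI)
  qed
  then have "(\<integral>z. k z \<partial>hyp_volume) = (\<integral>z. f z \<partial>hyp_volume)"
    by (simp add: LIMSEQ_const_iff)
  also have "\<dots> = of_real (weight_volume m) * g 0"
    unfolding f_def weight_volume_def integral_mult_left_zero by (simp only: integral_complex_of_real)
  finally show "(\<integral>z. k z \<partial>hyp_volume) = g 0 * of_real (weight_volume m)"
    by (simp add: mult.commute)
qed

text \<open>
  The third column is the normalized lift of \<open>z\<close>, so that \<open>0\<close> is sent to \<open>z\<close>. The first is a unit
  vector orthogonal to it with vanishing second coordinate, and the second is orthogonal to both.
\<close>

definition boost :: "complex^2 \<Rightarrow> complex^3^3" where
  "boost z = (let a = z$1; b = z$2; q = 1 - (cmod a)\<^sup>2; p = of_real (sqrt q); s = of_real (sqrt (defect z)) in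
     vector [vector [1 / p, a * cnj b / (s * p), a / s],
             vector [0, of_real q / (s * p), b / s],
             vector [cnj a / p, cnj b / (s * p), 1 / s]])"

lemma boost:
  assumes z: "z \<in> unit_ball"
  shows boost_SU21: "boost z \<in> carrier SU21" and act_boost: "act (boost z) 0 = z"
proof -
  define a b where "a = z$1" and "b = z$2"
  define q where "q = 1 - (cmod a)\<^sup>2"
  define r where "r = defect z"
  define p s where "p = complex_of_real (sqrt q)" and "s = complex_of_real (sqrt r)"
  have r: "0 < r" using z by (simp add: r_def unit_ball_sq)
  have rq: "r = q - (cmod b)\<^sup>2" by (simp add: r_def q_def a_def b_def norm_complex2)
  then have q: "0 < q" using r by (smt (verit) zero_le_power2)
  have pp: "p * p = of_real q" and ss: "s * s = of_real r"
    unfolding p_def s_def of_real_mult[symmetric] using q r by simp_all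
  have ps0: "p \<noteq> 0" "s \<noteq> 0" using q r by (simp_all add: p_def s_def)
  have cps [simp]: "cnj p = p" "cnj s = s" by (simp_all add: p_def s_def)
  have qa: "complex_of_real q = 1 - a * cnj a" by (simp add: q_def complex_norm_square del: of_real_power)
  have ra: "complex_of_real r = 1 - a * cnj a - b * cnj b"
    unfolding rq qa[symmetric] by (simp add: complex_norm_square[symmetric])
  have B: "boost z = vector [vector [1 / p, a * cnj b / (s * p), a / s],
             vector [0, of_real q / (s * p), b / s],
             vector [cnj a / p, cnj b / (s * p), 1 / s]]"
    by (simp add: boost_def Let_def a_def b_def q_def p_def s_def r_def)
  show "boost z \<in> carrier SU21"
  proof (rule SU21I)
    have "det (boost z) = (of_real q * (1 - a * cnj a) - b * cnj b + a * cnj a * (b * cnj b)) / (p * p * (s * s))"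
      unfolding B det_3 using ps0 by (simp add: field_simps)
    also have "of_real q * (1 - a * cnj a) - b * cnj b + a * cnj a * (b * cnj b) = complex_of_real q * of_real r"
      unfolding qa ra by (simp add: algebra_simps)
    finally show "det (boost z) = 1" unfolding pp ss using q r by simp
    define ca cb where "ca = cnj a" and "cb = cnj b"
    have e1: "a * ca = 1 - p * p" and e2: "b * cb = p * p - s * s"
      unfolding pp ss ra qa ca_def cb_def by simp_all
    have e: "1 / p * (1 / p) - a / p * (ca / p) = 1"
      "ca * b / (s * p) * (a * cb / (s * p)) + p * p / (s * p) * (p * p / (s * p)) - b / (s * p) * (cb / (s * p)) = 1"
      "ca * b / (s * p) * (a / s) + p * p / (s * p) * (b / s) - b / (s * p) * (1 / s) = 0"
      "ca / s * (a * cb / (s * p)) + cb / s * (p * p / (s * p)) - 1 / s * (cb / (s * p)) = 0"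
      "ca / s * (a / s) + cb / s * (b / s) - 1 / s * (1 / s) = -1"
      using ps0 by (simp_all add: field_simps, (use e1 e2 in algebra)+)
    show "cnj (boost z $ 1 $ i) * boost z $ 1 $ j + cnj (boost z $ 2 $ i) * boost z $ 2 $ j -
        cnj (boost z $ 3 $ i) * boost z $ 3 $ j = H21 $ i $ j" for i j
      using exhaust_3[of i] exhaust_3[of j] e
      by (auto simp: B H21_def pp[symmetric] ca_def cb_def)
  qed
  have "(boost z *v lift 0) $ 1 = a / s" "(boost z *v lift 0) $ 2 = b / s" "(boost z *v lift 0) $ 3 = 1 / s"
    by (simp_all add: matrix_lift_nth B)
  then show "act (boost z) 0 = z"
    using ps0 by (simp add: act_def aut_factor_def vec_eq_iff forall_2 a_def b_def)
qed

text \<open>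
  The weight \<open>m\<close> action on functions; holomorphic functions fixed by a group are its automorphic
  forms of weight \<open>m\<close>.
\<close>

definition slash :: "nat \<Rightarrow> complex^3^3 \<Rightarrow> (complex^2 \<Rightarrow> complex) \<Rightarrow> complex^2 \<Rightarrow> complex" where
  "slash m g f w = (if w \<in> unit_ball then f (act g w) / aut_factor g w ^ m else 0)"

lemma aut_factor_has_derivative:
  "(aut_factor \<gamma> has_derivative (\<lambda>v. \<gamma>$3$1 * v$1 + \<gamma>$3$2 * v$2)) (at z)"
  using matrix_lift_has_derivative[of \<gamma> 3 z] by (simp add: aut_factor_def[abs_def])

lemma holomorphic2_slash:
  assumes g: "g \<in> carrier SU21" and f: "holomorphic2_on f unit_ball"
  shows "holomorphic2_on (slash m g f) unit_ball"
  unfolding holomorphic2_on_def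
proof
  fix z assume z: "z \<in> unit_ball"
  then have "act g z \<in> unit_ball" using g by (simp add: act_in_ball)
  then obtain f' where f': "(f has_derivative f') (at (act g z))" "\<And>c v. f' (c *s v) = c * f' v"
    using f unfolding holomorphic2_on_def by metis
  define a where "a = aut_factor g z"
  have a: "a \<noteq> 0" using g z by (simp add: a_def aut_factor_nonzero)
  have d1: "((\<lambda>z. f (act g z)) has_derivative (\<lambda>v. f' (act_jacobian g z *v v))) (at z)"
    by (rule has_derivative_compose[OF act_has_derivative[OF g z] f'(1)])
  have d2: "((\<lambda>z. aut_factor g z ^ m) has_derivative (\<lambda>v. of_nat m * (g$3$1 * v$1 + g$3$2 * v$2) * a ^ (m - 1))) (at z)"
    unfolding a_def by (rule has_derivative_power[OF aut_factor_has_derivative])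
  define F' where "F' v = (f' (act_jacobian g z *v v) * a ^ m -
      f (act g z) * (of_nat m * (g$3$1 * v$1 + g$3$2 * v$2) * a ^ (m - 1))) / (a ^ m * a ^ m)" for v
  have "((\<lambda>z. f (act g z) / aut_factor g z ^ m) has_derivative F') (at z)"
    unfolding F'_def a_def
    by (rule has_derivative_divide'[OF d1 d2[unfolded a_def]]) (use a in \<open>simp add: a_def\<close>)
  then have "(slash m g f has_derivative F') (at z)"
    by (rule has_derivative_transform_within_open[OF _ open_unit_ball z]) (simp add: slash_def)
  moreover have "F' (c *s v) = c * F' v" for c v
    by (simp add: F'_def vector_scalar_commute f'(2) algebra_simps diff_divide_distrib add_divide_distrib)
  ultimately show "\<exists>f'. (slash m g f has_derivative f') (at z) \<and> (\<forall>c v. f' (c *s v) = c * f' v)"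
    by blast
qed

lemma slash_bound:
  assumes g: "g \<in> carrier SU21"
    and bound: "\<And>z. z \<in> unit_ball \<Longrightarrow> (cmod (f z))\<^sup>2 * defect z ^ m \<le> A\<^sup>2"
    and z: "z \<in> unit_ball"
  shows "(cmod (slash m g f z))\<^sup>2 * defect z ^ m \<le> A\<^sup>2"
proof -
  define J where "J = cmod (aut_factor g z)"
  have J: "0 < J" using g z by (simp add: J_def aut_factor_nonzero)
  have "defect z = J\<^sup>2 * defect (act g z)"
    using one_minus_norm_act[OF g z] by (simp add: J_def)
  then have "(cmod (slash m g f z))\<^sup>2 * defect z ^ m
      = (cmod (f (act g z)))\<^sup>2 * defect (act g z) ^ m * (J\<^sup>2 ^ m / (J ^ m)\<^sup>2)"
    using z by (simp add: slash_def norm_divide norm_power power_divide power_mult_distrib J_def)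
  also have "J\<^sup>2 ^ m / (J ^ m)\<^sup>2 = 1" using J by (simp add: power_mult[symmetric] mult.commute)
  finally show ?thesis using bound[of "act g z"] g z by (simp add: act_in_ball)
qed

text \<open>
  The invariant quantity \<open>|f|\<^sup>2 (1 - |z|\<^sup>2)\<^bsup>m\<^esup>\<close> is squared to avoid half-integral exponents; for
  \<open>m \<ge> 6\<close> its boundedness makes \<open>f\<close> integrable against the weight.
\<close>

lemma square_bound_imp_weight_bound:
  assumes "z \<in> unit_ball" "6 \<le> m" "0 \<le> A" "(cmod c)\<^sup>2 * defect z ^ m \<le> A\<^sup>2"
  shows "cmod c * defect z ^ m \<le> A * defect z ^ 3"
proof -
  define q where "q = defect z"
  have q: "0 \<le> q" "q \<le> 1" using assms(1) by (simp_all add: q_def unit_ball_sq less_imp_le)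
  have "(cmod c * q ^ m)\<^sup>2 = ((cmod c)\<^sup>2 * q ^ m) * q ^ m"
    by (simp add: power_mult_distrib power2_eq_square)
  also have "\<dots> \<le> A\<^sup>2 * q ^ 6"
    using assms q by (intro mult_mono power_decreasing) (auto simp: q_def[symmetric])
  also have "\<dots> = (A * q ^ 3)\<^sup>2" by (simp add: power_mult_distrib flip: power_mult)
  finally show ?thesis
    unfolding q_def[symmetric] by (rule power2_le_imp_le) (use q assms(3) in auto)
qed

text \<open>
  Apply the mean value property to \<open>slash m g f\<close>, where \<open>g\<close> moves \<open>0\<close> to \<open>z\<close>, and substitute \<open>u = g w\<close>.
  The kernel appears because \<open>hyp_form_act\<close> with \<open>0\<close> and \<open>w\<close> expresses \<open>aut_factor g w\<close> by \<open>hyp_form z u\<close>.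
\<close>

theorem reproducing_formula:
  assumes f: "holomorphic2_on f unit_ball" and zero: "\<And>z. z \<notin> unit_ball \<Longrightarrow> f z = 0"
    and bound: "\<And>z. z \<in> unit_ball \<Longrightarrow> (cmod (f z))\<^sup>2 * defect z ^ m \<le> A\<^sup>2"
    and m: "6 \<le> m" and A: "0 \<le> A" and z: "z \<in> unit_ball"
  shows "(\<integral>u. of_real (defect u ^ m) * f u / (- hyp_form z u) ^ m \<partial>hyp_volume)
      = f z * of_real (weight_volume m)" (is ?eq)
    and "integrable hyp_volume (\<lambda>u. of_real (defect u ^ m) * f u / (- hyp_form z u) ^ m)" (is ?int)
proof -
  have fm [measurable]: "f \<in> borel_measurable borel" by (rule holomorphic2_measurable[OF f zero])
  define g where "g = boost z"
  have g: "g \<in> carrier SU21" and g0: "act g 0 = z" using boost[OF z] by (simp_all add: g_def)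
  define a where "a = aut_factor g 0"
  have a: "a \<noteq> 0" using g by (simp add: a_def aut_factor_nonzero)
  define K where "K u = of_real (defect u ^ m) * f u / (- hyp_form z u) ^ m" for u
  have "continuous_on UNIV (hyp_form z)"
    unfolding hyp_form_def[abs_def] by (intro continuous_intros)
  then have [measurable]: "hyp_form z \<in> borel_measurable borel" by (rule borel_measurable_continuous_onI)
  have Km [measurable]: "K \<in> borel_measurable borel" unfolding K_def by measurable
  have *: "of_real (defect w ^ m) * slash m g f w = K (act g w) / a ^ m" if w: "w \<in> unit_ball" for w
  proof -
    define j u where "j = aut_factor g w" and "u = act g w"
    have j: "j \<noteq> 0" using g w by (simp add: j_def aut_factor_nonzero)
    have "aut_factor g 0 * cnj j * hyp_form (act g 0) u = hyp_form 0 w"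
      unfolding j_def u_def by (rule hyp_form_act[OF g zero_in_ball w])
    then have e: "a * (- hyp_form z u) * cnj j = 1" by (simp add: a_def g0 algebra_simps)
    then have h: "- hyp_form z u \<noteq> 0" by auto
    have "a * (- hyp_form z u) \<noteq> 0" using a h by simp
    then have cj: "cnj j = 1 / (a * (- hyp_form z u))"
      using e by (metis nonzero_eq_divide_eq mult.commute)
    have "defect w = (cmod j)\<^sup>2 * defect u"
      using one_minus_norm_act[OF g w] by (simp add: j_def u_def)
    then have "of_real (defect w ^ m) = (j * cnj j) ^ m * of_real (defect u ^ m)"
      unfolding complex_norm_square[symmetric] by (metis of_real_mult of_real_power power_mult_distrib)
    then have "of_real (defect w ^ m) * slash m g f w
        = (j * cnj j) ^ m * of_real (defect u ^ m) * (f u / j ^ m)"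
      using w by (simp only: slash_def if_True j_def[symmetric] u_def[symmetric])
    also have "\<dots> = of_real (defect u ^ m) * f u * cnj j ^ m"
      using j by (simp add: power_mult_distrib)
    also have "\<dots> = K u / a ^ m"
    proof -
      define h where "h = - hyp_form z u"
      show ?thesis unfolding cj K_def h_def[symmetric] by (simp add: power_mult_distrib power_divide)
    qed
    finally show ?thesis by (simp add: u_def)
  qed
  note mv = mean_value_ball[OF holomorphic2_slash[OF g f] _ square_bound_imp_weight_bound[OF _ m A slash_bound[OF g bound]]]
  have slash0: "slash m g f 0 = f z / a ^ m" by (simp add: slash_def g0 a_def)
  have AE: "AE w in hyp_volume. of_real (defect w ^ m) * slash m g f w = K (act g w) / a ^ m"
    using AE_hyp_volume_ball by eventually_elim (rule *)
  have sm: "slash m g f \<in> borel_measurable borel"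
    by (rule holomorphic2_measurable[OF holomorphic2_slash[OF g f]]) (simp add: slash_def)
  have "integrable hyp_volume (\<lambda>w. of_real (defect w ^ m) * slash m g f w)"
    by (rule mv(1)) (auto simp: slash_def)
  then have "integrable hyp_volume (\<lambda>w. K (act g w) / a ^ m)"
    by (rule integrable_cong_AE_imp) (use AE in \<open>auto elim!: AE_mp\<close>)
  from integrable_mult_left[OF this, of "a ^ m"] have "integrable hyp_volume (\<lambda>w. K (act g w))"
    using a by simp
  then have "integrable hyp_volume K"
    by (subst distr_hyp_volume[OF g, symmetric]) (simp add: integrable_distr_eq)
  then show ?int by (simp add: K_def[abs_def])
  have "(\<integral>u. K u \<partial>hyp_volume) = (\<integral>w. K (act g w) \<partial>hyp_volume)"
    by (rule integral_hyp_volume_act[OF g Km, symmetric])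
  also have "\<dots> = (\<integral>w. K (act g w) / a ^ m \<partial>hyp_volume) * a ^ m"
    using a by simp
  also have "(\<integral>w. K (act g w) / a ^ m \<partial>hyp_volume) = (\<integral>w. of_real (defect w ^ m) * slash m g f w \<partial>hyp_volume)"
    using sm AE by (intro integral_cong_AE) (auto elim!: AE_mp)
  also have "\<dots> = slash m g f 0 * of_real (weight_volume m)"
    by (rule mv(2)) (auto simp: slash_def)
  finally show ?eq using a by (simp add: slash0 K_def[abs_def])
qed

section \<open>Poincare series\<close>

lemma integrable_count_space_bound:
  fixes u :: "'i \<Rightarrow> 'b::{banach, second_countable_topology}"
  assumes "integrable (count_space I) B" and "\<And>i. i \<in> I \<Longrightarrow> norm (u i) \<le> B i"
  shows "integrable (count_space I) u"
  by (rule Bochner_Integration.integrable_bound[OF assms(1)])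
    (use assms(2) in \<open>auto simp: AE_count_space intro: order_trans[OF _ abs_ge_self]\<close>)

text \<open>
  Termwise differentiation of a series indexed by an arbitrary countable set: the index set is embedded
  into the natural numbers and the series is padded with zeros, since the index set may be finite.
\<close>

lemma has_derivative_sum_count_space:
  fixes t :: "'i \<Rightarrow> 'a::real_normed_vector \<Rightarrow> 'b::{banach, second_countable_topology}"
  assumes I: "countable I" and S: "open S" "convex S" and x: "x \<in> S"
    and der: "\<And>i x. i \<in> I \<Longrightarrow> x \<in> S \<Longrightarrow> (t i has_derivative t' i x) (at x)"
    and bound: "\<And>i x. i \<in> I \<Longrightarrow> x \<in> S \<Longrightarrow> norm (t i x) \<le> B i"
    and bound': "\<And>i x h. i \<in> I \<Longrightarrow> x \<in> S \<Longrightarrow> norm (t' i x h) \<le> B i * norm h"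
    and B: "integrable (count_space I) B"
  shows "((\<lambda>x. \<integral>i. t i x \<partial>count_space I) has_derivative (\<lambda>h. \<integral>i. t' i x h \<partial>count_space I)) (at x)"
proof -
  define J where "J = to_nat_on I ` I"
  define e where "e = inv_into I (to_nat_on I)"
  have e: "bij_betw e J I"
    unfolding e_def J_def by (intro bij_betw_inv_into inj_on_imp_bij_betw inj_on_to_nat_on I)
  have eI: "e n \<in> I" if "n \<in> J" for n using e that by (auto simp: bij_betw_def)
  have to_series: "(\<integral>i. u i \<partial>count_space I) = (\<Sum>n. if n \<in> J then u (e n) else 0)"
      "summable (\<lambda>n. norm (if n \<in> J then u (e n) else 0))"
    if u: "integrable (count_space I) u" for u :: "'i \<Rightarrow> 'c::{banach, second_countable_topology}"
  proof -
    have s: "Infinite_Set_Sum.abs_summable_on (\<lambda>n. u (e n)) J"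
      using u abs_summable_on_reindex_bij_betw[OF e, of u] by (simp add: abs_summable_on_def)
    have "(\<integral>i. u i \<partial>count_space I) = infsetsum u I" by (simp add: infsetsum_def)
    also have "\<dots> = infsetsum (\<lambda>n. u (e n)) J" by (rule infsetsum_reindex_bij_betw[OF e, symmetric])
    also have "\<dots> = (\<Sum>n. if n \<in> J then u (e n) else 0)" by (rule infsetsum_nat[OF s])
    finally show "(\<integral>i. u i \<partial>count_space I) = (\<Sum>n. if n \<in> J then u (e n) else 0)" .
    have "(\<lambda>n. norm (if n \<in> J then u (e n) else 0)) = (\<lambda>n. if n \<in> J then norm (u (e n)) else 0)" by auto
    then show "summable (\<lambda>n. norm (if n \<in> J then u (e n) else 0))"
      using s by (simp add: abs_summable_on_nat_iff)
  qed
  define f where "f n x = (if n \<in> J then t (e n) x else 0)" for n x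
  define f' where "f' n x h = (if n \<in> J then t' (e n) x h else 0)" for n x h
  define b where "b n = (if n \<in> J then B (e n) else 0)" for n
  have int: "integrable (count_space I) (\<lambda>i. t i x)" if "x \<in> S" for x
    by (rule integrable_count_space_bound[OF B]) (use bound that in auto)
  have int': "integrable (count_space I) (\<lambda>i. t' i x h)" if "x \<in> S" for x h
    by (rule integrable_count_space_bound[OF integrable_mult_left[OF B, of "norm h"]]) (use bound' that in auto)
  define g' where "g' x h = (\<Sum>n. f' n x h)" for x h
  have f'b: "norm (f' n x h) \<le> b n * norm h" if "x \<in> S" for n x h
    using bound'[OF eI that] by (auto simp: f'_def b_def)
  have sb: "summable b"
    using summable_norm_cancel[OF to_series(2)[OF B]] by (simp add: b_def[abs_def])
  have tail: "(\<lambda>N. \<Sum>n. b (n + N)) \<longlonglongrightarrow> 0" by (rule suminf_exist_split2[OF sb])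
  have unif: "\<forall>\<^sub>F N in sequentially. \<forall>x\<in>S. \<forall>h. norm ((\<Sum>i<N. f' i x h) - g' x h) \<le> \<epsilon> * norm h" if "\<epsilon> > 0" for \<epsilon>
  proof -
    have "\<forall>\<^sub>F N in sequentially. (\<Sum>n. b (n + N)) < \<epsilon>"
      using order_tendstoD(2)[OF tail that] .
    then show ?thesis
    proof eventually_elim
      case (elim N)
      show ?case
      proof (intro ballI allI)
        fix x h :: "'a" assume x: "x \<in> S"
        have sm: "summable (\<lambda>n. b (n + N) * norm h)"
          by (intro summable_mult2 summable_ignore_initial_segment sb)
        have "summable (\<lambda>n. f' n x h)"
          by (rule summable_comparison_test'[OF summable_mult2[OF sb, of "norm h"]]) (rule f'b[OF x])
        then have "g' x h = (\<Sum>n. f' (n + N) x h) + (\<Sum>i<N. f' i x h)"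
          unfolding g'_def by (rule suminf_split_initial_segment)
        then have "norm ((\<Sum>i<N. f' i x h) - g' x h) = norm (\<Sum>n. f' (n + N) x h)"
          by (simp add: norm_minus_commute)
        also have "\<dots> \<le> (\<Sum>n. b (n + N) * norm h)"
          by (rule norm_suminf_le[OF f'b[OF x] sm])
        also have "\<dots> = (\<Sum>n. b (n + N)) * norm h"
          by (rule suminf_mult2[symmetric]) (intro summable_ignore_initial_segment sb)
        also have "\<dots> \<le> \<epsilon> * norm h" using elim by (intro mult_right_mono) auto
        finally show "norm ((\<Sum>i<N. f' i x h) - g' x h) \<le> \<epsilon> * norm h" .
      qed
    qed
  qed
  have sums: "(\<lambda>n. f n y) sums (\<integral>i. t i y \<partial>count_space I)" if "y \<in> S" for y
    unfolding to_series(1)[OF int[OF that]] f_def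
    by (rule summable_sums[OF summable_norm_cancel[OF to_series(2)[OF int[OF that]]]])
  have "\<exists>g. \<forall>x\<in>S. (\<lambda>n. f n x) sums g x \<and> (g has_derivative g' x) (at x within S)"
  proof (rule has_derivative_series[where f = f and f' = f' and g' = g', OF S(2) _ unif x sums[OF x]])
    fix n y assume y: "y \<in> S"
    show "(f n has_derivative f' n y) (at y within S)"
      using der[OF eI y] by (cases "n \<in> J") (auto simp: f_def[abs_def] f'_def[abs_def] intro: has_derivative_at_withinI)
  qed
  then obtain g where g: "\<And>x. x \<in> S \<Longrightarrow> (\<lambda>n. f n x) sums g x"
    "\<And>x. x \<in> S \<Longrightarrow> (g has_derivative g' x) (at x within S)" by blast
  have "(g has_derivative g' x) (at x)"
    using g(2)[OF x] at_within_open[OF x S(1)] by simp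
  moreover have "g y = (\<integral>i. t i y \<partial>count_space I)" if "y \<in> S" for y
    using g(1)[OF that] sums[OF that] by (rule sums_unique2)
  ultimately have "((\<lambda>x. \<integral>i. t i x \<partial>count_space I) has_derivative g' x) (at x)"
    by (rule has_derivative_transform_within_open[OF _ S(1) x])
  moreover have "g' x = (\<lambda>h. \<integral>i. t' i x h \<partial>count_space I)"
    unfolding g'_def f'_def to_series(1)[OF int'[OF x]] ..
  ultimately show ?thesis by simp
qed

text \<open>
  As a function of \<open>w\<close> this is a negative power of an affine function, so its derivative is explicit and
  the convergence of the differentiated series needs no Cauchy estimates.
\<close>

definition poincare_term :: "nat \<Rightarrow> complex^2 \<Rightarrow> complex^3^3 \<Rightarrow> complex^2 \<Rightarrow> complex" where
  "poincare_term m z \<gamma> w = 1 / (- hform (\<gamma> *v lift w) (lift z)) ^ m"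

definition poincare_term_deriv :: "nat \<Rightarrow> complex^2 \<Rightarrow> complex^3^3 \<Rightarrow> complex^2 \<Rightarrow> complex^2 \<Rightarrow> complex" where
  "poincare_term_deriv m z \<gamma> w v = of_nat m / (- hform (\<gamma> *v lift w) (lift z)) ^ (m + 1) *
     ((\<gamma>$1$1 * v$1 + \<gamma>$1$2 * v$2) * cnj (z$1) + (\<gamma>$2$1 * v$1 + \<gamma>$2$2 * v$2) * cnj (z$2)
      - (\<gamma>$3$1 * v$1 + \<gamma>$3$2 * v$2))"

lemma hform_act: "\<gamma> \<in> carrier SU21 \<Longrightarrow> w \<in> unit_ball \<Longrightarrow>
   hform (\<gamma> *v lift w) (lift z) = aut_factor \<gamma> w * hyp_form (act \<gamma> w) z"
  using hform_scale[of "aut_factor \<gamma> w" "lift (act \<gamma> w)" 1 "lift z"] by (simp add: lift_act hform_lift)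

lemma hform_lower:
  assumes "\<gamma> \<in> carrier SU21" "z \<in> unit_ball" "w \<in> unit_ball"
  shows "cmod (\<gamma>$3$3) * ((1 - norm z) * (1 - norm w)) \<le> cmod (hform (\<gamma> *v lift w) (lift z))"
  using hyp_form_act_lower[OF assms] by (simp add: hform_act assms norm_mult mult.assoc)

lemma hform_nonzero:
  assumes "\<gamma> \<in> carrier SU21" "z \<in> unit_ball" "w \<in> unit_ball"
  shows "hform (\<gamma> *v lift w) (lift z) \<noteq> 0"
proof -
  have "0 < cmod (\<gamma>$3$3) * ((1 - norm z) * (1 - norm w))"
    using SU21_33_ge_1[OF assms(1)] assms(2,3) by (intro mult_pos_pos) (auto simp: unit_ball_def)
  then show ?thesis using hform_lower[OF assms] by auto
qed

lemma DERIV_inverse_power: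
  fixes x :: complex
  assumes "x \<noteq> 0"
  shows "((\<lambda>x. 1 / x ^ m) has_field_derivative (- (of_nat m / x ^ (m + 1)))) (at x)"
proof (cases m)
  case (Suc n)
  have "((\<lambda>x. 1 / x ^ m) has_field_derivative (- (of_nat m * x ^ (m - 1) / (x ^ m * x ^ m)))) (at x)"
    using assms by (auto intro!: derivative_eq_intros)
  moreover have "of_nat m * x ^ (m - 1) / (x ^ m * x ^ m) = of_nat m / x ^ (m + 1)"
    using assms by (simp add: Suc field_simps)
  ultimately show ?thesis by simp
qed simp

lemma poincare_term_has_derivative:
  assumes "\<gamma> \<in> carrier SU21" "z \<in> unit_ball" "w \<in> unit_ball"
  shows "(poincare_term m z \<gamma> has_derivative poincare_term_deriv m z \<gamma> w) (at w)"
proof -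
  define L where "L v = - ((\<gamma>$1$1 * v$1 + \<gamma>$1$2 * v$2) * cnj (z$1) + (\<gamma>$2$1 * v$1 + \<gamma>$2$2 * v$2) * cnj (z$2)
      - (\<gamma>$3$1 * v$1 + \<gamma>$3$2 * v$2))" for v :: "complex^2"
  have "((\<lambda>w. - hform (\<gamma> *v lift w) (lift z)) has_derivative L) (at w)"
    unfolding hform_def L_def lift_nth complex_cnj_one mult_1_right
    by (intro has_derivative_minus has_derivative_add has_derivative_diff has_derivative_mult_left
        matrix_lift_has_derivative)
  moreover have "- hform (\<gamma> *v lift w) (lift z) \<noteq> 0" using hform_nonzero[OF assms] by simp
  note DERIV_inverse_power[OF this, of m, unfolded has_field_derivative_def]
  ultimately have "((\<lambda>w. 1 / (- hform (\<gamma> *v lift w) (lift z)) ^ m) has_derivative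
      (\<lambda>v. - (of_nat m / (- hform (\<gamma> *v lift w) (lift z)) ^ (m + 1)) * L v)) (at w)"
    by (rule has_derivative_compose)
  moreover have "(\<lambda>v. - (of_nat m / (- hform (\<gamma> *v lift w) (lift z)) ^ (m + 1)) * L v)
      = poincare_term_deriv m z \<gamma> w"
    by (rule ext) (simp only: poincare_term_deriv_def L_def minus_mult_minus)
  ultimately show ?thesis by (simp add: poincare_term_def[abs_def])
qed

lemma poincare_term_deriv_scale: "poincare_term_deriv m z \<gamma> w (c *s v) = c * poincare_term_deriv m z \<gamma> w v"
  by (simp add: poincare_term_deriv_def algebra_simps)

text \<open>
  On a smaller ball the affine function is at least \<open>|\<gamma>\<^sub>3\<^sub>3| \<kappa>\<close>. Since \<open>|\<gamma>\<^sub>3\<^sub>3| \<ge> 1\<close>, the exponent \<open>m\<close> may be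
  lowered to the exponent \<open>6\<close> of \<open>summable_lattice\<close>.
\<close>

lemma poincare_term_bounds:
  assumes \<gamma>: "\<gamma> \<in> carrier SU21" and z: "z \<in> unit_ball" and w: "norm w \<le> \<rho>" and \<rho>: "\<rho> < 1" and m: "6 \<le> m"
  defines "\<kappa> \<equiv> (1 - norm z) * (1 - \<rho>)"
  shows "cmod (poincare_term m z \<gamma> w) \<le> 1 / \<kappa> ^ m * (1 / cmod (\<gamma>$3$3) ^ 6)"
    and "cmod (poincare_term_deriv m z \<gamma> w v) \<le> 12 * real m / \<kappa> ^ (m + 1) * (1 / cmod (\<gamma>$3$3) ^ 6) * norm v"
proof -
  define d where "d = cmod (\<gamma>$3$3)"
  define l where "l = cmod (- hform (\<gamma> *v lift w) (lift z))"
  have d1: "1 \<le> d" using SU21_33_ge_1[OF \<gamma>] by (simp add: d_def)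
  have zz: "norm z < 1" using z by (simp add: unit_ball_def)
  have \<kappa>: "0 < \<kappa>" using zz \<rho> by (simp add: \<kappa>_def)
  have wB: "w \<in> unit_ball" using w \<rho> by (simp add: unit_ball_def)
  have "d * \<kappa> \<le> d * ((1 - norm z) * (1 - norm w))"
    unfolding \<kappa>_def using d1 zz w by (intro mult_left_mono) auto
  also have "\<dots> \<le> l" using hform_lower[OF \<gamma> z wB] by (simp add: l_def d_def)
  finally have l: "d * \<kappa> \<le> l" .
  have dk: "0 < d * \<kappa>" using d1 \<kappa> by simp
  have pw: "1 / l ^ n \<le> 1 / (d ^ n * \<kappa> ^ n)" for n
    unfolding power_mult_distrib[symmetric] using l dk less_le_trans[OF dk l] d1 \<kappa>
    by (intro divide_left_mono power_mono mult_pos_pos zero_less_power) auto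
  have dm: "d ^ 6 \<le> d ^ m" using d1 m by (rule power_increasing[rotated])
  have dpos: "0 < d" using d1 by simp
  have "cmod (poincare_term m z \<gamma> w) = 1 / l ^ m"
    by (simp add: poincare_term_def l_def norm_divide norm_power)
  also have "\<dots> \<le> 1 / (d ^ m * \<kappa> ^ m)" by (rule pw)
  also have "\<dots> \<le> 1 / (d ^ 6 * \<kappa> ^ m)"
    using dm dpos \<kappa> by (intro frac_le mult_right_mono) auto
  finally show "cmod (poincare_term m z \<gamma> w) \<le> 1 / \<kappa> ^ m * (1 / cmod (\<gamma>$3$3) ^ 6)"
    by (simp add: d_def mult.commute)
  have row: "cmod (\<gamma>$i$1 * v$1 + \<gamma>$i$2 * v$2) \<le> 4 * d * norm v" for i
  proof -
    have "cmod (\<gamma>$i$j * v$k) \<le> 2 * d * norm v" for j k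
      unfolding norm_mult d_def using SU21_entry_le[OF \<gamma>] Finite_Cartesian_Product.norm_nth_le
      by (intro mult_mono) auto
    from add_mono[OF this[of 1 1] this[of 2 2]] show ?thesis
      using norm_triangle_ineq[of "\<gamma>$i$1 * v$1" "\<gamma>$i$2 * v$2"] by linarith
  qed
  have zi: "cmod (z $ i) \<le> 1" for i
    using Finite_Cartesian_Product.norm_nth_le[of z i] zz by linarith
  define T where "T i = \<gamma>$i$1 * v$1 + \<gamma>$i$2 * v$2" for i
  have Tz: "cmod (T i * cnj (z $ k)) \<le> 4 * d * norm v" for i k
  proof -
    have "cmod (T i * cnj (z $ k)) \<le> cmod (T i) * 1"
      unfolding norm_mult complex_mod_cnj using zi by (intro mult_left_mono) auto
    then show ?thesis using row[of i] by (simp add: T_def)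
  qed
  have "cmod (T 1 * cnj (z $ 1) + T 2 * cnj (z $ 2) - T 3) \<le> cmod (T 1 * cnj (z $ 1)) + cmod (T 2 * cnj (z $ 2)) + cmod (T 3)"
    by (meson norm_triangle_ineq norm_triangle_ineq4 order_trans add_right_mono)
  also have "\<dots> \<le> 12 * d * norm v"
    using Tz[of 1 1] Tz[of 2 2] row[of 3] unfolding T_def[symmetric] by linarith
  finally have lin: "cmod (T 1 * cnj (z $ 1) + T 2 * cnj (z $ 2) - T 3) \<le> 12 * d * norm v" .
  have "cmod (poincare_term_deriv m z \<gamma> w v) = real m * (1 / l ^ (m + 1)) * cmod (T 1 * cnj (z $ 1) + T 2 * cnj (z $ 2) - T 3)"
    unfolding poincare_term_deriv_def T_def[symmetric] norm_mult norm_divide norm_power l_def[symmetric] by simp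
  also have "\<dots> \<le> real m * (1 / (d ^ (m + 1) * \<kappa> ^ (m + 1))) * (12 * d * norm v)"
    using d1 \<kappa> by (intro mult_mono mult_left_mono pw lin) (auto simp: l_def)
  also have "\<dots> = 12 * real m / \<kappa> ^ (m + 1) * (1 / d ^ m) * norm v"
    using d1 \<kappa> by (simp add: field_simps)
  also have "\<dots> \<le> 12 * real m / \<kappa> ^ (m + 1) * (1 / d ^ 6) * norm v"
    using dm dpos \<kappa> by (intro mult_right_mono mult_left_mono frac_le) auto
  finally show "cmod (poincare_term_deriv m z \<gamma> w v) \<le> 12 * real m / \<kappa> ^ (m + 1) * (1 / cmod (\<gamma>$3$3) ^ 6) * norm v"
    by (simp add: d_def)
qed

context ball_lattice
begin

abbreviation forms :: "nat \<Rightarrow> (complex^2 \<Rightarrow> complex) set" where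
  "forms k \<equiv> aut_forms (3 * k) \<Gamma>"

abbreviation ip :: "nat \<Rightarrow> (complex^2 \<Rightarrow> complex) \<Rightarrow> (complex^2 \<Rightarrow> complex) \<Rightarrow> complex" where
  "ip k \<equiv> form_inner \<Gamma> k"

definition poincare :: "nat \<Rightarrow> complex^2 \<Rightarrow> complex^2 \<Rightarrow> complex" where
  "poincare m z w = (if w \<in> unit_ball then \<integral>\<gamma>. poincare_term m z \<gamma> w \<partial>counting else 0)"

text \<open>
  Automorphy holds because translating the argument by \<open>\<delta>\<close> permutes the summands, up to the common factor
  \<open>aut_factor \<delta> w ^ m\<close>.
\<close>

lemma poincare_aut_form:
  assumes z: "z \<in> unit_ball" and m: "6 \<le> m"
  shows "poincare m z \<in> aut_forms m \<Gamma>"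
proof -
  have "holomorphic2_on (poincare m z) unit_ball"
    unfolding holomorphic2_on_def
  proof
    fix w assume w: "w \<in> unit_ball"
    obtain \<rho> where \<rho>: "norm w < \<rho>" "\<rho> < 1" using w dense by (auto simp: unit_ball_def)
    define \<kappa> where "\<kappa> = (1 - norm z) * (1 - \<rho>)"
    have \<kappa>: "0 < \<kappa>" using z \<rho> by (simp add: \<kappa>_def unit_ball_def)
    define C where "C = 1 / \<kappa> ^ m + 12 * real m / \<kappa> ^ (m + 1)"
    have C: "1 / \<kappa> ^ m \<le> C" "12 * real m / \<kappa> ^ (m + 1) \<le> C" using \<kappa> by (simp_all add: C_def)
    define F' where "F' v = (\<integral>\<gamma>. poincare_term_deriv m z \<gamma> w v \<partial>counting)" for v
    have "((\<lambda>w. \<integral>\<gamma>. poincare_term m z \<gamma> w \<partial>counting) has_derivative F') (at w)"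
      unfolding F'_def
    proof (rule has_derivative_sum_count_space[OF countable_group open_ball convex_ball])
      show "w \<in> ball 0 \<rho>" using \<rho> by simp
      show "integrable counting (\<lambda>\<gamma>. C * (1 / cmod (\<gamma>$3$3) ^ 6))"
        by (intro integrable_mult_right summable_lattice)
      fix \<gamma> and u :: "complex^2" assume \<gamma>: "\<gamma> \<in> \<Gamma>" and u: "u \<in> ball 0 \<rho>"
      then have uB: "u \<in> unit_ball" "norm u \<le> \<rho>" using \<rho> by (auto simp: unit_ball_def)
      note b = poincare_term_bounds[OF in_SU21[OF \<gamma>] z uB(2) \<rho>(2) m, folded \<kappa>_def]
      show "(poincare_term m z \<gamma> has_derivative poincare_term_deriv m z \<gamma> u) (at u)"
        using poincare_term_has_derivative \<gamma> z uB by simp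
      show "cmod (poincare_term m z \<gamma> u) \<le> C * (1 / cmod (\<gamma>$3$3) ^ 6)"
        by (rule order_trans[OF b(1)], rule mult_right_mono[OF C(1)]) simp
      show "cmod (poincare_term_deriv m z \<gamma> u h) \<le> C * (1 / cmod (\<gamma>$3$3) ^ 6) * norm h" for h
        by (rule order_trans[OF b(2)], intro mult_right_mono C(2)) auto
    qed
    then have "(poincare m z has_derivative F') (at w)"
      by (rule has_derivative_transform_within_open[OF _ open_unit_ball w]) (simp add: poincare_def)
    moreover have "F' (c *s v) = c * F' v" for c v
      by (simp add: F'_def poincare_term_deriv_scale)
    ultimately show "\<exists>f'. (poincare m z has_derivative f') (at w) \<and> (\<forall>c v. f' (c *s v) = c * f' v)"
      by blast
  qed
  moreover have "poincare m z (act \<delta> w) = aut_factor \<delta> w ^ m * poincare m z w"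
    if \<delta>: "\<delta> \<in> \<Gamma>" and w: "w \<in> unit_ball" for \<delta> w
  proof -
    define j where "j = aut_factor \<delta> w"
    have j: "j \<noteq> 0" using \<delta> w by (simp add: j_def aut_factor_nonzero)
    have t: "poincare_term m z \<gamma> (act \<delta> w) = j ^ m * poincare_term m z (\<gamma> ** \<delta>) w" if "\<gamma> \<in> \<Gamma>" for \<gamma>
    proof -
      have "(\<gamma> ** \<delta>) *v lift w = j *s (\<gamma> *v lift (act \<delta> w))"
        using \<delta> w by (simp add: matrix_vector_mul_assoc[symmetric] lift_act vector_scalar_commute j_def)
      then have h: "- hform ((\<gamma> ** \<delta>) *v lift w) (lift z) = j * (- hform (\<gamma> *v lift (act \<delta> w)) (lift z))"
        using hform_scale[of j _ 1 "lift z"] by simp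
      show ?thesis unfolding poincare_term_def h power_mult_distrib using j by simp
    qed
    have "(\<integral>\<gamma>. poincare_term m z \<gamma> (act \<delta> w) \<partial>counting)
        = (\<integral>\<gamma>. j ^ m * poincare_term m z (\<gamma> ** \<delta>) w \<partial>counting)"
      by (intro Bochner_Integration.integral_cong) (auto simp: t)
    also have "\<dots> = j ^ m * (\<integral>\<gamma>. poincare_term m z (\<gamma> ** \<delta>) w \<partial>counting)" by simp
    also have "(\<integral>\<gamma>. poincare_term m z (\<gamma> ** \<delta>) w \<partial>counting) = (\<integral>\<gamma>. poincare_term m z \<gamma> w \<partial>counting)"
      by (rule integral_bij_count_space[OF bij_mult_right[OF \<delta>]])
    finally show ?thesis using \<delta> w by (simp add: poincare_def act_in_ball j_def)
  qed
  ultimately show ?thesis by (auto simp: aut_forms_def poincare_def)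
qed

text \<open>
  The left-hand side is \<open>\<Gamma>\<close>-invariant, so it suffices to bound it on a compact ball that meets every
  orbit.
\<close>

lemma aut_form_bounded:
  assumes f: "f \<in> aut_forms m \<Gamma>"
  shows "\<exists>A\<ge>0. \<forall>z\<in>unit_ball. (cmod (f z))\<^sup>2 * defect z ^ m \<le> A\<^sup>2"
proof -
  obtain r where r: "r < 1" "0 < r" "\<And>z. z \<in> unit_ball \<Longrightarrow> \<exists>\<gamma>\<in>\<Gamma>. norm (act \<gamma> z) < r"
    using orbits_meet_smaller_ball by blast
  have hol: "holomorphic2_on f unit_ball"
    and aut: "\<And>\<gamma> z. \<gamma> \<in> \<Gamma> \<Longrightarrow> z \<in> unit_ball \<Longrightarrow> f (act \<gamma> z) = aut_factor \<gamma> z ^ m * f z"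
    using f by (auto simp: aut_forms_def)
  have "continuous_on (cball 0 r) f"
    using holomorphic2_continuous_on[OF hol] by (rule continuous_on_subset) (use r in \<open>auto simp: unit_ball_def\<close>)
  then have "bounded (f ` cball 0 r)" by (intro compact_imp_bounded compact_continuous_image) auto
  then obtain A where A: "\<And>z. norm z \<le> r \<Longrightarrow> cmod (f z) \<le> A"
    unfolding bounded_iff by (metis imageI mem_cball_0)
  have A0: "0 \<le> A" using A[of 0] r norm_ge_zero order_trans by (metis norm_zero less_imp_le)
  have "(cmod (f z))\<^sup>2 * defect z ^ m \<le> A\<^sup>2" if z: "z \<in> unit_ball" for z
  proof -
    obtain \<gamma> where \<gamma>: "\<gamma> \<in> \<Gamma>" "norm (act \<gamma> z) < r" using r(3)[OF z] by blast
    define J where "J = cmod (aut_factor \<gamma> z)"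
    define u where "u = act \<gamma> z"
    have "defect z = J\<^sup>2 * defect u"
      using one_minus_norm_act[of \<gamma> z] \<gamma> z by (simp add: J_def u_def)
    then have "(cmod (f z))\<^sup>2 * defect z ^ m = (J ^ m * cmod (f z))\<^sup>2 * defect u ^ m"
      by (simp add: power_mult_distrib mult_ac flip: power_mult)
    also have "J ^ m * cmod (f z) = cmod (f u)"
      unfolding u_def by (subst aut) (use \<gamma> z in \<open>simp_all add: J_def norm_mult norm_power\<close>)
    also have "(cmod (f u))\<^sup>2 * defect u ^ m \<le> A\<^sup>2 * 1"
    proof (intro mult_mono power_mono)
      have u1: "(norm u)\<^sup>2 \<le> 1" using \<gamma> r by (intro power_le_one) (auto simp: u_def)
      show "defect u ^ m \<le> 1" using u1 by (intro power_le_one) auto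
      show "0 \<le> defect u ^ m" using u1 by (intro zero_le_power) auto
      show "cmod (f u) \<le> A" using A \<gamma> by (simp add: u_def)
    qed auto
    finally show ?thesis by simp
  qed
  then show ?thesis using A0 by blast
qed

lemma form_inner_dom_volume:
  assumes f: "f \<in> borel_measurable borel" and g: "g \<in> borel_measurable borel"
  shows "ip k f g = (\<integral>z. of_real (defect z ^ (3 * k)) * f z * cnj (g z) \<partial>dom_volume)"
proof -
  have meas: "(\<lambda>z. of_real (defect z ^ (3 * k)) * f z * cnj (g z)) \<in> borel_measurable hyp_volume"
  proof -
    have "cnj \<in> borel_measurable borel" by (intro borel_measurable_continuous_onI continuous_intros)
    from measurable_compose[OF g this] show ?thesis using f by measurable
  qed
  have eq: "dom_volume = density hyp_volume (\<lambda>z. ennreal (indicator D z))"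
    by (simp add: dom_volume_def ennreal_indicator)
  show ?thesis
    unfolding form_inner_def set_lebesgue_integral_def eq
    by (rule integral_density[OF meas, symmetric]) auto
qed

lemma aut_form_measurable: "f \<in> aut_forms m \<Gamma> \<Longrightarrow> f \<in> borel_measurable borel"
  by (rule holomorphic2_measurable) (auto simp: aut_forms_def)

text \<open>
  Unfolding the reproducing formula of the ball: each translate of its kernel becomes the conjugate of
  one summand of the Poincare series.
\<close>

theorem reproducing_kernel:
  assumes f: "f \<in> forms k" and k: "2 \<le> k" and z: "z \<in> unit_ball"
  shows "ip k f (poincare (3 * k) z) = f z * of_real (weight_volume (3 * k))"
proof -
  define m where "m = 3 * k"
  have m: "6 \<le> m" using k by (simp add: m_def)
  have hol: "holomorphic2_on f unit_ball" and zero: "\<And>z. z \<notin> unit_ball \<Longrightarrow> f z = 0"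
    and aut: "\<And>\<gamma> z. \<gamma> \<in> \<Gamma> \<Longrightarrow> z \<in> unit_ball \<Longrightarrow> f (act \<gamma> z) = aut_factor \<gamma> z ^ m * f z"
    using f by (auto simp: aut_forms_def m_def)
  obtain A where A: "0 \<le> A" "\<And>z. z \<in> unit_ball \<Longrightarrow> (cmod (f z))\<^sup>2 * defect z ^ m \<le> A\<^sup>2"
    using aut_form_bounded[OF f] unfolding m_def by blast
  note rep = reproducing_formula[OF hol zero A(2) m A(1) z]
  define K where "K u = of_real (defect u ^ m) * f u / (- hyp_form z u) ^ m" for u
  have K: "K (act \<gamma> u) = of_real (defect u ^ m) * f u * cnj (poincare_term m z \<gamma> u)"
    if \<gamma>: "\<gamma> \<in> \<Gamma>" and u: "u \<in> unit_ball" for \<gamma> u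
  proof -
    define j v where "j = aut_factor \<gamma> u" and "v = act \<gamma> u"
    have j: "j \<noteq> 0" using \<gamma> u by (simp add: j_def aut_factor_nonzero)
    have "defect u = (cmod j)\<^sup>2 * defect v"
      using one_minus_norm_act[of \<gamma> u] \<gamma> u by (simp add: j_def v_def)
    then have w: "of_real (defect u ^ m) = (j * cnj j) ^ m * of_real (defect v ^ m)"
      unfolding complex_norm_square[symmetric] by (metis of_real_mult of_real_power power_mult_distrib)
    have fv: "f v = j ^ m * f u" using aut[OF \<gamma> u] by (simp add: j_def v_def)
    have "cnj (poincare_term m z \<gamma> u) = 1 / (cnj j * (- hyp_form z v)) ^ m"
      unfolding poincare_term_def hform_act[OF in_SU21[OF \<gamma>] u] by (simp add: j_def v_def cnj_hyp_form)
    also have "\<dots> = 1 / (cnj j ^ m * (- hyp_form z v) ^ m)" by (simp only: power_mult_distrib)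
    finally have "of_real (defect u ^ m) * f u * cnj (poincare_term m z \<gamma> u)
        = (j ^ m * cnj j ^ m * of_real (defect v ^ m)) * f u * (1 / (cnj j ^ m * (- hyp_form z v) ^ m))"
      unfolding w by (simp only: power_mult_distrib)
    also have "\<dots> = of_real (defect v ^ m) * (j ^ m * f u) / (- hyp_form z v) ^ m"
      using j by simp
    finally show ?thesis by (simp only: K_def fv v_def[symmetric])
  qed
  have inner: "(\<integral>\<gamma>. K (act \<gamma> u) \<partial>counting) = of_real (defect u ^ m) * f u * cnj (poincare m z u)"
    if u: "u \<in> unit_ball" for u
  proof -
    have "(\<integral>\<gamma>. K (act \<gamma> u) \<partial>counting)
       = (\<integral>\<gamma>. of_real (defect u ^ m) * f u * cnj (poincare_term m z \<gamma> u) \<partial>counting)"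
      by (intro Bochner_Integration.integral_cong) (auto simp: K u)
    also have "\<dots> = of_real (defect u ^ m) * f u * cnj (\<integral>\<gamma>. poincare_term m z \<gamma> u \<partial>counting)"
      by simp
    finally show ?thesis using u by (simp add: poincare_def)
  qed
  have Kint: "integrable hyp_volume K" using rep(2) by (simp add: K_def[abs_def])
  have pm: "poincare m z \<in> borel_measurable borel"
    by (rule aut_form_measurable[OF poincare_aut_form[OF z m]])
  have cm: "cnj \<in> borel_measurable borel" by (intro borel_measurable_continuous_onI continuous_intros)
  have [measurable]: "f \<in> borel_measurable borel" "(\<lambda>u. cnj (poincare m z u)) \<in> borel_measurable borel"
    using aut_form_measurable[OF f] measurable_compose[OF pm cm] by auto
  have "f z * of_real (weight_volume m) = (\<integral>u. K u \<partial>hyp_volume)"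
    using rep(1) by (simp add: K_def[abs_def])
  also have "\<dots> = (\<integral>u. (\<integral>\<gamma>. K (act \<gamma> u) \<partial>counting) \<partial>dom_volume)"
    by (rule integral_unfolding(1)[OF Kint])
  also have "\<dots> = (\<integral>u. of_real (defect u ^ m) * f u * cnj (poincare m z u) \<partial>dom_volume)"
  proof (rule integral_cong_AE)
    show "(\<lambda>u. \<integral>\<gamma>. K (act \<gamma> u) \<partial>counting) \<in> borel_measurable dom_volume"
      using integral_unfolding(2)[OF Kint] by (rule borel_measurable_integrable)
    show "(\<lambda>u. of_real (defect u ^ m) * f u * cnj (poincare m z u)) \<in> borel_measurable dom_volume"
      by measurable
    show "AE u in dom_volume. (\<integral>\<gamma>. K (act \<gamma> u) \<partial>counting) = of_real (defect u ^ m) * f u * cnj (poincare m z u)"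
      using AE_dom_volume by eventually_elim (use fund_dom_subset inner in blast)
  qed
  also have "\<dots> = ip k f (poincare m z)"
    unfolding m_def by (rule form_inner_dom_volume[OF aut_form_measurable[OF f] pm[unfolded m_def], symmetric])
  finally show ?thesis by (simp add: m_def)
qed

end

section \<open>The uniform bound on sums over the lattice\<close>

definition cosh_half :: "complex^2 \<Rightarrow> complex^2 \<Rightarrow> real" where
  "cosh_half z w = cosh (hyp_dist z w / 2)"

lemma cosh_half_eq:
  assumes "z \<in> unit_ball" "w \<in> unit_ball"
  shows "cosh_half z w = cmod (hyp_form z w) / (sqrt (defect z) * sqrt (defect w))"
proof -
  define a b where "a = defect z" and "b = defect w"
  have ab: "0 < a" "0 < b" using assms by (simp_all add: a_def b_def unit_ball_sq)
  have "hyp_form z z * hyp_form w w = of_real (a * b)"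
    unfolding hyp_form_self a_def b_def of_real_mult[symmetric] by (simp only: of_real_eq_iff) (simp add: algebra_simps)
  moreover have "hyp_form z w * hyp_form w z = of_real ((cmod (hyp_form z w))\<^sup>2)"
    unfolding complex_norm_square by (simp add: cnj_hyp_form)
  ultimately have "complex_of_real ((cosh_half z w)\<^sup>2) = of_real ((cmod (hyp_form z w))\<^sup>2 / (a * b))"
    unfolding cosh_half_def cosh_hyp_dist(2)[OF assms] by (simp only: of_real_divide)
  then have "(cosh_half z w)\<^sup>2 = (cmod (hyp_form z w))\<^sup>2 / (a * b)" by (simp only: of_real_eq_iff)
  also have "\<dots> = (cmod (hyp_form z w) / (sqrt a * sqrt b))\<^sup>2"
    using ab by (simp add: power_divide power_mult_distrib)
  finally show ?thesis
    unfolding a_def[symmetric] b_def[symmetric]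
    using ab by (intro power2_eq_imp_eq[of "cosh_half z w"]) (auto simp: cosh_half_def)
qed

lemma cosh_half_ge_1: "1 \<le> cosh_half z w"
  by (simp add: cosh_half_def cosh_real_ge_1)

lemma sqrt_weight_act:
  assumes "\<gamma> \<in> carrier SU21" "z \<in> unit_ball"
  shows "cmod (aut_factor \<gamma> z) * sqrt (defect (act \<gamma> z)) = sqrt (defect z)"
  unfolding one_minus_norm_act[OF assms, symmetric] by (simp add: real_sqrt_mult)

lemma cosh_half_act:
  assumes "\<gamma> \<in> carrier SU21" "z \<in> unit_ball" "w \<in> unit_ball"
  shows "cosh_half (act \<gamma> z) (act \<gamma> w) = cosh_half z w"
proof -
  define i j where "i = cmod (aut_factor \<gamma> z)" and "j = cmod (aut_factor \<gamma> w)"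
  have ij: "i \<noteq> 0" "j \<noteq> 0" using assms by (simp_all add: i_def j_def aut_factor_nonzero)
  have "cmod (hyp_form z w) = i * j * cmod (hyp_form (act \<gamma> z) (act \<gamma> w))"
    using hyp_form_act[OF assms, symmetric] by (simp add: norm_mult i_def j_def)
  then show ?thesis
    using assms ij sqrt_weight_act[OF assms(1,2), symmetric] sqrt_weight_act[OF assms(1,3), symmetric]
    by (simp add: cosh_half_eq act_in_ball i_def[symmetric] j_def[symmetric])
qed

lemma cosh_half_act_right:
  assumes "\<gamma> \<in> carrier SU21" "z \<in> unit_ball" "w \<in> unit_ball"
  shows "cosh_half z (act \<gamma> w) =
    cmod (hform (\<gamma> *v lift w) (lift z)) / (sqrt (defect z) * sqrt (defect w))"
proof -
  define j where "j = cmod (aut_factor \<gamma> w)"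
  have j: "j \<noteq> 0" using assms by (simp add: j_def aut_factor_nonzero)
  have "cmod (hyp_form z (act \<gamma> w)) = cmod (hyp_form (act \<gamma> w) z)"
    by (metis cnj_hyp_form complex_mod_cnj)
  then show ?thesis
    using assms j sqrt_weight_act[OF assms(1,3), symmetric]
    by (simp add: cosh_half_eq act_in_ball hform_act norm_mult j_def[symmetric])
qed

lemma aut_forms_derivative:
  assumes "f \<in> aut_forms m \<Gamma>" "z \<in> unit_ball"
  obtains f' where "(f has_derivative f') (at z)" "\<And>c v. f' (c *s v) = c * f' v"
proof -
  have "holomorphic2_on f unit_ball" using assms(1) by (simp add: aut_forms_def)
  then have "\<exists>f'. (f has_derivative f') (at z) \<and> (\<forall>c v. f' (c *s v) = c * f' v)"
    using assms(2) unfolding holomorphic2_on_def by (rule bspec)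
  then show ?thesis using that by blast
qed

lemma zero_aut_form: "(\<lambda>z. 0) \<in> aut_forms m \<Gamma>"
  by (auto simp: aut_forms_def holomorphic2_on_def intro!: exI[of _ "\<lambda>v. 0"])

lemma aut_forms_cmult: "f \<in> aut_forms m \<Gamma> \<Longrightarrow> (\<lambda>z. c * f z) \<in> aut_forms m \<Gamma>"
proof -
  assume f: "f \<in> aut_forms m \<Gamma>"
  have "holomorphic2_on (\<lambda>z. c * f z) unit_ball"
    unfolding holomorphic2_on_def
  proof
    fix z assume "z \<in> unit_ball"
    then obtain f' where "(f has_derivative f') (at z)" "\<And>c v. f' (c *s v) = c * f' v"
      using aut_forms_derivative[OF f] by blast
    then show "\<exists>f'. ((\<lambda>z. c * f z) has_derivative f') (at z) \<and> (\<forall>c v. f' (c *s v) = c * f' v)"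
      by (intro exI[of _ "\<lambda>v. c * f' v"]) (auto intro: has_derivative_mult_right)
  qed
  then show ?thesis using f by (auto simp: aut_forms_def)
qed

lemma aut_forms_add:
  assumes "f \<in> aut_forms m \<Gamma>" "g \<in> aut_forms m \<Gamma>"
  shows "(\<lambda>z. f z + g z) \<in> aut_forms m \<Gamma>"
proof -
  have "holomorphic2_on (\<lambda>z. f z + g z) unit_ball"
    unfolding holomorphic2_on_def
  proof
    fix z assume z: "z \<in> unit_ball"
    obtain f' where f': "(f has_derivative f') (at z)" "\<And>c v. f' (c *s v) = c * f' v"
      using aut_forms_derivative[OF assms(1) z] by blast
    obtain g' where g': "(g has_derivative g') (at z)" "\<And>c v. g' (c *s v) = c * g' v"
      using aut_forms_derivative[OF assms(2) z] by blast
    show "\<exists>f'. ((\<lambda>z. f z + g z) has_derivative f') (at z) \<and> (\<forall>c v. f' (c *s v) = c * f' v)"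
      using f' g' by (intro exI[of _ "\<lambda>v. f' v + g' v"]) (auto intro: has_derivative_add simp: distrib_left)
  qed
  then show ?thesis using assms by (auto simp: aut_forms_def distrib_left)
qed

lemma aut_forms_sum:
  assumes "finite E" "E \<subseteq> aut_forms m \<Gamma>"
  shows "(\<lambda>z. \<Sum>f\<in>E. a f * f z) \<in> aut_forms m \<Gamma>"
  using assms
proof (induction E rule: finite_induct)
  case empty
  then show ?case by (simp add: zero_aut_form)
next
  case (insert f E)
  then have "(\<lambda>z. a f * f z + (\<Sum>f\<in>E. a f * f z)) \<in> aut_forms m \<Gamma>"
    by (intro aut_forms_add aut_forms_cmult) auto
  then show ?case using insert by simp
qed

context ball_lattice
begin

text \<open>
  Moving \<open>z\<close> by \<open>\<alpha>\<close> and \<open>w\<close> by \<open>\<beta>\<close> only reindexes the sum by \<open>\<gamma> \<mapsto> \<alpha> \<gamma> \<beta>\<^bsup>-1\<^esup>\<close>, so both points may be assumed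
  to lie in a fixed smaller ball. There every summand is dominated by \<open>|\<gamma>\<^sub>3\<^sub>3|\<^bsup>-6\<^esup>\<close>.
\<close>

lemma uniform_lattice_sum:
  "\<exists>C\<ge>0. \<forall>z\<in>unit_ball. \<forall>w\<in>unit_ball. integrable counting (\<lambda>\<gamma>. 1 / cosh_half z (act \<gamma> w) ^ 6) \<and>
     (\<integral>\<gamma>. 1 / cosh_half z (act \<gamma> w) ^ 6 \<partial>counting) \<le> C"
proof -
  obtain r where r: "r < 1" "0 < r" "\<And>z. z \<in> unit_ball \<Longrightarrow> \<exists>\<gamma>\<in>\<Gamma>. norm (act \<gamma> z) < r"
    using orbits_meet_smaller_ball by blast
  define \<kappa> where "\<kappa> = (1 - r) * (1 - r)"
  have \<kappa>: "0 < \<kappa>" using r by (simp add: \<kappa>_def)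
  define L where "L = (\<integral>\<gamma>. 1 / \<kappa> ^ 6 * (1 / cmod (\<gamma>$3$3) ^ 6) \<partial>counting)"
  have Li: "integrable counting (\<lambda>\<gamma>. 1 / \<kappa> ^ 6 * (1 / cmod (\<gamma>$3$3) ^ 6))"
    by (intro integrable_mult_right summable_lattice)
  have small: "1 / cosh_half z (act \<gamma> w) ^ 6 \<le> 1 / \<kappa> ^ 6 * (1 / cmod (\<gamma>$3$3) ^ 6)"
    if \<gamma>: "\<gamma> \<in> \<Gamma>" and z: "norm z < r" and w: "norm w < r" for \<gamma> z w
  proof -
    have B: "z \<in> unit_ball" "w \<in> unit_ball" using z w r by (auto simp: unit_ball_def)
    define d where "d = cmod (\<gamma>$3$3)"
    have d: "1 \<le> d" using SU21_33_ge_1 \<gamma> by (simp add: d_def)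
    have "d * \<kappa> \<le> d * ((1 - norm z) * (1 - norm w))"
      unfolding \<kappa>_def using d z w r by (intro mult_left_mono mult_mono) auto
    also have "\<dots> \<le> cmod (hform (\<gamma> *v lift w) (lift z))"
      using hform_lower[OF in_SU21[OF \<gamma>] B] by (simp add: d_def)
    also have "\<dots> \<le> cosh_half z (act \<gamma> w)"
    proof -
      define s where "s = sqrt (defect z) * sqrt (defect w)"
      have s: "0 < s" "s \<le> 1" using B by (auto simp: s_def unit_ball_sq intro!: mult_le_one)
      have "cmod (hform (\<gamma> *v lift w) (lift z)) * s \<le> cmod (hform (\<gamma> *v lift w) (lift z)) * 1"
        using s by (intro mult_left_mono) auto
      then show ?thesis
        using s unfolding cosh_half_act_right[OF in_SU21[OF \<gamma>] B] s_def[symmetric] by (simp add: field_simps)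
    qed
    finally have "(d * \<kappa>) ^ 6 \<le> cosh_half z (act \<gamma> w) ^ 6"
      using d \<kappa> by (intro power_mono) auto
    moreover have "0 < (d * \<kappa>) ^ 6" using d \<kappa> by simp
    ultimately have "1 / cosh_half z (act \<gamma> w) ^ 6 \<le> 1 / (d * \<kappa>) ^ 6"
      by (intro frac_le) auto
    then show ?thesis by (simp add: d_def power_mult_distrib mult.commute)
  qed
  have "integrable counting (\<lambda>\<gamma>. 1 / cosh_half z (act \<gamma> w) ^ 6) \<and>
     (\<integral>\<gamma>. 1 / cosh_half z (act \<gamma> w) ^ 6 \<partial>counting) \<le> L"
    if z: "z \<in> unit_ball" and w: "w \<in> unit_ball" for z w
  proof -
    obtain \<alpha> \<beta> where \<alpha>: "\<alpha> \<in> \<Gamma>" "norm (act \<alpha> z) < r" and \<beta>: "\<beta> \<in> \<Gamma>" "norm (act \<beta> w) < r"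
      using r(3) z w by metis
    define \<phi> where "\<phi> \<gamma> = \<alpha> ** (\<gamma> ** inverse21 \<beta>)" for \<gamma>
    have left: "bij_betw (\<lambda>\<gamma>. \<alpha> ** \<gamma>) \<Gamma> \<Gamma>"
      using \<alpha> SU21_closed[of \<alpha>] by (intro bij_betw_byWitness[where f' = "\<lambda>\<gamma>. inverse21 \<alpha> ** \<gamma>"])
        (auto simp: mult_closed inverse_closed matrix_mul_assoc)
    have bij: "bij_betw \<phi> \<Gamma> \<Gamma>"
      using bij_betw_trans[OF bij_mult_right[OF inverse_closed[OF \<beta>(1)]] left] by (simp add: \<phi>_def[abs_def] o_def)
    define z' w' where "z' = act \<alpha> z" and "w' = act \<beta> w"
    have eq: "cosh_half z (act \<gamma> w) = cosh_half z' (act (\<phi> \<gamma>) w')" if \<gamma>: "\<gamma> \<in> \<Gamma>" for \<gamma>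
    proof -
      have "act (\<phi> \<gamma>) w' = act \<alpha> (act \<gamma> w)"
        using \<alpha> \<beta> \<gamma> w unfolding \<phi>_def w'_def
        by (simp add: act_mult mult_closed inverse_closed act_in_ball act_inverse)
      then show ?thesis using \<alpha> \<gamma> z w by (simp add: z'_def cosh_half_act act_in_ball)
    qed
    have cong: "(\<integral>\<gamma>. 1 / cosh_half z (act \<gamma> w) ^ 6 \<partial>counting) = (\<integral>\<gamma>. 1 / cosh_half z' (act (\<phi> \<gamma>) w') ^ 6 \<partial>counting)"
      by (intro Bochner_Integration.integral_cong) (auto simp: eq)
    have "integrable counting (\<lambda>\<gamma>. 1 / cosh_half z' (act \<gamma> w') ^ 6)"
      by (rule integrable_count_space_bound[OF Li])
        (use small \<alpha> \<beta> cosh_half_ge_1 in \<open>auto simp: z'_def w'_def intro: order_trans[OF zero_le_one]\<close>)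
    moreover from this have "(\<integral>\<gamma>. 1 / cosh_half z' (act \<gamma> w') ^ 6 \<partial>counting) \<le> L"
      unfolding L_def by (rule integral_mono[OF _ Li]) (use small \<alpha> \<beta> in \<open>auto simp: z'_def w'_def\<close>)
    moreover have "integrable counting (\<lambda>\<gamma>. 1 / cosh_half z (act \<gamma> w) ^ 6)
       \<longleftrightarrow> integrable counting (\<lambda>\<gamma>. 1 / cosh_half z' (act (\<phi> \<gamma>) w') ^ 6)"
      by (intro Bochner_Integration.integrable_cong) (auto simp: eq)
    ultimately show ?thesis
      unfolding cong using integrable_bij_count_space[OF bij, of "\<lambda>\<gamma>. 1 / cosh_half z' (act \<gamma> w') ^ 6"]
        integral_bij_count_space[OF bij, of "\<lambda>\<gamma>. 1 / cosh_half z' (act \<gamma> w') ^ 6"] by simp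
  qed
  moreover have "0 \<le> L" unfolding L_def using \<kappa> by (intro Bochner_Integration.integral_nonneg) auto
  ultimately show ?thesis by blast
qed

lemma poincare_le_cosh_sum:
  assumes z: "z \<in> unit_ball" and w: "w \<in> unit_ball" and m: "6 \<le> m"
  shows "integrable counting (\<lambda>\<gamma>. 1 / cosh_half z (act \<gamma> w) ^ m)"
    and "sqrt (defect z) ^ m * sqrt (defect w) ^ m * cmod (poincare m z w)
     \<le> (\<integral>\<gamma>. 1 / cosh_half z (act \<gamma> w) ^ m \<partial>counting)"
proof -
  define s where "s = sqrt (defect z) * sqrt (defect w)"
  have s: "0 < s" using z w by (simp add: s_def unit_ball_sq)
  have t: "s ^ m * cmod (poincare_term m z \<gamma> w) = 1 / cosh_half z (act \<gamma> w) ^ m" if \<gamma>: "\<gamma> \<in> \<Gamma>" for \<gamma>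
    using s unfolding cosh_half_act_right[OF in_SU21[OF \<gamma>] z w] s_def[symmetric]
    by (simp add: poincare_term_def norm_divide norm_power power_divide)
  have "integrable counting (\<lambda>\<gamma>. 1 / cosh_half z (act \<gamma> w) ^ 6)"
    using uniform_lattice_sum z w by blast
  then show int: "integrable counting (\<lambda>\<gamma>. 1 / cosh_half z (act \<gamma> w) ^ m)"
  proof (rule integrable_count_space_bound)
    fix \<gamma>
    have "cosh_half z (act \<gamma> w) ^ 6 \<le> cosh_half z (act \<gamma> w) ^ m"
      by (rule power_increasing[OF m cosh_half_ge_1])
    moreover have "0 < cosh_half z (act \<gamma> w)" using cosh_half_ge_1[of z "act \<gamma> w"] by linarith
    ultimately show "norm (1 / cosh_half z (act \<gamma> w) ^ m) \<le> 1 / cosh_half z (act \<gamma> w) ^ 6"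
      by (simp add: frac_le)
  qed
  have "cmod (poincare m z w) \<le> (\<integral>\<gamma>. cmod (poincare_term m z \<gamma> w) \<partial>counting)"
    using w by (simp add: poincare_def integral_norm_bound)
  then have "s ^ m * cmod (poincare m z w) \<le> s ^ m * (\<integral>\<gamma>. cmod (poincare_term m z \<gamma> w) \<partial>counting)"
    using s by (intro mult_left_mono) auto
  also have "\<dots> = (\<integral>\<gamma>. s ^ m * cmod (poincare_term m z \<gamma> w) \<partial>counting)" by simp
  also have "\<dots> = (\<integral>\<gamma>. 1 / cosh_half z (act \<gamma> w) ^ m \<partial>counting)"
    by (intro Bochner_Integration.integral_cong) (auto simp: t)
  finally show "sqrt (defect z) ^ m * sqrt (defect w) ^ m * cmod (poincare m z w)
     \<le> (\<integral>\<gamma>. 1 / cosh_half z (act \<gamma> w) ^ m \<partial>counting)"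
    by (simp add: s_def power_mult_distrib)
qed

section \<open>The inner product space of automorphic forms\<close>

lemma integrable_form_inner:
  assumes f: "f \<in> forms k" and g: "g \<in> forms k"
  shows "integrable dom_volume (\<lambda>z. of_real (defect z ^ (3 * k)) * f z * cnj (g z))"
proof -
  obtain A where A: "0 \<le> A" "\<And>z. z \<in> unit_ball \<Longrightarrow> (cmod (f z))\<^sup>2 * defect z ^ (3 * k) \<le> A\<^sup>2"
    using aut_form_bounded[OF f] by blast
  obtain B where B: "0 \<le> B" "\<And>z. z \<in> unit_ball \<Longrightarrow> (cmod (g z))\<^sup>2 * defect z ^ (3 * k) \<le> B\<^sup>2"
    using aut_form_bounded[OF g] by blast
  have cm: "cnj \<in> borel_measurable borel" by (intro borel_measurable_continuous_onI continuous_intros)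
  have [measurable]: "f \<in> borel_measurable borel" "(\<lambda>z. cnj (g z)) \<in> borel_measurable borel"
    using aut_form_measurable[OF f] measurable_compose[OF aut_form_measurable[OF g] cm] by auto
  interpret finite_measure dom_volume by (rule finite_dom_volume)
  show ?thesis
  proof (rule integrable_const_bound[of _ "A * B"])
    show "AE z in dom_volume. cmod (of_real (defect z ^ (3 * k)) * f z * cnj (g z)) \<le> A * B"
      using AE_dom_volume
    proof eventually_elim
      case (elim z)
      then have z: "z \<in> unit_ball" using fund_dom_subset by blast
      define q where "q = defect z ^ (3 * k)"
      have q: "0 \<le> q" using z by (auto simp: q_def unit_ball_sq intro!: zero_le_power)
      have "(q * cmod (f z) * cmod (g z))\<^sup>2 = ((cmod (f z))\<^sup>2 * q) * ((cmod (g z))\<^sup>2 * q)"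
        by (simp add: power2_eq_square)
      also have "\<dots> \<le> A\<^sup>2 * B\<^sup>2" using A(2)[OF z] B(2)[OF z] q by (intro mult_mono) (auto simp: q_def)
      also have "\<dots> = (A * B)\<^sup>2" by (simp add: power_mult_distrib)
      finally have "q * cmod (f z) * cmod (g z) \<le> A * B"
        by (rule power2_le_imp_le) (use A B in simp)
      moreover have "cmod (of_real q * f z * cnj (g z)) = q * cmod (f z) * cmod (g z)"
        using q by (simp add: norm_mult)
      ultimately show ?case by (simp only: q_def)
    qed
  qed measurable
qed

lemma form_inner_eq:
  assumes "f \<in> forms k" "g \<in> forms k"
  shows "ip k f g = (\<integral>z. of_real (defect z ^ (3 * k)) * f z * cnj (g z) \<partial>dom_volume)"
  by (rule form_inner_dom_volume) (use assms aut_form_measurable in auto)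

lemma form_inner_add_left:
  assumes "f \<in> forms k" "g \<in> forms k" "h \<in> forms k"
  shows "ip k (\<lambda>z. f z + g z) h = ip k f h + ip k g h"
  using integrable_form_inner[OF assms(1,3)] integrable_form_inner[OF assms(2,3)]
  by (simp add: form_inner_eq aut_forms_add assms distrib_left distrib_right)

lemma form_inner_cmult_left:
  assumes "f \<in> forms k" "h \<in> forms k"
  shows "ip k (\<lambda>z. c * f z) h = c * ip k f h"
proof -
  have "(\<lambda>z. of_real (defect z ^ (3 * k)) * (c * f z) * cnj (h z))
      = (\<lambda>z. c * (of_real (defect z ^ (3 * k)) * f z * cnj (h z)))"
    by (simp add: fun_eq_iff mult_ac)
  then show ?thesis
    by (simp add: form_inner_eq aut_forms_cmult assms del: of_real_power of_real_diff)
qed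

lemma form_inner_cnj:
  assumes "f \<in> forms k" "g \<in> forms k"
  shows "cnj (ip k f g) = ip k g f"
proof -
  have "cnj (ip k f g) = (\<integral>z. cnj (of_real (defect z ^ (3 * k)) * f z * cnj (g z)) \<partial>dom_volume)"
    unfolding form_inner_eq[OF assms] by (rule Bochner_Integration.integral_cnj[symmetric])
  also have "\<dots> = ip k g f"
    unfolding form_inner_eq[OF assms(2,1)] by (simp add: mult_ac)
  finally show ?thesis .
qed

lemma form_inner_sum_left:
  assumes "finite E" "E \<subseteq> forms k" "h \<in> forms k"
  shows "ip k (\<lambda>z. \<Sum>f\<in>E. a f * f z) h = (\<Sum>f\<in>E. a f * ip k f h)"
  using assms
proof (induction E rule: finite_induct)
  case empty
  then show ?case using form_inner_cmult_left[OF zero_aut_form, of h k 0] by simp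
next
  case (insert f E)
  have "ip k (\<lambda>z. a f * f z + (\<Sum>f\<in>E. a f * f z)) h
      = ip k (\<lambda>z. a f * f z) h + ip k (\<lambda>z. \<Sum>f\<in>E. a f * f z) h"
    using insert by (intro form_inner_add_left aut_forms_cmult aut_forms_sum) auto
  then show ?case using insert by (simp add: form_inner_cmult_left)
qed

lemma form_inner_self:
  assumes f: "f \<in> forms k"
  shows "ip k f f = of_real (\<integral>z. defect z ^ (3 * k) * (cmod (f z))\<^sup>2 \<partial>dom_volume)"
    and "integrable dom_volume (\<lambda>z. defect z ^ (3 * k) * (cmod (f z))\<^sup>2)"
    and "0 \<le> (\<integral>z. defect z ^ (3 * k) * (cmod (f z))\<^sup>2 \<partial>dom_volume)"
proof -
  have eq: "(\<lambda>z. of_real (defect z ^ (3 * k)) * f z * cnj (f z))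
      = (\<lambda>z. complex_of_real (defect z ^ (3 * k) * (cmod (f z))\<^sup>2))"
    unfolding of_real_mult complex_norm_square by (simp add: mult.assoc)
  show "ip k f f = of_real (\<integral>z. defect z ^ (3 * k) * (cmod (f z))\<^sup>2 \<partial>dom_volume)"
    unfolding form_inner_eq[OF f f] eq by (rule integral_complex_of_real)
  show "integrable dom_volume (\<lambda>z. defect z ^ (3 * k) * (cmod (f z))\<^sup>2)"
    using integrable_form_inner[OF f f] unfolding eq by (simp only: complex_of_real_integrable_eq)
  have "AE z in dom_volume. 0 \<le> defect z ^ (3 * k) * (cmod (f z))\<^sup>2"
    using AE_dom_volume
  proof eventually_elim
    case (elim z)
    then have "0 \<le> defect z" using fund_dom_subset by (auto simp: unit_ball_sq dest!: subsetD)
    then show ?case by simp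
  qed
  then show "0 \<le> (\<integral>z. defect z ^ (3 * k) * (cmod (f z))\<^sup>2 \<partial>dom_volume)"
    by (rule integral_nonneg_AE)
qed

text \<open>
  A form of norm zero vanishes almost everywhere on the domain, so it is orthogonal to every Poincare
  series; by the reproducing property it then vanishes at every point.
\<close>

lemma form_inner_definite:
  assumes f: "f \<in> forms k" and k: "2 \<le> k" and zero: "ip k f f = 0"
  shows "f = (\<lambda>z. 0)"
proof
  fix z
  have "(\<integral>z. defect z ^ (3 * k) * (cmod (f z))\<^sup>2 \<partial>dom_volume) = 0"
    using zero unfolding form_inner_self(1)[OF f] by simp
  moreover have "AE z in dom_volume. 0 \<le> defect z ^ (3 * k) * (cmod (f z))\<^sup>2"
    using AE_dom_volume
  proof eventually_elim
    case (elim z)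
    then have "0 \<le> defect z" using fund_dom_subset by (auto simp: unit_ball_sq dest!: subsetD)
    then show ?case by simp
  qed
  ultimately have "AE z in dom_volume. defect z ^ (3 * k) * (cmod (f z))\<^sup>2 = 0"
    using integral_nonneg_eq_0_iff_AE[OF form_inner_self(2)[OF f]] by simp
  then have AE0: "AE z in dom_volume. f z = 0"
    using AE_dom_volume
  proof eventually_elim
    case (elim z)
    then have "(norm z)\<^sup>2 < 1" using fund_dom_subset by (auto simp: unit_ball_sq dest!: subsetD)
    then show ?case using elim by simp
  qed
  show "f z = 0"
  proof (cases "z \<in> unit_ball")
    case True
    define P where "P = poincare (3 * k) z"
    have P: "P \<in> forms k"
      unfolding P_def by (rule poincare_aut_form[OF True]) (use k in simp)
    have "ip k f P = 0"
      unfolding form_inner_eq[OF f P]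
      by (rule integral_eq_zero_AE) (use AE0 in \<open>auto elim!: AE_mp\<close>)
    then show ?thesis
      using reproducing_kernel[OF f k True] weight_volume_pos[of "3 * k"] k by (simp add: P_def)
  next
    case False
    then show ?thesis using f by (simp add: aut_forms_def)
  qed
qed

definition orthonormal :: "nat \<Rightarrow> (complex^2 \<Rightarrow> complex) set \<Rightarrow> bool" where
  "orthonormal k E \<longleftrightarrow> finite E \<and> E \<subseteq> forms k \<and>
     (\<forall>f\<in>E. \<forall>g\<in>E. ip k f g = (if f = g then 1 else 0))"

lemma form_inner_orthonormal_sum:
  assumes E: "orthonormal k E" and g: "g \<in> E"
  shows "ip k (\<lambda>z. \<Sum>f\<in>E. a f * f z) g = a g"
proof -
  have "ip k (\<lambda>z. \<Sum>f\<in>E. a f * f z) g = (\<Sum>f\<in>E. a f * ip k f g)"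
    using E g by (intro form_inner_sum_left) (auto simp: orthonormal_def)
  also have "\<dots> = (\<Sum>f\<in>E. if f = g then a f else 0)"
    using E g by (intro sum.cong refl) (auto simp: orthonormal_def)
  also have "\<dots> = a g" using E g by (simp add: orthonormal_def)
  finally show ?thesis .
qed

text \<open>
  The Riesz representative of evaluation at \<open>z\<close>.
\<close>

definition bergman_section :: "nat \<Rightarrow> complex^2 \<Rightarrow> complex^2 \<Rightarrow> complex" where
  "bergman_section k z = (\<lambda>w. inverse (of_real (weight_volume (3 * k))) * poincare (3 * k) z w)"

lemma bergman_section:
  assumes k: "2 \<le> k" and z: "z \<in> unit_ball"
  shows "bergman_section k z \<in> forms k"
    and "f \<in> forms k \<Longrightarrow> ip k f (bergman_section k z) = f z"
proof -
  have P: "poincare (3 * k) z \<in> forms k"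
    by (rule poincare_aut_form[OF z]) (use k in simp)
  then show R: "bergman_section k z \<in> forms k"
    unfolding bergman_section_def by (rule aut_forms_cmult)
  assume f: "f \<in> forms k"
  have V: "weight_volume (3 * k) \<noteq> 0" using weight_volume_pos[of "3 * k"] k by simp
  have "ip k f (bergman_section k z) = cnj (ip k (bergman_section k z) f)"
    by (rule form_inner_cnj[OF R f, symmetric])
  also have "\<dots> = inverse (of_real (weight_volume (3 * k))) * ip k f (poincare (3 * k) z)"
    unfolding bergman_section_def form_inner_cmult_left[OF P f] by (simp add: form_inner_cnj[OF P f])
  also have "\<dots> = f z" using V by (simp add: reproducing_kernel[OF f k z])
  finally show "ip k f (bergman_section k z) = f z" .
qed

lemma cmod_bergman_section:
  assumes "2 \<le> k"
  shows "cmod (bergman_section k z w) = cmod (poincare (3 * k) z w) / weight_volume (3 * k)"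
proof -
  have "0 < weight_volume (3 * k)" using assms by (intro weight_volume_pos) simp
  then show ?thesis
    unfolding bergman_section_def norm_mult norm_inverse norm_of_real by (simp only: abs_of_pos divide_inverse mult.commute)
qed

text \<open>
  Bessel's inequality for the vector \<open>R = bergman_section k z\<close>: its coefficients are \<open>cnj (f z)\<close> and its
  squared norm is \<open>R z\<close>, both by the reproducing property.
\<close>

lemma bessel:
  assumes E: "orthonormal k E" and k: "2 \<le> k" and z: "z \<in> unit_ball"
  shows "(\<Sum>f\<in>E. (cmod (f z))\<^sup>2) \<le> cmod (bergman_section k z z)"
proof -
  define R where "R = bergman_section k z"
  have R: "R \<in> forms k" and rep: "\<And>f. f \<in> forms k \<Longrightarrow> ip k f R = f z"
    using bergman_section[OF k z] by (auto simp: R_def)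
  define s where "s = (\<Sum>f\<in>E. (cmod (f z))\<^sup>2)"
  define h where "h = (\<lambda>w. \<Sum>f\<in>E. cnj (f z) * f w)"
  have E': "finite E" "E \<subseteq> forms k" using E by (auto simp: orthonormal_def)
  have h: "h \<in> forms k" unfolding h_def by (rule aut_forms_sum[OF E'])
  have hz: "h z = of_real s"
    unfolding h_def s_def of_real_sum complex_norm_square by (simp add: mult.commute)
  have hf: "ip k f h = f z" if "f \<in> E" for f
  proof -
    have "ip k h f = cnj (f z)"
      unfolding h_def by (rule form_inner_orthonormal_sum[OF E that])
    then show ?thesis using form_inner_cnj[OF h, of f] that E' by auto
  qed
  have hh: "ip k h h = of_real s"
  proof -
    have "ip k h h = (\<Sum>f\<in>E. cnj (f z) * ip k f h)"
      by (subst (1) h_def, rule form_inner_sum_left[OF E' h])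
    then show ?thesis unfolding hz[symmetric] by (simp add: hf) (simp add: h_def)
  qed
  define p where "p = (\<lambda>w. R w + (-1) * h w)"
  have mh: "(\<lambda>w. (-1) * h w) \<in> forms k" by (rule aut_forms_cmult[OF h])
  have p: "p \<in> forms k" unfolding p_def by (rule aut_forms_add[OF R mh])
  have left: "ip k p g = ip k R g - ip k h g" if "g \<in> forms k" for g
    unfolding p_def form_inner_add_left[OF R mh that] form_inner_cmult_left[OF h that] by simp
  have pR: "ip k p R = R z - of_real s"
    using rep[OF p] by (simp add: p_def hz)
  have ph: "ip k p h = 0"
    unfolding left[OF h] hh using form_inner_cnj[OF h R] rep[OF h] hz by simp
  have "ip k p p = cnj (ip k R p - ip k h p)"
    using left[OF p] form_inner_cnj[OF p p] by simp
  also have "\<dots> = ip k p R - ip k p h"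
    by (simp add: form_inner_cnj p R h)
  finally have "ip k p p = R z - of_real s" by (simp add: pR ph)
  moreover obtain c where "ip k p p = of_real c" "0 \<le> c"
    using form_inner_self(1,3)[OF p] by blast
  ultimately have "0 \<le> Re (R z - of_real s)"
    by (metis Re_complex_of_real)
  then show ?thesis
    using complex_Re_le_cmod[of "R z"] unfolding s_def[symmetric] R_def[symmetric] by simp
qed

text \<open>
  Integrate Bessel's inequality over the domain. The left-hand side gives the number of forms; the
  right-hand side is bounded because the domain has finite volume and the diagonal of the Poincare
  series is bounded by the uniform lattice sum.
\<close>

lemma orthonormal_card_bounded:
  assumes k: "2 \<le> k"
  shows "\<exists>N. \<forall>E. orthonormal k E \<longrightarrow> card E \<le> N"
proof -
  define m where "m = 3 * k"
  have m: "6 \<le> m" using k by (simp add: m_def)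
  obtain C where C: "0 \<le> C" "\<And>z w. z \<in> unit_ball \<Longrightarrow> w \<in> unit_ball \<Longrightarrow>
      integrable counting (\<lambda>\<gamma>. 1 / cosh_half z (act \<gamma> w) ^ 6) \<and>
      (\<integral>\<gamma>. 1 / cosh_half z (act \<gamma> w) ^ 6 \<partial>counting) \<le> C"
    using uniform_lattice_sum by blast
  define V where "V = weight_volume m"
  have V: "0 < V" using m by (simp add: V_def weight_volume_pos)
  have diag: "defect z ^ m * cmod (bergman_section k z z) \<le> C / V" if z: "z \<in> unit_ball" for z
  proof -
    have "defect z ^ m * cmod (poincare m z z) = sqrt (defect z) ^ m * sqrt (defect z) ^ m * cmod (poincare m z z)"
      using z by (simp add: power_mult_distrib[symmetric] unit_ball_sq less_imp_le)
    also have "\<dots> \<le> (\<integral>\<gamma>. 1 / cosh_half z (act \<gamma> z) ^ m \<partial>counting)"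
      by (rule poincare_le_cosh_sum(2)[OF z z m])
    also have "\<dots> \<le> (\<integral>\<gamma>. 1 / cosh_half z (act \<gamma> z) ^ 6 \<partial>counting)"
    proof (rule integral_mono[OF poincare_le_cosh_sum(1)[OF z z m]])
      show "integrable counting (\<lambda>\<gamma>. 1 / cosh_half z (act \<gamma> z) ^ 6)" using C(2)[OF z z] by simp
      show "1 / cosh_half z (act \<gamma> z) ^ m \<le> 1 / cosh_half z (act \<gamma> z) ^ 6" for \<gamma>
        using cosh_half_ge_1[of z "act \<gamma> z"] m by (intro frac_le power_increasing) auto
    qed
    also have "\<dots> \<le> C" using C(2)[OF z z] by simp
    finally have "defect z ^ m * cmod (poincare m z z) / V \<le> C / V"
      using V by (simp add: divide_right_mono)
    moreover have "cmod (bergman_section k z z) = cmod (poincare m z z) / V"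
      using cmod_bergman_section[OF k] by (simp only: m_def V_def)
    ultimately show ?thesis by simp
  qed
  interpret finite_measure dom_volume by (rule finite_dom_volume)
  have "real (card E) \<le> C / V * measure dom_volume (space dom_volume)" if E: "orthonormal k E" for E
  proof -
    have E': "finite E" "E \<subseteq> forms k" using E by (auto simp: orthonormal_def)
    have one: "(\<integral>z. defect z ^ m * (cmod (f z))\<^sup>2 \<partial>dom_volume) = 1" if "f \<in> E" for f
    proof -
      have "ip k f f = 1" using E that by (auto simp: orthonormal_def)
      moreover have "f \<in> forms k" using that E' by blast
      ultimately have "complex_of_real (\<integral>z. defect z ^ m * (cmod (f z))\<^sup>2 \<partial>dom_volume) = 1"
        unfolding m_def by (simp only: form_inner_self(1)[symmetric])
      then show ?thesis by (simp only: of_real_eq_1_iff)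
    qed
    have int: "integrable dom_volume (\<lambda>z. defect z ^ m * (cmod (f z))\<^sup>2)" if "f \<in> E" for f
      unfolding m_def using that E' by (intro form_inner_self(2)) auto
    have "real (card E) = (\<Sum>f\<in>E. \<integral>z. defect z ^ m * (cmod (f z))\<^sup>2 \<partial>dom_volume)"
      by (simp add: one)
    also have "\<dots> = (\<integral>z. (\<Sum>f\<in>E. defect z ^ m * (cmod (f z))\<^sup>2) \<partial>dom_volume)"
      by (rule Bochner_Integration.integral_sum[symmetric]) (rule int)
    also have "\<dots> \<le> (\<integral>z. C / V \<partial>dom_volume)"
    proof (rule integral_mono_AE)
      show "integrable dom_volume (\<lambda>z. \<Sum>f\<in>E. defect z ^ m * (cmod (f z))\<^sup>2)"
        by (rule Bochner_Integration.integrable_sum) (rule int)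
      show "AE z in dom_volume. (\<Sum>f\<in>E. defect z ^ m * (cmod (f z))\<^sup>2) \<le> C / V"
        using AE_dom_volume
      proof eventually_elim
        case (elim z)
        then have z: "z \<in> unit_ball" using fund_dom_subset by blast
        have "(\<Sum>f\<in>E. defect z ^ m * (cmod (f z))\<^sup>2) = defect z ^ m * (\<Sum>f\<in>E. (cmod (f z))\<^sup>2)"
          by (simp add: sum_distrib_left)
        also have "\<dots> \<le> defect z ^ m * cmod (bergman_section k z z)"
          using z bessel[OF E k z] by (intro mult_left_mono) (auto simp: unit_ball_sq)
        also have "\<dots> \<le> C / V" by (rule diag[OF z])
        finally show ?case .
      qed
    qed simp
    also have "\<dots> = C / V * measure dom_volume (space dom_volume)" by simp
    finally show ?thesis .
  qed
  moreover obtain N :: nat where "C / V * measure dom_volume (space dom_volume) \<le> real N"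
    using real_arch_simple by blast
  ultimately have "\<forall>E. orthonormal k E \<longrightarrow> card E \<le> N" by (meson of_nat_le_iff order_trans)
  then show ?thesis by blast
qed

text \<open>
  An orthonormal set of maximal size spans: otherwise the normalized residual of some form could be
  added to it.
\<close>

lemma orthonormal_basis_exists:
  assumes k: "2 \<le> k"
  shows "\<exists>E. orthonormal_basis \<Gamma> k E"
proof -
  obtain N where N: "\<And>E. orthonormal k E \<Longrightarrow> card E \<le> N"
    using orthonormal_card_bounded[OF k] by blast
  have "orthonormal k {}" by (simp add: orthonormal_def)
  then obtain E where E: "orthonormal k E" and max: "\<And>E'. orthonormal k E' \<Longrightarrow> card E' \<le> card E"
    using ex_has_greatest_nat[of "orthonormal k" "{}" card "Suc N"] N by (metis le_imp_less_Suc)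
  have E': "finite E" "E \<subseteq> forms k" using E by (auto simp: orthonormal_def)
  have span: "\<exists>a. g = (\<lambda>z. \<Sum>f\<in>E. a f * f z)" if g: "g \<in> forms k" for g
  proof -
    define a where "a f = ip k g f" for f
    define h where "h = (\<lambda>z. \<Sum>f\<in>E. a f * f z)"
    have h: "h \<in> forms k" unfolding h_def by (rule aut_forms_sum[OF E'])
    define p where "p = (\<lambda>z. g z + (-1) * h z)"
    have mh: "(\<lambda>w. (-1) * h w) \<in> forms k" by (rule aut_forms_cmult[OF h])
    have p: "p \<in> forms k" unfolding p_def by (rule aut_forms_add[OF g mh])
    have pf: "ip k p f = 0" if f: "f \<in> E" for f
    proof -
      have fS: "f \<in> forms k" using f E' by blast
      have "ip k h f = a f" unfolding h_def by (rule form_inner_orthonormal_sum[OF E f])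
      then show ?thesis
        unfolding p_def form_inner_add_left[OF g mh fS] form_inner_cmult_left[OF h fS] by (simp add: a_def)
    qed
    have "ip k p p = 0"
    proof (rule ccontr)
      assume ne: "ip k p p \<noteq> 0"
      define c where "c = (\<integral>z. defect z ^ (3 * k) * (cmod (p z))\<^sup>2 \<partial>dom_volume)"
      have pp: "ip k p p = of_real c" and c0: "0 \<le> c"
        using form_inner_self[OF p] by (simp_all add: c_def)
      have c: "0 < c" using ne pp c0 by (cases "c = 0") auto
      define t where "t = complex_of_real (1 / sqrt c)"
      define e where "e = (\<lambda>z. t * p z)"
      have e: "e \<in> forms k" unfolding e_def by (rule aut_forms_cmult[OF p])
      have ef: "ip k e f = 0" if "f \<in> E" for f
        unfolding e_def using form_inner_cmult_left[OF p, of f t] pf[OF that] E' that by auto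
      have fe: "ip k f e = 0" if "f \<in> E" for f
        using form_inner_cnj[OF e, of f] ef[OF that] E' that by auto
      have pe: "ip k p e = t * of_real c"
      proof -
        have "ip k e p = t * of_real c"
          unfolding e_def using form_inner_cmult_left[OF p p, of t] pp by simp
        then show ?thesis using form_inner_cnj[OF e p] by (simp add: t_def)
      qed
      have ee: "ip k e e = 1"
      proof -
        have "ip k e e = t * (t * of_real c)"
          using form_inner_cmult_left[OF p e, of t] pe by (simp add: e_def)
        also have "\<dots> = of_real (1 / sqrt c * (1 / sqrt c * c))" by (simp only: t_def of_real_mult)
        also have "1 / sqrt c * (1 / sqrt c * c) = 1" using c by (simp add: field_simps)
        finally show ?thesis by simp
      qed
      have "e \<notin> E" using ee ef[of e] by auto
      moreover have "orthonormal k (insert e E)"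
        using E e ee ef fe \<open>e \<notin> E\<close> unfolding orthonormal_def by auto
      ultimately show False using max[of "insert e E"] E' by simp
    qed
    then have "p = (\<lambda>z. 0)" by (rule form_inner_definite[OF p k])
    then have "g = h" by (simp add: p_def fun_eq_iff)
    then show ?thesis unfolding h_def by blast
  qed
  then show ?thesis
    using E unfolding orthonormal_basis_def orthonormal_def by blast
qed

section \<open>The estimate of the Bergman kernel\<close>

text \<open>
  Expand the section in the orthonormal basis; by the reproducing property its coefficients are
  \<open>cnj (f z)\<close>.
\<close>

theorem bergman_kernel_eq:
  assumes k: "2 \<le> k" and z: "z \<in> unit_ball"
  shows "bergman_kernel \<Gamma> k z w = cnj (bergman_section k z w)"
proof -
  define E where "E = (SOME E. orthonormal_basis \<Gamma> k E)"
  have basis: "orthonormal_basis \<Gamma> k E"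
    unfolding E_def using orthonormal_basis_exists[OF k] by (rule someI_ex)
  then have E: "orthonormal k E" by (auto simp: orthonormal_basis_def orthonormal_def)
  have R: "bergman_section k z \<in> forms k" by (rule bergman_section(1)[OF k z])
  then obtain a where a: "bergman_section k z = (\<lambda>w. \<Sum>f\<in>E. a f * f w)"
    using basis unfolding orthonormal_basis_def by blast
  have "a f = cnj (f z)" if f: "f \<in> E" for f
  proof -
    have fS: "f \<in> forms k" using E f by (auto simp: orthonormal_def)
    have "a f = ip k (bergman_section k z) f"
      unfolding a by (rule form_inner_orthonormal_sum[OF E f, symmetric])
    also have "\<dots> = cnj (ip k f (bergman_section k z))"
      by (rule form_inner_cnj[OF fS R, symmetric])
    finally show ?thesis using bergman_section(2)[OF k z fS] by simp
  qed
  then have "bergman_section k z w = (\<Sum>f\<in>E. cnj (f z) * f w)"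
    unfolding a by (intro sum.cong) auto
  then show ?thesis by (simp add: bergman_kernel_def E_def[symmetric])
qed

lemma cosh_quotient_dist_le:
  assumes z: "z \<in> unit_ball" and w: "w \<in> unit_ball" and \<gamma>: "\<gamma> \<in> \<Gamma>"
  shows "cosh (quotient_dist \<Gamma> z w / 2) \<le> cosh_half z (act \<gamma> w)"
proof -
  have nn: "0 \<le> hyp_dist z (act \<gamma> w)" if "\<gamma> \<in> \<Gamma>" for \<gamma>
    using that z w by (intro cosh_hyp_dist(1) act_in_ball) auto
  have "quotient_dist \<Gamma> z w \<le> hyp_dist z (act \<gamma> w)"
    unfolding quotient_dist_def using nn \<gamma> by (intro cINF_lower) (auto intro!: bdd_belowI2)
  moreover have "0 \<le> quotient_dist \<Gamma> z w"
    unfolding quotient_dist_def using nn one_closed by (intro cINF_greatest) auto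
  ultimately show ?thesis
    unfolding cosh_half_def by (subst cosh_real_nonneg_le_iff) auto
qed

theorem bergman_norm_bound:
  "\<exists>c>0. \<forall>k\<ge>3. \<forall>z\<in>unit_ball. \<forall>w\<in>unit_ball.
     bergman_norm \<Gamma> k z w \<le> c * ((real k)\<^sup>2 / cosh (quotient_dist \<Gamma> z w / 2) ^ (3 * k - 8))"
proof -
  obtain C where C: "0 \<le> C" "\<And>z w. z \<in> unit_ball \<Longrightarrow> w \<in> unit_ball \<Longrightarrow>
      integrable counting (\<lambda>\<gamma>. 1 / cosh_half z (act \<gamma> w) ^ 6) \<and>
      (\<integral>\<gamma>. 1 / cosh_half z (act \<gamma> w) ^ 6 \<partial>counting) \<le> C"
    using uniform_lattice_sum by blast
  define \<beta> where "\<beta> = measure lborel (ball (0::complex^2) 1)"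
  have \<beta>: "0 < \<beta>" unfolding \<beta>_def by (rule unit_ball_measure_pos)
  \<comment> \<open>The factor 72 is 8 times 9, from the bound on \<open>weight_volume\<close> at \<open>m = 3k\<close>.\<close>
  define c where "c = 72 / \<beta> * (C + 1)"
  have "bergman_norm \<Gamma> k z w \<le> c * ((real k)\<^sup>2 / cosh (quotient_dist \<Gamma> z w / 2) ^ (3 * k - 8))"
    if k: "3 \<le> k" and z: "z \<in> unit_ball" and w: "w \<in> unit_ball" for k z w
  proof -
    define m where "m = 3 * k"
    have m: "6 \<le> m" "8 \<le> m" "3 \<le> m" using k by (simp_all add: m_def)
    define V where "V = weight_volume m"
    have V: "0 < V" using m by (simp add: V_def weight_volume_pos)
    define X where "X = cosh (quotient_dist \<Gamma> z w / 2)"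
    have X: "1 \<le> X" by (simp add: X_def cosh_real_ge_1)
    have pw: "defect u powr (3 * real k / 2) = sqrt (defect u) ^ m" if "u \<in> unit_ball" for u :: "complex^2"
    proof -
      have q: "0 < defect u" using that by (simp add: unit_ball_sq)
      have "sqrt (defect u) ^ m = sqrt (defect u) powr real m"
        using q by (simp add: powr_realpow)
      also have "\<dots> = defect u powr (1/2 * real m)"
        using q by (simp add: powr_half_sqrt[symmetric] powr_powr)
      finally show ?thesis by (simp add: m_def)
    qed
    have "bergman_norm \<Gamma> k z w = sqrt (defect z) ^ m * sqrt (defect w) ^ m * cmod (poincare m z w) / V"
    proof -
      have "2 \<le> k" using k by simp
      then have "cmod (bergman_kernel \<Gamma> k z w) = cmod (poincare m z w) / V"
        unfolding bergman_kernel_eq[OF \<open>2 \<le> k\<close> z] complex_mod_cnj m_def V_def by (rule cmod_bergman_section)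
      then show ?thesis unfolding bergman_norm_def pw[OF z] pw[OF w] by simp
    qed
    also have "\<dots> \<le> (\<integral>\<gamma>. 1 / cosh_half z (act \<gamma> w) ^ m \<partial>counting) / V"
      using V poincare_le_cosh_sum(2)[OF z w m(1)] by (intro divide_right_mono) auto
    also have "(\<integral>\<gamma>. 1 / cosh_half z (act \<gamma> w) ^ m \<partial>counting)
       \<le> (\<integral>\<gamma>. 1 / X ^ (m - 8) * (1 / cosh_half z (act \<gamma> w) ^ 6) \<partial>counting)"
    proof (rule integral_mono[OF poincare_le_cosh_sum(1)[OF z w m(1)]])
      show "integrable counting (\<lambda>\<gamma>. 1 / X ^ (m - 8) * (1 / cosh_half z (act \<gamma> w) ^ 6))"
        using C(2)[OF z w] by (intro integrable_mult_right) simp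
      fix \<gamma> assume "\<gamma> \<in> space counting"
      then have \<gamma>: "\<gamma> \<in> \<Gamma>" by simp
      define y where "y = cosh_half z (act \<gamma> w)"
      have y: "1 \<le> y" "X \<le> y"
        using cosh_half_ge_1 cosh_quotient_dist_le[OF z w \<gamma>] by (auto simp: y_def X_def)
      \<comment> \<open>Six of the eight remaining factors already make the series converge.\<close>
      have "X ^ (m - 8) * y ^ 6 \<le> y ^ (m - 8) * y ^ 8"
        using X y by (intro mult_mono power_mono power_increasing) auto
      also have "\<dots> = y ^ m" using m by (simp flip: power_add)
      finally have "1 / y ^ m \<le> 1 / (X ^ (m - 8) * y ^ 6)"
        using X y by (intro frac_le) auto
      then show "1 / cosh_half z (act \<gamma> w) ^ m \<le> 1 / X ^ (m - 8) * (1 / cosh_half z (act \<gamma> w) ^ 6)"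
        by (simp add: y_def)
    qed
    also have "(\<integral>\<gamma>. 1 / X ^ (m - 8) * (1 / cosh_half z (act \<gamma> w) ^ 6) \<partial>counting)
        = 1 / X ^ (m - 8) * (\<integral>\<gamma>. 1 / cosh_half z (act \<gamma> w) ^ 6 \<partial>counting)"
      by (rule integral_mult_right_zero)
    also have "\<dots> \<le> 1 / X ^ (m - 8) * (C + 1)"
      using C(2)[OF z w] X by (intro mult_left_mono) auto
    finally have 1: "bergman_norm \<Gamma> k z w \<le> 1 / X ^ (m - 8) * (C + 1) / V"
      using V by (simp add: divide_right_mono)
    have "1 / V \<le> 72 / \<beta> * (real k)\<^sup>2"
    proof -
      have kpos: "0 < real k" using k by simp
      have "\<beta> / (8 * (real m)\<^sup>2) \<le> V"
        unfolding V_def \<beta>_def by (rule weight_volume_ge[OF m(3)])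
      moreover have "0 < \<beta> / (8 * (real m)\<^sup>2)" using \<beta> kpos by (simp add: m_def)
      ultimately have "1 / V \<le> 1 / (\<beta> / (8 * (real m)\<^sup>2))" by (intro frac_le) auto
      also have "\<dots> = 72 / \<beta> * (real k)\<^sup>2" by (simp add: m_def power_mult_distrib)
      finally show ?thesis .
    qed
    then have "1 / X ^ (m - 8) * (C + 1) * (1 / V) \<le> 1 / X ^ (m - 8) * (C + 1) * (72 / \<beta> * (real k)\<^sup>2)"
      using X C(1) by (intro mult_left_mono) auto
    with 1 have "bergman_norm \<Gamma> k z w \<le> 1 / X ^ (m - 8) * (C + 1) * (72 / \<beta> * (real k)\<^sup>2)" by simp
    also have "\<dots> = c * ((real k)\<^sup>2 / X ^ (m - 8))" using \<beta> X by (simp add: c_def field_simps)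
    finally show ?thesis by (simp add: X_def m_def)
  qed
  moreover have "0 < c" using \<beta> C(1) by (simp add: c_def)
  ultimately show ?thesis by blast
qed

end

theorem theorem1:
  fixes \<Gamma> :: "(complex^3^3) set"
  assumes "subgroup \<Gamma> SU21" and "discrete \<Gamma>" and "torsion_free \<Gamma>" and "cocompact \<Gamma>"
  shows "\<exists>c>0. \<forall>k::nat. k \<ge> 3 \<longrightarrow>
    (\<forall>p\<in>ball_quotient \<Gamma>. \<forall>q\<in>ball_quotient \<Gamma>. \<forall>z\<in>p. \<forall>w\<in>q.
       bergman_norm \<Gamma> k z w
         \<le> c * ((real k)\<^sup>2 / cosh (quotient_dist \<Gamma> z w / 2) ^ (3 * k - 8)))"
proof -
  interpret ball_lattice \<Gamma> by (rule ball_lattice.intro[OF assms])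
  have ball: "z \<in> unit_ball" if "p \<in> ball_quotient \<Gamma>" "z \<in> p" for z p
    using that act_in_ball by (auto simp: ball_quotient_def orbits_def orbit_def)
  obtain c where "c > 0" "\<And>k z w. 3 \<le> k \<Longrightarrow> z \<in> unit_ball \<Longrightarrow> w \<in> unit_ball \<Longrightarrow>
      bergman_norm \<Gamma> k z w \<le> c * ((real k)\<^sup>2 / cosh (quotient_dist \<Gamma> z w / 2) ^ (3 * k - 8))"
    using bergman_norm_bound by blast
  then show ?thesis using ball by (intro exI[of _ c]) blast
qed

end
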